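(* Let $(H,\mu_H,\Delta_H,\alpha_H,R)$ be a quasitriangular Hom-bialgebra with $\alpha_H$ bijective and $(\alpha_H\otimes\alpha_H)(R)=R$. Denote by ${}_H\mathcal M$ the category whose objects are left $H$-modules $(M,\alpha_M)$ with $\alpha_M$ bijective and whose morphisms are morphisms of left $H$-modules. Then ${}_H\mathcal M$ is a quasi-braided pre-tensor subcategory of ${}_H^H\mathcal{YD}$ (the latter with the structure $\hat\otimes$, $a$, $c$ recalled in the context), with tensor product $(M\otimes N,\alpha_M\otimes\alpha_N)$ with action $h\cdot(m\otimes n)=h_1\cdot m\otimes h_2\cdot n$, associativity constraints $a_{M,N,P}((m\otimes n)\otimes p)=\alpha_M^{-1}(m)\otimes(n\otimes\alpha_P(p))$ for $M,N,P\in{}_H\mathcal M$, and quasi-braiding $c_{M,N}:M\otimes N\to N\otimes M$, $c_{M,N}(m\otimes n)=\alpha_N^{-1}(R^2\cdot n)\otimes\alpha_M^{-1}(R^1\cdot m)$ for all $M,N\in{}_H\mathcal M$. Here a left $H$-module $(M,\alpha_M)$ is regarded as an object of ${}_H^H\mathcal{YD}$ via the coaction $M\to H\otimes M$, $m\mapsto\alpha_H(R^2)\otimes R^1\cdot m$.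
   Context: Everything is over a field $k$, $\otimes=\otimes_k$; (co)algebras are not assumed (co)unital. Sweedler notation: $\Delta(h)=h_1\otimes h_2$; multiplications are written by juxtaposition. A Hom-bialgebra is $(H,\mu,\Delta,\alpha)$ with $\mu:H\otimes H\to H$, $\Delta:H\to H\otimes H$, $\alpha:H\to H$ linear such that for all $h,h',h''$: $\alpha(hh')=\alpha(h)\alpha(h')$; $\alpha(h)(h'h'')=(hh')\alpha(h'')$; $\Delta(h_1)\otimes\alpha(h_2)=\alpha(h_1)\otimes\Delta(h_2)$; $\Delta(hh')=h_1h'_1\otimes h_2h'_2$; $\Delta(\alpha(h))=\alpha(h_1)\otimes\alpha(h_2)$. It is quasitriangular, with $R=R^1\otimes R^2=r^1\otimes r^2\in H\otimes H$ (summation understood), if $(\Delta\otimes\alpha)(R)=\alpha(R^1)\otimes\alpha(r^1)\otimes R^2r^2$, $(\alpha\otimes\Delta)(R)=R^1r^1\otimes\alpha(r^2)\otimes\alpha(R^2)$, and $\Delta^{cop}(h)R=R\Delta(h)$ for all $h\in H$, where $\Delta^{cop}(h)=h_2\otimes h_1$ and $H\otimes H$ has the componentwise multiplication. Let $(H,\mu_H,\Delta_H,\alpha_H)$ be a Hom-bialgebra, $M$ a linear space, $\alpha_M:M\to M$ linear. $(M,\alpha_M)$ is a left $H$-module if there is a linear map $H\otimes M\to M$, $h\otimes m\mapsto h\cdot m$, with $\alpha_M(h\cdot m)=\alpha_H(h)\cdot\alpha_M(m)$ and $\alpha_H(h)\cdot(h'\cdot m)=(hh')\cdot\alpha_M(m)$.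 It is a left $H$-comodule if there is a linear map $\lambda_M:M\to H\otimes M$, $\lambda_M(m)=m_{(-1)}\otimes m_{(0)}$, with $(\alpha_H\otimes\alpha_M)\circ\lambda_M=\lambda_M\circ\alpha_M$ and $(\Delta_H\otimes\alpha_M)\circ\lambda_M=(\alpha_H\otimes\lambda_M)\circ\lambda_M$. A morphism $f:M\to N$ of left $H$-modules is a linear map with $\alpha_N\circ f=f\circ\alpha_M$ and $f(h\cdot m)=h\cdot f(m)$; a morphism of left $H$-comodules is a linear map with $\alpha_N\circ f=f\circ\alpha_M$ and $(id_H\otimes f)\circ\lambda_M=\lambda_N\circ f$. $(M,\alpha_M)$ is a (left-left) Yetter-Drinfeld module over $H$ if it is both a left $H$-module and a left $H$-comodule and, for all $h\in H$, $m\in M$, $$(h_1\cdot m)_{(-1)}\alpha_H^2(h_2)\otimes(h_1\cdot m)_{(0)}=\alpha_H^2(h_1)\alpha_H(m_{(-1)})\otimes\alpha_H(h_2)\cdot m_{(0)}.$$ For $\alpha_H$ bijective, ${}_H^H\mathcal{YD}$ is the category whose objects are Yetter-Drinfeld modules $(M,\alpha_M)$ over $H$ with $\alpha_M$ bijective, and whose morphisms are the maps that are morphisms of both left $H$-modules and left $H$-comodules. A pre-tensor category $(\mathcal C,\otimes,a)$ satisfies all the axioms of a tensor (monoidal) category except that no unit object or unit constraints are required: $\otimes$ is a bifunctor and $a_{U,V,W}:(U\otimes V)\otimes W\to U\otimes(V\otimes W)$ is a natural isomorphism satisfying the pentagon axiom. A quasi-braiding is a family of natural morphisms $c_{V,W}:V\otimes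 W\to W\otimes V$ (not required to be isomorphisms) satisfying the two hexagon axioms $a_{V,W,U}\circ c_{U,V\otimes W}\circ a_{U,V,W}=(id_V\otimes c_{U,W})\circ a_{V,U,W}\circ(c_{U,V}\otimes id_W)$ and $a_{W,U,V}^{-1}\circ c_{U\otimes V,W}\circ a_{U,V,W}^{-1}=(c_{U,W}\otimes id_V)\circ a_{U,W,V}^{-1}\circ(id_U\otimes c_{V,W})$. Then $(\mathcal C,\otimes,a,c)$ is a quasi-braided pre-tensor category. A quasi-braided pre-tensor subcategory is a subcategory which is itself a quasi-braided pre-tensor category with tensor product, associativity constraints and quasi-braiding being those of the ambient category. The quasi-braided pre-tensor structure on ${}_H^H\mathcal{YD}$ used here: $M\hat\otimes N=(M\otimes N,\alpha_M\otimes\alpha_N)$ with action $h\cdot(m\otimes n)=h_1\cdot m\otimes h_2\cdot n$ and coaction $m\otimes n\mapsto\alpha_H^{-2}(m_{(-1)}n_{(-1)})\otimes(m_{(0)}\otimes n_{(0)})$; $a_{M,N,P}((m\otimes n)\otimes p)=\alpha_M^{-1}(m)\otimes(n\otimes\alpha_P(p))$; $c_{M,N}(m\otimes n)=\alpha_N^{-1}(\alpha_H^{-1}(m_{(-1)})\cdot n)\otimes\alpha_M^{-1}(m_{(0)})$. *)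

theory Defs
  imports "HOL-Algebra.Module" "HOL-Library.FuncSet"
begin

section \<open>Quasi-braided pre-tensor categories\<close>

record ('o, 'm) category_data =
  Obj :: "'o set"
  Arr :: "'m set"
  Dom :: "'m \<Rightarrow> 'o"
  Cod :: "'m \<Rightarrow> 'o"
  Id :: "'o \<Rightarrow> 'm"
  Comp :: "'m \<Rightarrow> 'm \<Rightarrow> 'm"  (infixr \<open>\<cdot>\<index>\<close> 65)

record ('o, 'm) pre_tensor_data = "('o, 'm) category_data" +
  TenO :: "'o \<Rightarrow> 'o \<Rightarrow> 'o"  (infixl \<open>\<diamondop>\<index>\<close> 75)
  TenA :: "'m \<Rightarrow> 'm \<Rightarrow> 'm"  (infixl \<open>\<bowtie>\<index>\<close> 75)
  Assoc :: "'o \<Rightarrow> 'o \<Rightarrow> 'o \<Rightarrow> 'm"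

record ('o, 'm) braided_data = "('o, 'm) pre_tensor_data" +
  Braid :: "'o \<Rightarrow> 'o \<Rightarrow> 'm"

definition Hom :: "('o, 'm, 'z) category_data_scheme \<Rightarrow> 'o \<Rightarrow> 'o \<Rightarrow> 'm set" where
  "Hom C A B = {f \<in> Arr C. Dom C f = A \<and> Cod C f = B}"

definition inverse_arrows :: "('o, 'm, 'z) category_data_scheme \<Rightarrow> 'm \<Rightarrow> 'm \<Rightarrow> bool" where
  "inverse_arrows C f g \<longleftrightarrow>
     g \<in> Hom C (Cod C f) (Dom C f) \<and>
     g \<cdot>\<^bsub>C\<^esub> f = Id C (Dom C f) \<and> f \<cdot>\<^bsub>C\<^esub> g = Id C (Cod C f)"

definition Inv :: "('o, 'm, 'z) category_data_scheme \<Rightarrow> 'm \<Rightarrow> 'm" where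
  "Inv C f = (THE g. inverse_arrows C f g)"

locale category =
  fixes C (structure)
  assumes dom_closed: "f \<in> Arr C \<Longrightarrow> Dom C f \<in> Obj C"
    and cod_closed: "f \<in> Arr C \<Longrightarrow> Cod C f \<in> Obj C"
    and id_hom: "A \<in> Obj C \<Longrightarrow> Id C A \<in> Hom C A A"
    and comp_hom: "\<lbrakk>f \<in> Hom C A B; g \<in> Hom C B D\<rbrakk> \<Longrightarrow> g \<cdot> f \<in> Hom C A D"
    and comp_id: "f \<in> Hom C A B \<Longrightarrow> f \<cdot> Id C A = f"
    and id_comp: "f \<in> Hom C A B \<Longrightarrow> Id C B \<cdot> f = f"
    and comp_assoc: "\<lbrakk>f \<in> Hom C A B; g \<in> Hom C B D; h \<in> Hom C D E\<rbrakk> \<Longrightarrow>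
      (h \<cdot> g) \<cdot> f = h \<cdot> (g \<cdot> f)"

locale pre_tensor_category = category +
  assumes tenO_closed: "\<lbrakk>A \<in> Obj C; B \<in> Obj C\<rbrakk> \<Longrightarrow> A \<diamondop> B \<in> Obj C"
    and tenA_hom: "\<lbrakk>f \<in> Hom C A B; g \<in> Hom C A' B'\<rbrakk> \<Longrightarrow> f \<bowtie> g \<in> Hom C (A \<diamondop> A') (B \<diamondop> B')"
    and tenA_id: "\<lbrakk>A \<in> Obj C; B \<in> Obj C\<rbrakk> \<Longrightarrow> Id C A \<bowtie> Id C B = Id C (A \<diamondop> B)"
    and tenA_comp: "\<lbrakk>f \<in> Hom C A B; g \<in> Hom C B D; f' \<in> Hom C A' B'; g' \<in> Hom C B' D'\<rbrakk> \<Longrightarrow>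
      (g \<cdot> f) \<bowtie> (g' \<cdot> f') = (g \<bowtie> g') \<cdot> (f \<bowtie> f')"
    and assoc_hom: "\<lbrakk>U \<in> Obj C; V \<in> Obj C; W \<in> Obj C\<rbrakk> \<Longrightarrow>
      Assoc C U V W \<in> Hom C ((U \<diamondop> V) \<diamondop> W) (U \<diamondop> (V \<diamondop> W))"
    and assoc_iso: "\<lbrakk>U \<in> Obj C; V \<in> Obj C; W \<in> Obj C\<rbrakk> \<Longrightarrow>
      \<exists>g. inverse_arrows C (Assoc C U V W) g"
    and assoc_natural: "\<lbrakk>f \<in> Hom C U U'; g \<in> Hom C V V'; h \<in> Hom C W W'\<rbrakk> \<Longrightarrow>
      Assoc C U' V' W' \<cdot> ((f \<bowtie> g) \<bowtie> h) = (f \<bowtie> (g \<bowtie> h)) \<cdot> Assoc C U V W"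
    and pentagon: "\<lbrakk>U \<in> Obj C; V \<in> Obj C; W \<in> Obj C; X \<in> Obj C\<rbrakk> \<Longrightarrow>
      (Id C U \<bowtie> Assoc C V W X) \<cdot> Assoc C U (V \<diamondop> W) X \<cdot> (Assoc C U V W \<bowtie> Id C X)
        = Assoc C U V (W \<diamondop> X) \<cdot> Assoc C (U \<diamondop> V) W X"

locale quasi_braided_pre_tensor_category = pre_tensor_category +
  assumes braid_hom: "\<lbrakk>V \<in> Obj C; W \<in> Obj C\<rbrakk> \<Longrightarrow> Braid C V W \<in> Hom C (V \<diamondop> W) (W \<diamondop> V)"
    and braid_natural: "\<lbrakk>f \<in> Hom C V V'; g \<in> Hom C W W'\<rbrakk> \<Longrightarrow>
      Braid C V' W' \<cdot> (f \<bowtie> g) = (g \<bowtie> f) \<cdot> Braid C V W"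
    and hexagon1: "\<lbrakk>U \<in> Obj C; V \<in> Obj C; W \<in> Obj C\<rbrakk> \<Longrightarrow>
      Assoc C V W U \<cdot> Braid C U (V \<diamondop> W) \<cdot> Assoc C U V W
        = (Id C V \<bowtie> Braid C U W) \<cdot> Assoc C V U W \<cdot> (Braid C U V \<bowtie> Id C W)"
    and hexagon2: "\<lbrakk>U \<in> Obj C; V \<in> Obj C; W \<in> Obj C\<rbrakk> \<Longrightarrow>
      Inv C (Assoc C W U V) \<cdot> Braid C (U \<diamondop> V) W \<cdot> Inv C (Assoc C U V W)
        = (Braid C U W \<bowtie> Id C V) \<cdot> Inv C (Assoc C U W V) \<cdot> (Id C U \<bowtie> Braid C V W)"

text \<open>
  \<open>C\<close> is a quasi-braided pre-tensor subcategory of \<open>D\<close>, its objects \<open>A\<close> and arrows \<open>f\<close> being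
  regarded as the objects \<open>Fo A\<close> and the arrows \<open>Fa f\<close> of \<open>D\<close>. All structure of \<open>C\<close> has to agree
  with that of \<open>D\<close> on the nose (equality, not isomorphism).
\<close>

locale quasi_braided_pre_tensor_subcategory =
  C: quasi_braided_pre_tensor_category C + D: quasi_braided_pre_tensor_category D
  for C :: "('o, 'm, 'z) braided_data_scheme"
    and D :: "('p, 'n, 'y) braided_data_scheme"
    and Fo :: "'o \<Rightarrow> 'p" and Fa :: "'m \<Rightarrow> 'n" +
  assumes obj_closed: "A \<in> Obj C \<Longrightarrow> Fo A \<in> Obj D"
    and obj_inj: "inj_on Fo (Obj C)"
    and arr_closed: "f \<in> Hom C A B \<Longrightarrow> Fa f \<in> Hom D (Fo A) (Fo B)"
    and arr_inj: "inj_on Fa (Arr C)"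
    and same_id: "A \<in> Obj C \<Longrightarrow> Fa (Id C A) = Id D (Fo A)"
    and same_comp: "\<lbrakk>f \<in> Hom C A B; g \<in> Hom C B E\<rbrakk> \<Longrightarrow> Fa (g \<cdot>\<^bsub>C\<^esub> f) = Fa g \<cdot>\<^bsub>D\<^esub> Fa f"
    and same_tenO: "\<lbrakk>A \<in> Obj C; B \<in> Obj C\<rbrakk> \<Longrightarrow> Fo (A \<diamondop>\<^bsub>C\<^esub> B) = Fo A \<diamondop>\<^bsub>D\<^esub> Fo B"
    and same_tenA: "\<lbrakk>f \<in> Arr C; g \<in> Arr C\<rbrakk> \<Longrightarrow> Fa (f \<bowtie>\<^bsub>C\<^esub> g) = Fa f \<bowtie>\<^bsub>D\<^esub> Fa g"
    and same_assoc: "\<lbrakk>A \<in> Obj C; B \<in> Obj C; E \<in> Obj C\<rbrakk> \<Longrightarrow>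
      Fa (Assoc C A B E) = Assoc D (Fo A) (Fo B) (Fo E)"
    and same_braid: "\<lbrakk>A \<in> Obj C; B \<in> Obj C\<rbrakk> \<Longrightarrow> Fa (Braid C A B) = Braid D (Fo A) (Fo B)"


section \<open>Tensor products of vector spaces\<close>

text \<open>
  To have a category of vector spaces that is closed under tensor products, all spaces have their
  carriers in a type \<open>'a univ\<close>, which is closed under forming finite formal sums of pairs. Every
  vector space over an arbitrary type \<open>'a\<close> has a copy in it by means of \<open>Atom\<close>.
\<close>

datatype 'a univ = Atom 'a | Formal (terms: "('a univ \<times> 'a univ) list")

type_synonym ('k, 'a) vect = "('k, 'a univ) module"

context
  fixes K :: "('k, 'r) ring_scheme"
begin

definition linear_maps :: "('k, 'u) module \<Rightarrow> ('k, 'v) module \<Rightarrow> ('u \<Rightarrow> 'v) set" where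
  "linear_maps V W = {f \<in> carrier V \<rightarrow>\<^sub>E carrier W.
     (\<forall>x \<in> carrier V. \<forall>y \<in> carrier V. f (x \<oplus>\<^bsub>V\<^esub> y) = f x \<oplus>\<^bsub>W\<^esub> f y) \<and>
     (\<forall>c \<in> carrier K. \<forall>x \<in> carrier V. f (c \<odot>\<^bsub>V\<^esub> x) = c \<odot>\<^bsub>W\<^esub> f x)}"

text \<open>
  The list \<open>[(v\<^sub>1, w\<^sub>1), \<dots>, (v\<^sub>n, w\<^sub>n)]\<close> stands for the sum of the \<open>v\<^sub>i \<otimes> w\<^sub>i\<close>; \<open>tensor_eq V W\<close> is the
  congruence on such sums that is generated by the relations of the tensor product.
\<close>

inductive tensor_eq :: "('k, 'u) module \<Rightarrow> ('k, 'u) module \<Rightarrow> ('u \<times> 'u) list \<Rightarrow> ('u \<times> 'u) list \<Rightarrow> bool"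
  for V W where
  refl: "xs \<in> lists (carrier V \<times> carrier W) \<Longrightarrow> tensor_eq V W xs xs"
| sym: "tensor_eq V W xs ys \<Longrightarrow> tensor_eq V W ys xs"
| trans: "\<lbrakk>tensor_eq V W xs ys; tensor_eq V W ys zs\<rbrakk> \<Longrightarrow> tensor_eq V W xs zs"
| append: "\<lbrakk>tensor_eq V W xs xs'; tensor_eq V W ys ys'\<rbrakk> \<Longrightarrow> tensor_eq V W (xs @ ys) (xs' @ ys')"
| commute: "\<lbrakk>v \<in> carrier V; w \<in> carrier W; v' \<in> carrier V; w' \<in> carrier W\<rbrakk> \<Longrightarrow>
    tensor_eq V W [(v, w), (v', w')] [(v', w'), (v, w)]"
| zero_left: "w \<in> carrier W \<Longrightarrow> tensor_eq V W [(\<zero>\<^bsub>V\<^esub>, w)] []"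
| zero_right: "v \<in> carrier V \<Longrightarrow> tensor_eq V W [(v, \<zero>\<^bsub>W\<^esub>)] []"
| add_left: "\<lbrakk>v \<in> carrier V; v' \<in> carrier V; w \<in> carrier W\<rbrakk> \<Longrightarrow>
    tensor_eq V W [(v \<oplus>\<^bsub>V\<^esub> v', w)] [(v, w), (v', w)]"
| add_right: "\<lbrakk>v \<in> carrier V; w \<in> carrier W; w' \<in> carrier W\<rbrakk> \<Longrightarrow>
    tensor_eq V W [(v, w \<oplus>\<^bsub>W\<^esub> w')] [(v, w), (v, w')]"
| scale: "\<lbrakk>c \<in> carrier K; v \<in> carrier V; w \<in> carrier W\<rbrakk> \<Longrightarrow>
    tensor_eq V W [(c \<odot>\<^bsub>V\<^esub> v, w)] [(v, c \<odot>\<^bsub>W\<^esub> w)]"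

text \<open>
  A congruence class is encoded by a chosen representative; the choice only depends on the class,
  because the predicates \<open>tensor_eq V W xs\<close> and \<open>tensor_eq V W ys\<close> are equal for congruent \<open>xs\<close>, \<open>ys\<close>.
\<close>

definition tensor_class :: "('k, 'a) vect \<Rightarrow> ('k, 'a) vect \<Rightarrow> ('a univ \<times> 'a univ) list \<Rightarrow> 'a univ" where
  "tensor_class V W xs = Formal (SOME ys. tensor_eq V W xs ys)"

text \<open>
  The fields \<open>mult\<close> and \<open>one\<close> of the record type \<open>module\<close> have no meaning for a vector space.
\<close>

definition tensor :: "('k, 'a) vect \<Rightarrow> ('k, 'a) vect \<Rightarrow> ('k, 'a) vect"  (infixr \<open>\<otimes>\<^sub>v\<close> 75) where
  "V \<otimes>\<^sub>v W =
    \<lparr>carrier = tensor_class V W ` lists (carrier V \<times> carrier W),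
     mult = undefined, one = undefined,
     zero = tensor_class V W [],
     add = (\<lambda>s t. tensor_class V W (terms s @ terms t)),
     smult = (\<lambda>c t. tensor_class V W (map (\<lambda>(v, w). (c \<odot>\<^bsub>V\<^esub> v, w)) (terms t)))\<rparr>"

definition pure :: "'a univ \<Rightarrow> ('k, 'a) vect \<Rightarrow> ('k, 'a) vect \<Rightarrow> 'a univ \<Rightarrow> 'a univ"
    (\<open>(_ \<otimes>\<langle>_,_\<rangle> _)\<close> [76, 0, 0, 75] 75) where
  "v \<otimes>\<langle>V, W\<rangle> w = tensor_class V W [(v, w)]"

text \<open>
  Sweedler notation: for \<open>t = t\<^sub>1 \<otimes> t\<^sub>2\<close> (summation understood) and \<open>f\<close> bilinear with values in \<open>U\<close>,
  \<open>sweedler U t (\<lambda>x y. f x y)\<close> is the element \<open>f t\<^sub>1 t\<^sub>2\<close> of \<open>U\<close>. By bilinearity it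
  does not depend on the representative.
\<close>

definition sweedler :: "('k, 'a) vect \<Rightarrow> 'a univ \<Rightarrow> ('a univ \<Rightarrow> 'a univ \<Rightarrow> 'a univ) \<Rightarrow> 'a univ" where
  "sweedler U t f = foldr (\<lambda>(x, y) s. f x y \<oplus>\<^bsub>U\<^esub> s) (terms t) \<zero>\<^bsub>U\<^esub>"

definition tensor_map :: "('k, 'a) vect \<Rightarrow> ('k, 'a) vect \<Rightarrow> ('k, 'a) vect \<Rightarrow> ('k, 'a) vect \<Rightarrow>
    ('a univ \<Rightarrow> 'a univ) \<Rightarrow> ('a univ \<Rightarrow> 'a univ) \<Rightarrow> 'a univ \<Rightarrow> 'a univ" where
  "tensor_map V W V' W' f g =
    (\<lambda>t \<in> carrier (V \<otimes>\<^sub>v W). sweedler (V' \<otimes>\<^sub>v W') t (\<lambda>v w. f v \<otimes>\<langle>V', W'\<rangle> g w))"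

end


section \<open>Hom-bialgebras and Yetter-Drinfeld modules\<close>

record ('k, 'a) hom_space =
  vs :: "('k, 'a) vect"
  \<alpha> :: "'a univ \<Rightarrow> 'a univ"

record ('k, 'a) hom_bialg = "('k, 'a) hom_space" +
  \<mu> :: "'a univ \<Rightarrow> 'a univ"
  \<Delta> :: "'a univ \<Rightarrow> 'a univ"

record ('k, 'a) hom_module = "('k, 'a) hom_space" +
  act :: "'a univ \<Rightarrow> 'a univ"

record ('k, 'a) hom_yd = "('k, 'a) hom_module" +
  coact :: "'a univ \<Rightarrow> 'a univ"

abbreviation elts :: "('k, 'a, 'z) hom_space_scheme \<Rightarrow> 'a univ set" where
  "elts M \<equiv> carrier (vs M)"

definition \<alpha>_bij :: "('k, 'a, 'z) hom_space_scheme \<Rightarrow> bool" where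
  "\<alpha>_bij M \<longleftrightarrow> bij_betw (\<alpha> M) (elts M) (elts M)"

definition \<alpha>inv :: "('k, 'a, 'z) hom_space_scheme \<Rightarrow> 'a univ \<Rightarrow> 'a univ" where
  "\<alpha>inv M = inv_into (elts M) (\<alpha> M)"

text \<open>Triple tensor products are bracketed to the right, with the usual identification \<open>(x \<otimes> y) \<otimes> z = x \<otimes> (y \<otimes> z)\<close>.\<close>

context
  fixes K :: "('k, 'r) ring_scheme"
    and H :: "('k, 'a) hom_bialg"
begin

abbreviation tensorK  (infixr \<open>\<otimes>\<^sub>v\<close> 75) where "V \<otimes>\<^sub>v W \<equiv> tensor K V W"
abbreviation pureK  (\<open>(_ \<otimes>\<langle>_,_\<rangle> _)\<close> [76, 0, 0, 75] 75) where "v \<otimes>\<langle>V, W\<rangle> w \<equiv> pure K v V W w"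

abbreviation HH :: "('k, 'a) vect" where "HH \<equiv> vs H \<otimes>\<^sub>v vs H"
abbreviation HHH :: "('k, 'a) vect" where "HHH \<equiv> vs H \<otimes>\<^sub>v HH"

abbreviation hmult :: "'a univ \<Rightarrow> 'a univ \<Rightarrow> 'a univ"  (infixl \<open>\<bullet>\<close> 80) where
  "h \<bullet> h' \<equiv> \<mu> H (h \<otimes>\<langle>vs H, vs H\<rangle> h')"

definition hom_bialgebra :: bool where
  "hom_bialgebra \<longleftrightarrow>
     module K (vs H) \<and>
     \<alpha> H \<in> linear_maps K (vs H) (vs H) \<and>
     \<mu> H \<in> linear_maps K HH (vs H) \<and>
     \<Delta> H \<in> linear_maps K (vs H) HH \<and>
     (\<forall>h \<in> elts H. \<forall>h' \<in> elts H. \<alpha> H (h \<bullet> h') = \<alpha> H h \<bullet> \<alpha> H h') \<and>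
     (\<forall>h \<in> elts H. \<forall>h' \<in> elts H. \<forall>h'' \<in> elts H. \<alpha> H h \<bullet> (h' \<bullet> h'') = (h \<bullet> h') \<bullet> \<alpha> H h'') \<and>
     (\<forall>h \<in> elts H.
        sweedler HHH (\<Delta> H h) (\<lambda>h1 h2. sweedler HHH (\<Delta> H h1) (\<lambda>x y.
          x \<otimes>\<langle>vs H, HH\<rangle> (y \<otimes>\<langle>vs H, vs H\<rangle> \<alpha> H h2)))
        = sweedler HHH (\<Delta> H h) (\<lambda>h1 h2. \<alpha> H h1 \<otimes>\<langle>vs H, HH\<rangle> \<Delta> H h2)) \<and>
     (\<forall>h \<in> elts H. \<forall>h' \<in> elts H.
        \<Delta> H (h \<bullet> h') =
          sweedler HH (\<Delta> H h) (\<lambda>h1 h2. sweedler HH (\<Delta> H h') (\<lambda>h1' h2'.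
            (h1 \<bullet> h1') \<otimes>\<langle>vs H, vs H\<rangle> (h2 \<bullet> h2')))) \<and>
     (\<forall>h \<in> elts H.
        \<Delta> H (\<alpha> H h) = sweedler HH (\<Delta> H h) (\<lambda>h1 h2. \<alpha> H h1 \<otimes>\<langle>vs H, vs H\<rangle> \<alpha> H h2))"

text \<open>\<open>R1\<close>, \<open>R2\<close> and \<open>r1\<close>, \<open>r2\<close> are the components of two copies of \<open>R\<close>.\<close>

definition quasitriangular :: "'a univ \<Rightarrow> bool" where
  "quasitriangular R \<longleftrightarrow>
     hom_bialgebra \<and> R \<in> carrier HH \<and>
     sweedler HHH R (\<lambda>R1 R2. sweedler HHH (\<Delta> H R1) (\<lambda>x y.
         x \<otimes>\<langle>vs H, HH\<rangle> (y \<otimes>\<langle>vs H, vs H\<rangle> \<alpha> H R2)))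
       = sweedler HHH R (\<lambda>R1 R2. sweedler HHH R (\<lambda>r1 r2.
           \<alpha> H R1 \<otimes>\<langle>vs H, HH\<rangle> (\<alpha> H r1 \<otimes>\<langle>vs H, vs H\<rangle> (R2 \<bullet> r2)))) \<and>
     sweedler HHH R (\<lambda>R1 R2. \<alpha> H R1 \<otimes>\<langle>vs H, HH\<rangle> \<Delta> H R2)
       = sweedler HHH R (\<lambda>R1 R2. sweedler HHH R (\<lambda>r1 r2.
           (R1 \<bullet> r1) \<otimes>\<langle>vs H, HH\<rangle> (\<alpha> H r2 \<otimes>\<langle>vs H, vs H\<rangle> \<alpha> H R2))) \<and>
     (\<forall>h \<in> elts H.
        sweedler HH (\<Delta> H h) (\<lambda>h1 h2. sweedler HH R (\<lambda>R1 R2.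
          (h2 \<bullet> R1) \<otimes>\<langle>vs H, vs H\<rangle> (h1 \<bullet> R2)))
        = sweedler HH R (\<lambda>R1 R2. sweedler HH (\<Delta> H h) (\<lambda>h1 h2.
            (R1 \<bullet> h1) \<otimes>\<langle>vs H, vs H\<rangle> (R2 \<bullet> h2))))"

abbreviation action  (\<open>(_ \<rhd>\<langle>_\<rangle> _)\<close> [80, 0, 79] 79) where
  "h \<rhd>\<langle>M\<rangle> m \<equiv> act M (h \<otimes>\<langle>vs H, vs M\<rangle> m)"

definition left_module :: "('k, 'a, 'z) hom_module_scheme \<Rightarrow> bool" where
  "left_module M \<longleftrightarrow>
     module K (vs M) \<and>
     \<alpha> M \<in> linear_maps K (vs M) (vs M) \<and>
     act M \<in> linear_maps K (vs H \<otimes>\<^sub>v vs M) (vs M) \<and>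
     (\<forall>h \<in> elts H. \<forall>m \<in> elts M. \<alpha> M (h \<rhd>\<langle>M\<rangle> m) = \<alpha> H h \<rhd>\<langle>M\<rangle> \<alpha> M m) \<and>
     (\<forall>h \<in> elts H. \<forall>h' \<in> elts H. \<forall>m \<in> elts M. \<alpha> H h \<rhd>\<langle>M\<rangle> (h' \<rhd>\<langle>M\<rangle> m) = (h \<bullet> h') \<rhd>\<langle>M\<rangle> \<alpha> M m)"

definition left_comodule :: "('k, 'a) hom_yd \<Rightarrow> bool" where
  "left_comodule M \<longleftrightarrow>
     (let HM = vs H \<otimes>\<^sub>v vs M; HHM = vs H \<otimes>\<^sub>v HM in
     module K (vs M) \<and>
     \<alpha> M \<in> linear_maps K (vs M) (vs M) \<and>
     coact M \<in> linear_maps K (vs M) HM \<and>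
     (\<forall>m \<in> elts M. tensor_map K (vs H) (vs M) (vs H) (vs M) (\<alpha> H) (\<alpha> M) (coact M m) = coact M (\<alpha> M m)) \<and>
     (\<forall>m \<in> elts M.
        sweedler HHM (coact M m) (\<lambda>x n. sweedler HHM (\<Delta> H x) (\<lambda>x1 x2.
          x1 \<otimes>\<langle>vs H, HM\<rangle> (x2 \<otimes>\<langle>vs H, vs M\<rangle> \<alpha> M n)))
        = sweedler HHM (coact M m) (\<lambda>x n. \<alpha> H x \<otimes>\<langle>vs H, HM\<rangle> coact M n)))"

definition yetter_drinfeld :: "('k, 'a) hom_yd \<Rightarrow> bool" where
  "yetter_drinfeld M \<longleftrightarrow>
     left_module M \<and> left_comodule M \<and>
     (let HM = vs H \<otimes>\<^sub>v vs M in
     \<forall>h \<in> elts H. \<forall>m \<in> elts M.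
       sweedler HM (\<Delta> H h) (\<lambda>h1 h2. sweedler HM (coact M (h1 \<rhd>\<langle>M\<rangle> m)) (\<lambda>x n.
         (x \<bullet> \<alpha> H (\<alpha> H h2)) \<otimes>\<langle>vs H, vs M\<rangle> n))
       = sweedler HM (\<Delta> H h) (\<lambda>h1 h2. sweedler HM (coact M m) (\<lambda>x n.
           (\<alpha> H (\<alpha> H h1) \<bullet> \<alpha> H x) \<otimes>\<langle>vs H, vs M\<rangle> (\<alpha> H h2 \<rhd>\<langle>M\<rangle> n))))"

definition module_morphisms ::
    "('k, 'a, 'z) hom_module_scheme \<Rightarrow> ('k, 'a, 'z) hom_module_scheme \<Rightarrow> ('a univ \<Rightarrow> 'a univ) set" where
  "module_morphisms M N = {f \<in> linear_maps K (vs M) (vs N).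
     (\<forall>m \<in> elts M. \<alpha> N (f m) = f (\<alpha> M m)) \<and>
     (\<forall>h \<in> elts H. \<forall>m \<in> elts M. f (h \<rhd>\<langle>M\<rangle> m) = h \<rhd>\<langle>N\<rangle> f m)}"

definition comodule_morphisms ::
    "('k, 'a) hom_yd \<Rightarrow> ('k, 'a) hom_yd \<Rightarrow> ('a univ \<Rightarrow> 'a univ) set" where
  "comodule_morphisms M N = {f \<in> linear_maps K (vs M) (vs N).
     (\<forall>m \<in> elts M. \<alpha> N (f m) = f (\<alpha> M m)) \<and>
     (\<forall>m \<in> elts M. tensor_map K (vs H) (vs M) (vs H) (vs N) (\<lambda>h. h) f (coact M m) = coact N (f m))}"


subsection \<open>The categories\<close>

definition tensor_\<alpha> :: "('k, 'a, 'z) hom_space_scheme \<Rightarrow> ('k, 'a, 'z) hom_space_scheme \<Rightarrow> 'a univ \<Rightarrow> 'a univ" where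
  "tensor_\<alpha> M N = tensor_map K (vs M) (vs N) (vs M) (vs N) (\<alpha> M) (\<alpha> N)"

definition tensor_act :: "('k, 'a, 'z) hom_module_scheme \<Rightarrow> ('k, 'a, 'z) hom_module_scheme \<Rightarrow> 'a univ \<Rightarrow> 'a univ" where
  "tensor_act M N = (let MN = vs M \<otimes>\<^sub>v vs N in
     (\<lambda>t \<in> carrier (vs H \<otimes>\<^sub>v MN). sweedler MN t (\<lambda>h s. sweedler MN s (\<lambda>m n.
       sweedler MN (\<Delta> H h) (\<lambda>h1 h2. (h1 \<rhd>\<langle>M\<rangle> m) \<otimes>\<langle>vs M, vs N\<rangle> (h2 \<rhd>\<langle>N\<rangle> n))))))"

definition tensor_coact :: "('k, 'a) hom_yd \<Rightarrow> ('k, 'a) hom_yd \<Rightarrow> 'a univ \<Rightarrow> 'a univ" where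
  "tensor_coact M N = (let MN = vs M \<otimes>\<^sub>v vs N; HMN = vs H \<otimes>\<^sub>v MN in
     (\<lambda>t \<in> carrier MN. sweedler HMN t (\<lambda>m n.
       sweedler HMN (coact M m) (\<lambda>x m0. sweedler HMN (coact N n) (\<lambda>y n0.
         \<alpha>inv H (\<alpha>inv H (x \<bullet> y)) \<otimes>\<langle>vs H, MN\<rangle> (m0 \<otimes>\<langle>vs M, vs N\<rangle> n0))))))"

definition associator :: "('k, 'a, 'z) hom_space_scheme \<Rightarrow> ('k, 'a, 'z) hom_space_scheme \<Rightarrow>
    ('k, 'a, 'z) hom_space_scheme \<Rightarrow> 'a univ \<Rightarrow> 'a univ" where
  "associator M N P = (let NP = vs N \<otimes>\<^sub>v vs P; MNP = vs M \<otimes>\<^sub>v NP in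
     (\<lambda>t \<in> carrier ((vs M \<otimes>\<^sub>v vs N) \<otimes>\<^sub>v vs P). sweedler MNP t (\<lambda>s p. sweedler MNP s (\<lambda>m n.
       \<alpha>inv M m \<otimes>\<langle>vs M, NP\<rangle> (n \<otimes>\<langle>vs N, vs P\<rangle> \<alpha> P p)))))"

definition yd_braiding :: "('k, 'a) hom_yd \<Rightarrow> ('k, 'a) hom_yd \<Rightarrow> 'a univ \<Rightarrow> 'a univ" where
  "yd_braiding M N = (let NM = vs N \<otimes>\<^sub>v vs M in
     (\<lambda>t \<in> carrier (vs M \<otimes>\<^sub>v vs N). sweedler NM t (\<lambda>m n. sweedler NM (coact M m) (\<lambda>x m0.
       \<alpha>inv N (\<alpha>inv H x \<rhd>\<langle>N\<rangle> n) \<otimes>\<langle>vs N, vs M\<rangle> \<alpha>inv M m0))))"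

definition R_braiding :: "'a univ \<Rightarrow> ('k, 'a) hom_module \<Rightarrow> ('k, 'a) hom_module \<Rightarrow> 'a univ \<Rightarrow> 'a univ" where
  "R_braiding R M N = (let NM = vs N \<otimes>\<^sub>v vs M in
     (\<lambda>t \<in> carrier (vs M \<otimes>\<^sub>v vs N). sweedler NM t (\<lambda>m n. sweedler NM R (\<lambda>R1 R2.
       \<alpha>inv N (R2 \<rhd>\<langle>N\<rangle> n) \<otimes>\<langle>vs N, vs M\<rangle> \<alpha>inv M (R1 \<rhd>\<langle>M\<rangle> m)))))"

text \<open>
  The part that both categories have in common. An arrow \<open>M \<rightarrow> N\<close> is a triple \<open>(M, f, N)\<close> with
  \<open>f\<close> in \<open>mor M N\<close>; \<open>ten\<close> is the tensor product of objects and \<open>br\<close> gives the underlying maps of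
  the quasi-braiding.
\<close>

definition linear_category ::
    "('k, 'a, 'z) hom_space_scheme set \<Rightarrow>
     (('k, 'a, 'z) hom_space_scheme \<Rightarrow> ('k, 'a, 'z) hom_space_scheme \<Rightarrow> ('a univ \<Rightarrow> 'a univ) set) \<Rightarrow>
     (('k, 'a, 'z) hom_space_scheme \<Rightarrow> ('k, 'a, 'z) hom_space_scheme \<Rightarrow> ('k, 'a, 'z) hom_space_scheme) \<Rightarrow>
     (('k, 'a, 'z) hom_space_scheme \<Rightarrow> ('k, 'a, 'z) hom_space_scheme \<Rightarrow> 'a univ \<Rightarrow> 'a univ) \<Rightarrow>
     (('k, 'a, 'z) hom_space_scheme,
      ('k, 'a, 'z) hom_space_scheme \<times> ('a univ \<Rightarrow> 'a univ) \<times> ('k, 'a, 'z) hom_space_scheme) braided_data" where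
  "linear_category obj mor ten br =
    \<lparr>Obj = obj,
     Arr = {(M, f, N). M \<in> obj \<and> N \<in> obj \<and> f \<in> mor M N},
     Dom = (\<lambda>(M, f, N). M),
     Cod = (\<lambda>(M, f, N). N),
     Id = (\<lambda>M. (M, \<lambda>m \<in> elts M. m, M)),
     Comp = (\<lambda>(N', g, P) (M, f, N). (M, compose (elts M) g f, P)),
     TenO = ten,
     TenA = (\<lambda>(M, f, N) (M', f', N').
       (ten M M', tensor_map K (vs M) (vs M') (vs N) (vs N') f f', ten N N')),
     Assoc = (\<lambda>M N P. (ten (ten M N) P, associator M N P, ten M (ten N P))),
     Braid = (\<lambda>M N. (ten M N, br M N, ten N M))\<rparr>"

definition YD where
  "YD = linear_category
     {M :: ('k, 'a) hom_yd. yetter_drinfeld M \<and> \<alpha>_bij M}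
     (\<lambda>M N. module_morphisms M N \<inter> comodule_morphisms M N)
     (\<lambda>M N. \<lparr>vs = vs M \<otimes>\<^sub>v vs N, \<alpha> = tensor_\<alpha> M N, act = tensor_act M N, coact = tensor_coact M N\<rparr>)
     yd_braiding"

definition Mod where
  "Mod R = linear_category
     {M :: ('k, 'a) hom_module. left_module M \<and> \<alpha>_bij M}
     module_morphisms
     (\<lambda>M N. \<lparr>vs = vs M \<otimes>\<^sub>v vs N, \<alpha> = tensor_\<alpha> M N, act = tensor_act M N\<rparr>)
     (R_braiding R)"

definition R_coact :: "'a univ \<Rightarrow> ('k, 'a) hom_module \<Rightarrow> 'a univ \<Rightarrow> 'a univ" where
  "R_coact R M = (let HM = vs H \<otimes>\<^sub>v vs M in
     (\<lambda>m \<in> elts M. sweedler HM R (\<lambda>R1 R2. \<alpha> H R2 \<otimes>\<langle>vs H, vs M\<rangle> (R1 \<rhd>\<langle>M\<rangle> m))))"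

definition as_yd :: "'a univ \<Rightarrow> ('k, 'a) hom_module \<Rightarrow> ('k, 'a) hom_yd" where
  "as_yd R M = \<lparr>vs = vs M, \<alpha> = \<alpha> M, act = act M, coact = R_coact R M\<rparr>"

definition as_yd_arrow :: "'a univ \<Rightarrow> ('k, 'a) hom_module \<times> ('a univ \<Rightarrow> 'a univ) \<times> ('k, 'a) hom_module \<Rightarrow>
    ('k, 'a) hom_yd \<times> ('a univ \<Rightarrow> 'a univ) \<times> ('k, 'a) hom_yd" where
  "as_yd_arrow R = (\<lambda>(M, f, N). (as_yd R M, f, as_yd R N))"

end

end

theory Submission
  imports Defs
begin

text \<open>
  As all maps \<open>\<alpha>\<close> are bijective, the Hom-structures can be untwisted. The operations
  \<open>h \<star> k = \<alpha>\<^sup>-\<^sup>1 (h k)\<close> (\<open>mul\<close>) and \<open>\<Delta> \<circ> \<alpha>\<^sup>-\<^sup>1\<close> (\<open>De\<close>) turn \<open>H\<close> into an ordinary associative and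
  coassociative bialgebra with the automorphism \<open>\<alpha>\<close>, and \<open>(h, m) \<mapsto> \<alpha>\<^sup>-\<^sup>1 (h \<cdot> m)\<close> (\<open>ac\<close>) and
  \<open>\<lambda> \<circ> \<alpha>\<^sup>-\<^sup>1\<close> (\<open>co\<close>) turn a Yetter-Drinfeld module over \<open>H\<close> into an ordinary one with a compatible
  automorphism. The category axioms for \<open>YD\<close> are then checked on pure tensors by means of linearity, exchange of
  independent Sweedler sums, coassociativity and the Yetter-Drinfeld condition.

  The untwisted form of the coaction \<open>m \<mapsto> \<alpha> R\<^sup>2 \<otimes> R\<^sup>1 \<cdot> m\<close> is \<open>m \<mapsto> R\<^sup>2 \<otimes> ac R\<^sup>1 m\<close>, because \<open>R\<close> is invariant
  under \<open>\<alpha> \<otimes> \<alpha>\<close>. The three axioms of quasitriangularity say that it is compatible with tensor products,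
  that it is coassociative, and that it satisfies the Yetter-Drinfeld condition. Every module morphism
  respects it, so modules embed fully faithfully into \<open>YD\<close> and inherit the axioms of a quasi-braided
  pre-tensor category from there.
\<close>

section \<open>Full embeddings into quasi-braided pre-tensor categories\<close>

text \<open>The Hom-axioms put different powers of \<alpha> on different legs, which makes them
  awkward as rewrite rules; after untwisting, \<alpha> commutes with every operation and can be
  pushed to the variables. The prescribed tensor product does not become the ordinary one, however:
  h acts on it through \<alpha>(h_1) and \<alpha>(h_2), and the coaction leg carries an \<alpha>^-1.
  Iterated products therefore depend on the bracketing, and the factors \<alpha>^-1 and \<alpha> of
  the associator compensate exactly for this. The quasi-braiding, by contrast, loses all its twists.

  A tensor is encoded by an arbitrarily chosen formal sum, so a Sweedler expression is independent
  of this choice only if its body is multilinear. Most rewriting steps thus carry typing and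
  linearity conditions, which the calculus arranges to be solved along the syntax of the terms.

  Faithfulness of the embedding transports equations; fullness enters because the second hexagon
  mentions inverse associators. As structures have to agree by equality, the coaction of a tensor
  product must equal, as a function, the one that R induces on it.\<close>

lemma (in category) inverse_arrows_unique:
  assumes f: "f \<in> Hom C A B" and g: "inverse_arrows C f g" and h: "inverse_arrows C f h"
  shows "g = h"
proof -
  have AB: "Dom C f = A" "Cod C f = B" using f by (auto simp: Hom_def)
  have g': "g \<in> Hom C B A" and h': "h \<in> Hom C B A"
    using g h by (auto simp: inverse_arrows_def AB)
  have "g = g \<cdot> (f \<cdot> h)"
    using h comp_id[OF g'] by (simp add: inverse_arrows_def AB)
  also have "\<dots> = (g \<cdot> f) \<cdot> h"
    by (rule comp_assoc[OF h' f g', symmetric])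
  also have "\<dots> = h"
    using g id_comp[OF h'] by (simp add: inverse_arrows_def AB)
  finally show ?thesis .
qed

lemma (in category) Inv_eqI: "f \<in> Hom C A B \<Longrightarrow> inverse_arrows C f g \<Longrightarrow> Inv C f = g"
  unfolding Inv_def using inverse_arrows_unique by blast

text \<open>About \<open>C\<close> only the typing of its operations and their compatibility with
  \<open>Fo\<close> and \<open>Fa\<close> are assumed; its laws are pulled back from
  \<open>D\<close>. Injectivity on hom-sets transports equations, surjectivity supplies inverses of
  the associativity constraints.\<close>

locale full_embedding = D: quasi_braided_pre_tensor_category D
  for C :: "('o, 'm, 'z) braided_data_scheme"
    and D :: "('p, 'n, 'y) braided_data_scheme"
    and Fo :: "'o \<Rightarrow> 'p" and Fa :: "'m \<Rightarrow> 'n" +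
  assumes dom_cod: "f \<in> Arr C \<Longrightarrow> Dom C f \<in> Obj C" "f \<in> Arr C \<Longrightarrow> Cod C f \<in> Obj C"
    and obj: "A \<in> Obj C \<Longrightarrow> Fo A \<in> Obj D"
    and bij: "\<lbrakk>A \<in> Obj C; B \<in> Obj C\<rbrakk> \<Longrightarrow> bij_betw Fa (Hom C A B) (Hom D (Fo A) (Fo B))"
    and id_C: "A \<in> Obj C \<Longrightarrow> Id C A \<in> Hom C A A"
    and id_eq: "A \<in> Obj C \<Longrightarrow> Fa (Id C A) = Id D (Fo A)"
    and comp_C: "\<lbrakk>f \<in> Hom C A B; g \<in> Hom C B E\<rbrakk> \<Longrightarrow> g \<cdot>\<^bsub>C\<^esub> f \<in> Hom C A E"
    and comp_eq: "\<lbrakk>f \<in> Hom C A B; g \<in> Hom C B E\<rbrakk> \<Longrightarrow> Fa (g \<cdot>\<^bsub>C\<^esub> f) = Fa g \<cdot>\<^bsub>D\<^esub> Fa f"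
    and tenO_C: "\<lbrakk>A \<in> Obj C; B \<in> Obj C\<rbrakk> \<Longrightarrow> A \<diamondop>\<^bsub>C\<^esub> B \<in> Obj C"
    and tenO_eq: "\<lbrakk>A \<in> Obj C; B \<in> Obj C\<rbrakk> \<Longrightarrow> Fo (A \<diamondop>\<^bsub>C\<^esub> B) = Fo A \<diamondop>\<^bsub>D\<^esub> Fo B"
    and tenA_C: "\<lbrakk>f \<in> Hom C A B; g \<in> Hom C A' B'\<rbrakk> \<Longrightarrow> f \<bowtie>\<^bsub>C\<^esub> g \<in> Hom C (A \<diamondop>\<^bsub>C\<^esub> A') (B \<diamondop>\<^bsub>C\<^esub> B')"
    and tenA_eq: "\<lbrakk>f \<in> Arr C; g \<in> Arr C\<rbrakk> \<Longrightarrow> Fa (f \<bowtie>\<^bsub>C\<^esub> g) = Fa f \<bowtie>\<^bsub>D\<^esub> Fa g"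
    and assoc_C: "\<lbrakk>U \<in> Obj C; V \<in> Obj C; W \<in> Obj C\<rbrakk> \<Longrightarrow>
      Assoc C U V W \<in> Hom C ((U \<diamondop>\<^bsub>C\<^esub> V) \<diamondop>\<^bsub>C\<^esub> W) (U \<diamondop>\<^bsub>C\<^esub> (V \<diamondop>\<^bsub>C\<^esub> W))"
    and assoc_eq: "\<lbrakk>A \<in> Obj C; B \<in> Obj C; E \<in> Obj C\<rbrakk> \<Longrightarrow>
      Fa (Assoc C A B E) = Assoc D (Fo A) (Fo B) (Fo E)"
    and braid_C: "\<lbrakk>V \<in> Obj C; W \<in> Obj C\<rbrakk> \<Longrightarrow> Braid C V W \<in> Hom C (V \<diamondop>\<^bsub>C\<^esub> W) (W \<diamondop>\<^bsub>C\<^esub> V)"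
    and braid_eq: "\<lbrakk>A \<in> Obj C; B \<in> Obj C\<rbrakk> \<Longrightarrow> Fa (Braid C A B) = Braid D (Fo A) (Fo B)"
begin

lemma HomD: "f \<in> Hom C A B \<Longrightarrow> A \<in> Obj C" "f \<in> Hom C A B \<Longrightarrow> B \<in> Obj C" "f \<in> Hom C A B \<Longrightarrow> f \<in> Arr C"
  using dom_cod by (auto simp: Hom_def)

lemma Fa_hom: "f \<in> Hom C A B \<Longrightarrow> Fa f \<in> Hom D (Fo A) (Fo B)"
  using bij[of A B] HomD[of f A B] by (auto simp: bij_betw_def)

lemma eqI: "f \<in> Hom C A B \<Longrightarrow> g \<in> Hom C A B \<Longrightarrow> Fa f = Fa g \<Longrightarrow> f = g"
  using bij[of A B] HomD[of f A B] by (auto simp: bij_betw_def dest: inj_onD)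

lemma category_C: "category C"
proof
  fix f A B assume f: "f \<in> Hom C A B"
  note [simp] = HomD[OF f]
  show "f \<cdot>\<^bsub>C\<^esub> Id C A = f"
    by (rule eqI[OF comp_C[OF id_C f] f])
      (simp_all add: comp_eq[OF id_C f] id_eq D.comp_id[OF Fa_hom[OF f]])
  show "Id C B \<cdot>\<^bsub>C\<^esub> f = f"
    by (rule eqI[OF comp_C[OF f id_C] f])
      (simp_all add: comp_eq[OF f id_C] id_eq D.id_comp[OF Fa_hom[OF f]])
  fix g E h G assume g: "g \<in> Hom C B E" and h: "h \<in> Hom C E G"
  show "(h \<cdot>\<^bsub>C\<^esub> g) \<cdot>\<^bsub>C\<^esub> f = h \<cdot>\<^bsub>C\<^esub> g \<cdot>\<^bsub>C\<^esub> f"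
    by (rule eqI[OF comp_C[OF f comp_C[OF g h]] comp_C[OF comp_C[OF f g] h]])
      (simp add: comp_eq[OF f comp_C[OF g h]] comp_eq[OF comp_C[OF f g] h] comp_eq[OF f g] comp_eq[OF g h]
        D.comp_assoc[OF Fa_hom[OF f] Fa_hom[OF g] Fa_hom[OF h]])
qed (use dom_cod id_C comp_C in auto)

text \<open>By fullness the inverse in \<open>D\<close> has a preimage, and this is an inverse
  because the images of both composites are identities. Uniqueness of inverses identifies it with
  \<open>Inv\<close>, which is defined by a definite description.\<close>

lemma inverse:
  assumes f: "f \<in> Hom C A B" and inv: "inverse_arrows D (Fa f) g'"
  obtains g where "inverse_arrows C f g" "g \<in> Hom C B A" "Fa g = g'" "Inv C f = g" "Inv D (Fa f) = g'"
proof -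
  interpret C: category C by (rule category_C)
  note [simp] = HomD[OF f]
  have Fa: "Fa f \<in> Hom D (Fo A) (Fo B)" by (rule Fa_hom[OF f])
  then have "Dom D (Fa f) = Fo A" "Cod D (Fa f) = Fo B" and AB: "Dom C f = A" "Cod C f = B"
    using f by (auto simp: Hom_def)
  then have g': "g' \<in> Hom D (Fo B) (Fo A)" "g' \<cdot>\<^bsub>D\<^esub> Fa f = Id D (Fo A)" "Fa f \<cdot>\<^bsub>D\<^esub> g' = Id D (Fo B)"
    using inv by (auto simp: inverse_arrows_def)
  obtain g where g: "g \<in> Hom C B A" "Fa g = g'"
    using g'(1) bij_betw_imp_surj_on[OF bij[of B A]] by (metis HomD(1,2) f imageE)
  have "inverse_arrows C f g"
    unfolding inverse_arrows_def AB
    using f g g' by (auto intro!: eqI[OF comp_C id_C] simp: comp_eq[where f = f] comp_eq[where f = g] id_eq)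
  then show ?thesis
    using that g C.Inv_eqI[OF f] D.Inv_eqI[OF Fa inv] by auto
qed

lemma inverse_assoc:
  assumes "U \<in> Obj C" "V \<in> Obj C" "W \<in> Obj C"
  shows "\<exists>g. inverse_arrows C (Assoc C U V W) g"
    and "Inv C (Assoc C U V W) \<in> Hom C (U \<diamondop>\<^bsub>C\<^esub> (V \<diamondop>\<^bsub>C\<^esub> W)) ((U \<diamondop>\<^bsub>C\<^esub> V) \<diamondop>\<^bsub>C\<^esub> W)"
    and "Fa (Inv C (Assoc C U V W)) = Inv D (Assoc D (Fo U) (Fo V) (Fo W))"
proof -
  obtain g' where "inverse_arrows D (Fa (Assoc C U V W)) g'"
    using D.assoc_iso[OF obj[OF assms(1)] obj[OF assms(2)] obj[OF assms(3)]] assoc_eq[OF assms] by auto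
  from inverse[OF assoc_C[OF assms] this] show "\<exists>g. inverse_arrows C (Assoc C U V W) g"
    "Inv C (Assoc C U V W) \<in> Hom C (U \<diamondop>\<^bsub>C\<^esub> (V \<diamondop>\<^bsub>C\<^esub> W)) ((U \<diamondop>\<^bsub>C\<^esub> V) \<diamondop>\<^bsub>C\<^esub> W)"
    "Fa (Inv C (Assoc C U V W)) = Inv D (Assoc D (Fo U) (Fo V) (Fo W))"
    using assoc_eq[OF assms] by metis+
qed

lemma quasi_braided_C: "quasi_braided_pre_tensor_category C"
proof -
  interpret C: category C by (rule category_C)
  show ?thesis
  proof
    fix A B assume [simp]: "A \<in> Obj C" "B \<in> Obj C"
    show "A \<diamondop>\<^bsub>C\<^esub> B \<in> Obj C" by (simp add: tenO_C)
    show "Id C A \<bowtie>\<^bsub>C\<^esub> Id C B = Id C (A \<diamondop>\<^bsub>C\<^esub> B)"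
      by (rule eqI[OF tenA_C[OF id_C id_C] id_C])
        (simp_all add: tenA_eq HomD(3)[OF id_C] id_eq tenO_C tenO_eq D.tenA_id obj)
    show "Braid C A B \<in> Hom C (A \<diamondop>\<^bsub>C\<^esub> B) (B \<diamondop>\<^bsub>C\<^esub> A)" by (simp add: braid_C)
  next
    fix f A B g A' B' assume "f \<in> Hom C A B" "g \<in> Hom C A' B'"
    then show "f \<bowtie>\<^bsub>C\<^esub> g \<in> Hom C (A \<diamondop>\<^bsub>C\<^esub> A') (B \<diamondop>\<^bsub>C\<^esub> B')" by (rule tenA_C)
  next
    fix f A B g E f' A' B' g' E'
    assume f: "f \<in> Hom C A B" and g: "g \<in> Hom C B E" and f': "f' \<in> Hom C A' B'" and g': "g' \<in> Hom C B' E'"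
    show "(g \<cdot>\<^bsub>C\<^esub> f) \<bowtie>\<^bsub>C\<^esub> (g' \<cdot>\<^bsub>C\<^esub> f') = (g \<bowtie>\<^bsub>C\<^esub> g') \<cdot>\<^bsub>C\<^esub> (f \<bowtie>\<^bsub>C\<^esub> f')"
      by (rule eqI[OF tenA_C[OF comp_C[OF f g] comp_C[OF f' g']] comp_C[OF tenA_C[OF f f'] tenA_C[OF g g']]])
        (simp add: comp_eq[OF tenA_C[OF f f'] tenA_C[OF g g']] tenA_eq HomD(3)[OF comp_C[OF f g]] HomD(3)[OF comp_C[OF f' g']]
          HomD(3)[OF f] HomD(3)[OF g] HomD(3)[OF f'] HomD(3)[OF g'] comp_eq[OF f g] comp_eq[OF f' g']
          D.tenA_comp[OF Fa_hom[OF f] Fa_hom[OF g] Fa_hom[OF f'] Fa_hom[OF g']])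
  next
    fix U V W assume [simp]: "U \<in> Obj C" "V \<in> Obj C" "W \<in> Obj C"
    show "Assoc C U V W \<in> Hom C ((U \<diamondop>\<^bsub>C\<^esub> V) \<diamondop>\<^bsub>C\<^esub> W) (U \<diamondop>\<^bsub>C\<^esub> (V \<diamondop>\<^bsub>C\<^esub> W))"
      "\<exists>g. inverse_arrows C (Assoc C U V W) g"
      by (simp_all add: assoc_C inverse_assoc(1))
  next
    fix f U U' g V V' h W W' assume f: "f \<in> Hom C U U'" and g: "g \<in> Hom C V V'" and h: "h \<in> Hom C W W'"
    note O [simp] = HomD[OF f] HomD[OF g] HomD[OF h]
    \<comment> \<open>The facts \<open>l\<close> and \<open>r\<close> type the factors of the left
      and of the right side; \<open>comp_eq\<close> and \<open>eqI\<close> have to be told the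
      objects in between.\<close>
    note l1 = tenA_C[OF tenA_C[OF f g] h] and r1 = tenA_C[OF f tenA_C[OF g h]]
    note l2 = assoc_C[OF O(2,5,8)] and r2 = assoc_C[OF O(1,4,7)]
    show "Assoc C U' V' W' \<cdot>\<^bsub>C\<^esub> ((f \<bowtie>\<^bsub>C\<^esub> g) \<bowtie>\<^bsub>C\<^esub> h) = (f \<bowtie>\<^bsub>C\<^esub> (g \<bowtie>\<^bsub>C\<^esub> h)) \<cdot>\<^bsub>C\<^esub> Assoc C U V W"
      by (rule eqI[OF comp_C[OF l1 l2] comp_C[OF r2 r1]])
        (simp add: comp_eq[OF l1 l2] comp_eq[OF r2 r1] assoc_eq tenA_eq HomD(3)[OF tenA_C[OF f g]] HomD(3)[OF tenA_C[OF g h]]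
          D.assoc_natural[OF Fa_hom[OF f] Fa_hom[OF g] Fa_hom[OF h]])
  next
    fix U V W X assume O [simp]: "U \<in> Obj C" "V \<in> Obj C" "W \<in> Obj C" "X \<in> Obj C"
    note l1 = tenA_C[OF assoc_C[OF O(1,2,3)] id_C[OF O(4)]] and l2 = assoc_C[OF O(1) tenO_C[OF O(2,3)] O(4)]
      and l3 = tenA_C[OF id_C[OF O(1)] assoc_C[OF O(2,3,4)]]
    note r1 = assoc_C[OF tenO_C[OF O(1,2)] O(3,4)] and r2 = assoc_C[OF O(1,2) tenO_C[OF O(3,4)]]
    show "(Id C U \<bowtie>\<^bsub>C\<^esub> Assoc C V W X) \<cdot>\<^bsub>C\<^esub> Assoc C U (V \<diamondop>\<^bsub>C\<^esub> W) X \<cdot>\<^bsub>C\<^esub> (Assoc C U V W \<bowtie>\<^bsub>C\<^esub> Id C X)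
        = Assoc C U V (W \<diamondop>\<^bsub>C\<^esub> X) \<cdot>\<^bsub>C\<^esub> Assoc C (U \<diamondop>\<^bsub>C\<^esub> V) W X"
      by (rule eqI[OF comp_C[OF comp_C[OF l1 l2] l3] comp_C[OF r1 r2]])
        (simp add: comp_eq[OF comp_C[OF l1 l2] l3] comp_eq[OF l1 l2] comp_eq[OF r1 r2] tenA_eq HomD(3)[OF id_C] HomD(3)[OF assoc_C]
          id_eq assoc_eq tenO_C tenO_eq D.pentagon obj)
  next
    fix f V V' g W W' assume f: "f \<in> Hom C V V'" and g: "g \<in> Hom C W W'"
    note O [simp] = HomD[OF f] HomD[OF g]
    note l1 = tenA_C[OF f g] and l2 = braid_C[OF O(2,5)] and r1 = braid_C[OF O(1,4)] and r2 = tenA_C[OF g f]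
    show "Braid C V' W' \<cdot>\<^bsub>C\<^esub> (f \<bowtie>\<^bsub>C\<^esub> g) = (g \<bowtie>\<^bsub>C\<^esub> f) \<cdot>\<^bsub>C\<^esub> Braid C V W"
      by (rule eqI[OF comp_C[OF l1 l2] comp_C[OF r1 r2]])
        (simp add: comp_eq[OF l1 l2] comp_eq[OF r1 r2] tenA_eq braid_eq D.braid_natural[OF Fa_hom[OF f] Fa_hom[OF g]])
  next
    fix U V W assume O [simp]: "U \<in> Obj C" "V \<in> Obj C" "W \<in> Obj C"
    note ar = HomD(3)[OF id_C] HomD(3)[OF braid_C]
    note l1 = assoc_C[OF O(1,2,3)] and l2 = braid_C[OF O(1) tenO_C[OF O(2,3)]] and l3 = assoc_C[OF O(2,3,1)]
    note r1 = tenA_C[OF braid_C[OF O(1,2)] id_C[OF O(3)]] and r2 = assoc_C[OF O(2,1,3)]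
      and r3 = tenA_C[OF id_C[OF O(2)] braid_C[OF O(1,3)]]
    show "Assoc C V W U \<cdot>\<^bsub>C\<^esub> Braid C U (V \<diamondop>\<^bsub>C\<^esub> W) \<cdot>\<^bsub>C\<^esub> Assoc C U V W
        = (Id C V \<bowtie>\<^bsub>C\<^esub> Braid C U W) \<cdot>\<^bsub>C\<^esub> Assoc C V U W \<cdot>\<^bsub>C\<^esub> (Braid C U V \<bowtie>\<^bsub>C\<^esub> Id C W)"
      by (rule eqI[OF comp_C[OF comp_C[OF l1 l2] l3] comp_C[OF comp_C[OF r1 r2] r3]])
        (simp add: comp_eq[OF comp_C[OF l1 l2] l3] comp_eq[OF l1 l2] comp_eq[OF comp_C[OF r1 r2] r3] comp_eq[OF r1 r2]
          tenA_eq ar id_eq assoc_eq braid_eq tenO_C tenO_eq D.hexagon1 obj)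
    note l1 = inverse_assoc(2)[OF O(1,2,3)] and l2 = braid_C[OF tenO_C[OF O(1,2)] O(3)] and l3 = inverse_assoc(2)[OF O(3,1,2)]
    note r1 = tenA_C[OF id_C[OF O(1)] braid_C[OF O(2,3)]] and r2 = inverse_assoc(2)[OF O(1,3,2)]
      and r3 = tenA_C[OF braid_C[OF O(1,3)] id_C[OF O(2)]]
    show "Inv C (Assoc C W U V) \<cdot>\<^bsub>C\<^esub> Braid C (U \<diamondop>\<^bsub>C\<^esub> V) W \<cdot>\<^bsub>C\<^esub> Inv C (Assoc C U V W)
        = (Braid C U W \<bowtie>\<^bsub>C\<^esub> Id C V) \<cdot>\<^bsub>C\<^esub> Inv C (Assoc C U W V) \<cdot>\<^bsub>C\<^esub> (Id C U \<bowtie>\<^bsub>C\<^esub> Braid C V W)"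
      by (rule eqI[OF comp_C[OF comp_C[OF l1 l2] l3] comp_C[OF comp_C[OF r1 r2] r3]])
        (simp add: comp_eq[OF comp_C[OF l1 l2] l3] comp_eq[OF l1 l2] comp_eq[OF comp_C[OF r1 r2] r3] comp_eq[OF r1 r2]
          tenA_eq ar id_eq inverse_assoc(3) braid_eq tenO_C tenO_eq D.hexagon2 obj)
  qed
qed

end

section \<open>The tensor product of modules\<close>

locale two_modules = V: module K V + W: module K W
  for K :: "('k, 'r) ring_scheme" and V W :: "('k, 'u) module"
begin

abbreviation formal_sums :: "('u \<times> 'u) list set" where
  "formal_sums \<equiv> lists (carrier V \<times> carrier W)"

abbreviation congruent (infix \<open>\<approx>\<close> 50) where
  "xs \<approx> ys \<equiv> tensor_eq K V W xs ys"

definition scale_left :: "'k \<Rightarrow> ('u \<times> 'u) list \<Rightarrow> ('u \<times> 'u) list" where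
  "scale_left c = map (\<lambda>(v, w). (c \<odot>\<^bsub>V\<^esub> v, w))"

lemma scale_left_simps [simp]:
  "scale_left c [] = []"
  "scale_left c ((v, w) # xs) = (c \<odot>\<^bsub>V\<^esub> v, w) # scale_left c xs"
  "scale_left c (xs @ ys) = scale_left c xs @ scale_left c ys"
  by (simp_all add: scale_left_def)

lemma scale_left_closed:
  "c \<in> carrier K \<Longrightarrow> xs \<in> formal_sums \<Longrightarrow> scale_left c xs \<in> formal_sums"
  by (induction xs) auto

lemma congruent_closed: "xs \<approx> ys \<Longrightarrow> xs \<in> formal_sums \<and> ys \<in> formal_sums"
  by (induction rule: tensor_eq.induct) auto

lemma congruent_cons:
  "v \<in> carrier V \<Longrightarrow> w \<in> carrier W \<Longrightarrow> xs \<approx> ys \<Longrightarrow> (v, w) # xs \<approx> (v, w) # ys"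
  using tensor_eq.append[OF tensor_eq.refl[of "[(v, w)]"]] by fastforce

text \<open>The generator \<open>commute\<close> exchanges two summands of a list of length two.
  Moving one summand past a whole list is the inductive step towards commutativity of formal
  sums.\<close>

lemma congruent_rotate:
  assumes "v \<in> carrier V" "w \<in> carrier W" "xs \<in> formal_sums"
  shows "(v, w) # xs \<approx> xs @ [(v, w)]"
  using assms(3)
proof (induction xs)
  case Nil
  then show ?case using assms by (auto intro: tensor_eq.refl)
next
  case (Cons x xs)
  obtain v' w' where x: "x = (v', w')" "v' \<in> carrier V" "w' \<in> carrier W" and xs: "xs \<in> formal_sums"
    using Cons by auto
  have "[(v, w), (v', w')] @ xs \<approx> [(v', w'), (v, w)] @ xs"
    using assms x xs by (blast intro: tensor_eq.append tensor_eq.commute tensor_eq.refl)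
  moreover have "(v', w') # ((v, w) # xs) \<approx> (v', w') # (xs @ [(v, w)])"
    using x xs Cons.IH by (auto intro: congruent_cons)
  ultimately show ?case
    using x by (auto intro: tensor_eq.trans)
qed

lemma congruent_swap:
  assumes "xs \<in> formal_sums" "ys \<in> formal_sums"
  shows "xs @ ys \<approx> ys @ xs"
  using assms(1)
proof (induction xs)
  case Nil
  then show ?case using assms by (auto intro: tensor_eq.refl)
next
  case (Cons x xs)
  obtain v w where x: "x = (v, w)" "v \<in> carrier V" "w \<in> carrier W" and xs: "xs \<in> formal_sums"
    using Cons by auto
  have "(x # xs) @ ys \<approx> (v, w) # (ys @ xs)"
    using Cons x by (auto intro: congruent_cons)
  moreover have "((v, w) # ys) @ xs \<approx> (ys @ [(v, w)]) @ xs"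
    using assms x xs by (intro tensor_eq.append congruent_rotate tensor_eq.refl) auto
  ultimately show ?case
    using x by (auto intro: tensor_eq.trans)
qed

lemma congruent_interchange:
  assumes "xs \<in> formal_sums" "ys \<in> formal_sums" "xs' \<in> formal_sums" "ys' \<in> formal_sums"
  shows "(xs @ ys) @ (xs' @ ys') \<approx> (xs @ xs') @ (ys @ ys')"
proof -
  have "xs @ ((ys @ xs') @ ys') \<approx> xs @ ((xs' @ ys) @ ys')"
    using assms by (intro tensor_eq.append congruent_swap tensor_eq.refl) auto
  then show ?thesis by simp
qed

lemma scale_left_congruent:
  assumes c: "c \<in> carrier K"
  shows "xs \<approx> ys \<Longrightarrow> scale_left c xs \<approx> scale_left c ys"
proof (induction rule: tensor_eq.induct)
  case (refl xs)
  then show ?case using scale_left_closed[OF c] by (blast intro: tensor_eq.refl)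
next
  case (scale d v w)
  \<comment> \<open>The relation moves d across the tensor sign while c has to stay on the left
    factor; this is where commutativity of the scalars enters.\<close>
  have "c \<odot>\<^bsub>V\<^esub> (d \<odot>\<^bsub>V\<^esub> v) = d \<odot>\<^bsub>V\<^esub> (c \<odot>\<^bsub>V\<^esub> v)"
    using c scale by (metis V.R.m_comm V.smult_assoc1)
  then show ?case using c scale tensor_eq.scale[of d K "c \<odot>\<^bsub>V\<^esub> v" V w W] by simp
next
  case (add_left v v' w)
  then show ?case using c
    by (auto simp: V.smult_r_distr intro: tensor_eq.add_left)
qed (use c in \<open>auto intro: tensor_eq.intros\<close>)

lemma scale_left_add:
  assumes "c \<in> carrier K" "d \<in> carrier K" "xs \<in> formal_sums"
  shows "scale_left (c \<oplus>\<^bsub>K\<^esub> d) xs \<approx> scale_left c xs @ scale_left d xs"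
  using assms(3)
proof (induction xs)
  case Nil
  then show ?case by (auto intro: tensor_eq.refl)
next
  case (Cons x xs)
  obtain v w where x: "x = (v, w)" "v \<in> carrier V" "w \<in> carrier W" and xs: "xs \<in> formal_sums"
    using Cons by auto
  have "[((c \<oplus>\<^bsub>K\<^esub> d) \<odot>\<^bsub>V\<^esub> v, w)] @ scale_left (c \<oplus>\<^bsub>K\<^esub> d) xs
      \<approx> ([(c \<odot>\<^bsub>V\<^esub> v, w)] @ [(d \<odot>\<^bsub>V\<^esub> v, w)]) @ (scale_left c xs @ scale_left d xs)"
    using assms x xs Cons.IH
    by (intro tensor_eq.append) (auto simp: V.smult_l_distr intro!: tensor_eq.add_left)
  moreover have "\<dots> \<approx> ([(c \<odot>\<^bsub>V\<^esub> v, w)] @ scale_left c xs) @ ([(d \<odot>\<^bsub>V\<^esub> v, w)] @ scale_left d xs)"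
    using assms x xs by (intro congruent_interchange scale_left_closed) auto
  ultimately show ?case
    using x by (auto intro: tensor_eq.trans)
qed

lemma scale_left_zero:
  assumes "xs \<in> formal_sums"
  shows "scale_left \<zero>\<^bsub>K\<^esub> xs \<approx> []"
  using assms
proof (induction xs)
  case Nil
  then show ?case by (auto intro: tensor_eq.refl)
next
  case (Cons x xs)
  obtain v w where x: "x = (v, w)" "v \<in> carrier V" "w \<in> carrier W" and xs: "xs \<in> formal_sums"
    using Cons by auto
  have "[(\<zero>\<^bsub>V\<^esub>, w)] @ scale_left \<zero>\<^bsub>K\<^esub> xs \<approx> [] @ []"
    using x Cons.IH xs by (intro tensor_eq.append tensor_eq.zero_left) auto
  then show ?case using x by simp
qed

lemma scale_left_one: "xs \<in> formal_sums \<Longrightarrow> scale_left \<one>\<^bsub>K\<^esub> xs = xs"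
  by (induction xs) auto

lemma scale_left_assoc:
  "c \<in> carrier K \<Longrightarrow> d \<in> carrier K \<Longrightarrow> xs \<in> formal_sums \<Longrightarrow>
    scale_left (c \<otimes>\<^bsub>K\<^esub> d) xs = scale_left c (scale_left d xs)"
  by (induction xs) (auto simp: V.smult_assoc1)

end

section \<open>The quotient by the congruence as a module\<close>

locale two_vects = two_modules K V W
  for K :: "('k, 'r) ring_scheme" and V W :: "('k, 'a) vect"
begin

abbreviation T where "T \<equiv> tensor K V W"
abbreviation cls where "cls \<equiv> tensor_class K V W"

text \<open>The choice returns some list congruent to \<open>xs\<close>, in general not
  \<open>xs\<close> itself. Since the operations of the tensor product are defined through
  \<open>terms\<close>, this and \<open>cls_eqI\<close> are what reduces them to operations on
  lists.\<close>

lemma terms_congruent: "xs \<in> formal_sums \<Longrightarrow> xs \<approx> terms (cls xs)"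
  unfolding tensor_class_def by (auto intro: someI tensor_eq.refl)

lemma cls_eqI: "xs \<approx> ys \<Longrightarrow> cls xs = cls ys"
proof -
  assume "xs \<approx> ys"
  then have "tensor_eq K V W xs = tensor_eq K V W ys"
    by (blast intro: tensor_eq.sym tensor_eq.trans)
  then show ?thesis by (simp add: tensor_class_def)
qed

lemma terms_cls_closed: "xs \<in> formal_sums \<Longrightarrow> terms (cls xs) \<in> formal_sums"
  using terms_congruent congruent_closed by blast

lemma tensor_cases:
  assumes "t \<in> carrier T"
  obtains xs where "xs \<in> formal_sums" "t = cls xs"
  using assms by (auto simp: tensor_def)

lemma terms_closed: "t \<in> carrier T \<Longrightarrow> terms t \<in> formal_sums"
  by (metis tensor_cases terms_cls_closed)

lemma cls_closed: "xs \<in> formal_sums \<Longrightarrow> cls xs \<in> carrier T"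
  by (simp add: tensor_def)

lemma cls_add:
  assumes "xs \<in> formal_sums" "ys \<in> formal_sums"
  shows "cls xs \<oplus>\<^bsub>T\<^esub> cls ys = cls (xs @ ys)"
  using assms by (auto simp: tensor_def intro!: cls_eqI tensor_eq.append terms_congruent[THEN tensor_eq.sym])

lemma cls_smult:
  assumes "c \<in> carrier K" "xs \<in> formal_sums"
  shows "c \<odot>\<^bsub>T\<^esub> cls xs = cls (scale_left c xs)"
  using assms
  by (auto simp: tensor_def simp flip: scale_left_def
      intro!: cls_eqI scale_left_congruent terms_congruent[THEN tensor_eq.sym])

lemma cls_zero: "\<zero>\<^bsub>T\<^esub> = cls []"
  by (simp add: tensor_def)

lemma cls_terms: "t \<in> carrier T \<Longrightarrow> cls (terms t) = t"
  by (metis tensor_cases terms_congruent cls_eqI)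

lemma tensor_module: "module K T"
proof (rule moduleI)
  show "abelian_group T"
  proof (rule abelian_groupI)
    fix x y z assume "x \<in> carrier T" "y \<in> carrier T" "z \<in> carrier T"
    then show "x \<oplus>\<^bsub>T\<^esub> y \<oplus>\<^bsub>T\<^esub> z = x \<oplus>\<^bsub>T\<^esub> (y \<oplus>\<^bsub>T\<^esub> z)"
      by (elim tensor_cases) (simp add: cls_add)
  next
    fix x y assume "x \<in> carrier T" "y \<in> carrier T"
    then show "x \<oplus>\<^bsub>T\<^esub> y = y \<oplus>\<^bsub>T\<^esub> x"
      by (elim tensor_cases) (simp add: cls_add cls_eqI congruent_swap)
  next
    fix x y assume "x \<in> carrier T" "y \<in> carrier T"
    then show "x \<oplus>\<^bsub>T\<^esub> y \<in> carrier T"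
      by (elim tensor_cases) (simp add: cls_add cls_closed)
  next
    show "\<zero>\<^bsub>T\<^esub> \<in> carrier T"
      by (auto simp: cls_zero intro!: cls_closed)
  next
    fix x assume "x \<in> carrier T"
    then show "\<zero>\<^bsub>T\<^esub> \<oplus>\<^bsub>T\<^esub> x = x"
      by (elim tensor_cases) (simp add: cls_zero cls_add)
  next
    fix x assume "x \<in> carrier T"
    then obtain xs where xs: "xs \<in> formal_sums" "x = cls xs" by (rule tensor_cases)
    \<comment> \<open>Formal sums have no negation; the additive inverse is obtained by scaling with
      -1, since (-1 + 1) xs is congruent to the empty sum.\<close>
    let ?y = "scale_left (\<ominus>\<^bsub>K\<^esub> \<one>\<^bsub>K\<^esub>) xs"
    have y: "?y \<in> formal_sums" using xs by (simp add: scale_left_closed)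
    have "?y @ scale_left \<one>\<^bsub>K\<^esub> xs \<approx> []"
      using scale_left_add[of "\<ominus>\<^bsub>K\<^esub> \<one>\<^bsub>K\<^esub>" "\<one>\<^bsub>K\<^esub>" xs] scale_left_zero[of xs] xs
      by (metis V.R.a_closed V.R.add.inv_closed V.R.l_neg V.R.one_closed tensor_eq.sym tensor_eq.trans)
    then have "cls ?y \<oplus>\<^bsub>T\<^esub> x = \<zero>\<^bsub>T\<^esub>"
      using xs y by (simp add: cls_add cls_zero scale_left_one cls_eqI)
    then show "\<exists>y\<in>carrier T. y \<oplus>\<^bsub>T\<^esub> x = \<zero>\<^bsub>T\<^esub>"
      using cls_closed[OF y] by blast
  qed
next
  show "cring K" by (rule V.is_cring)
next
  fix a x assume "a \<in> carrier K" "x \<in> carrier T"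
  then show "a \<odot>\<^bsub>T\<^esub> x \<in> carrier T"
    by (elim tensor_cases) (simp add: cls_smult cls_closed scale_left_closed)
next
  fix a b x assume *: "a \<in> carrier K" "b \<in> carrier K" "x \<in> carrier T"
  then show "(a \<oplus>\<^bsub>K\<^esub> b) \<odot>\<^bsub>T\<^esub> x = a \<odot>\<^bsub>T\<^esub> x \<oplus>\<^bsub>T\<^esub> b \<odot>\<^bsub>T\<^esub> x"
    by (elim tensor_cases)
      (simp add: cls_smult cls_add scale_left_closed cls_eqI scale_left_add)
  show "(a \<otimes>\<^bsub>K\<^esub> b) \<odot>\<^bsub>T\<^esub> x = a \<odot>\<^bsub>T\<^esub> (b \<odot>\<^bsub>T\<^esub> x)"
    using * by (elim tensor_cases) (simp add: cls_smult scale_left_closed scale_left_assoc)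
next
  fix a x y assume "a \<in> carrier K" "x \<in> carrier T" "y \<in> carrier T"
  then show "a \<odot>\<^bsub>T\<^esub> (x \<oplus>\<^bsub>T\<^esub> y) = a \<odot>\<^bsub>T\<^esub> x \<oplus>\<^bsub>T\<^esub> a \<odot>\<^bsub>T\<^esub> y"
    by (elim tensor_cases) (simp add: cls_smult cls_add scale_left_closed)
next
  fix x assume "x \<in> carrier T"
  then show "\<one>\<^bsub>K\<^esub> \<odot>\<^bsub>T\<^esub> x = x"
    by (elim tensor_cases) (simp add: cls_smult scale_left_one)
qed

end

lemma tensor_module: "module K V \<Longrightarrow> module K W \<Longrightarrow> module K (tensor K V W)"
  by (intro two_vects.tensor_module two_vects.intro two_modules.intro)

section \<open>A calculus for Sweedler notation\<close>

text \<open>A constant of its own, so that a congruence rule can be attached to typing judgements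
  while ordinary membership stays unaffected.\<close>

definition el :: "'u \<Rightarrow> ('k, 'u) module \<Rightarrow> bool"  (infix \<open>\<in>\<^sub>v\<close> 50) where
  "x \<in>\<^sub>v V \<longleftrightarrow> x \<in> carrier V"

text \<open>Unlike \<open>linear_maps\<close>, this includes that both spaces are modules and does
  not ask for extensionality, so that it applies to plain lambda terms.\<close>

definition lin :: "('k, 'r) ring_scheme \<Rightarrow> ('k, 'u) module \<Rightarrow> ('k, 'v) module \<Rightarrow> ('u \<Rightarrow> 'v) \<Rightarrow> bool" where
  "lin K V W f \<longleftrightarrow>
     module K V \<and> module K W \<and> (\<forall>x \<in> carrier V. f x \<in> carrier W) \<and>
     (\<forall>x \<in> carrier V. \<forall>y \<in> carrier V. f (x \<oplus>\<^bsub>V\<^esub> y) = f x \<oplus>\<^bsub>W\<^esub> f y) \<and>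
     (\<forall>c \<in> carrier K. \<forall>x \<in> carrier V. f (c \<odot>\<^bsub>V\<^esub> x) = c \<odot>\<^bsub>W\<^esub> f x)"

definition bilin :: "('k, 'r) ring_scheme \<Rightarrow> ('k, 'u) module \<Rightarrow> ('k, 'v) module \<Rightarrow> ('k, 'w) module \<Rightarrow>
    ('u \<Rightarrow> 'v \<Rightarrow> 'w) \<Rightarrow> bool" where
  "bilin K A B U f \<longleftrightarrow> (\<forall>a. a \<in>\<^sub>v A \<longrightarrow> lin K B U (\<lambda>b. f a b)) \<and> (\<forall>b. b \<in>\<^sub>v B \<longrightarrow> lin K A U (\<lambda>a. f a b))"

text \<open>In contrast to \<^const>\<open>sweedler\<close> this sum records the spaces \<open>A\<close> and \<open>B\<close>, so that the typing conditions
  of the rules below can be solved by rewriting, and it is guarded, so that it satisfies an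
  unconditional congruence rule.\<close>

definition sw :: "('k, 'r) ring_scheme \<Rightarrow> ('k, 'a) vect \<Rightarrow> ('k, 'a) vect \<Rightarrow> ('k, 'a) vect \<Rightarrow>
    'a univ \<Rightarrow> ('a univ \<Rightarrow> 'a univ \<Rightarrow> 'a univ) \<Rightarrow> 'a univ" where
  "sw K A B U t f = (if set (terms t) \<subseteq> carrier A \<times> carrier B then sweedler U t f else \<zero>\<^bsub>U\<^esub>)"

text \<open>Keeps the simplifier from rewriting the terms whose type it is checking.\<close>

lemma el_cong [cong]: "V = V' \<Longrightarrow> (x \<in>\<^sub>v V) = (x \<in>\<^sub>v V')"
  by simp

lemma lin_cong [cong]: "V = V' \<Longrightarrow> W = W' \<Longrightarrow> lin K V W f = lin K V' W' f"
  by simp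

lemma sweedler_cong:
  assumes "set (terms t) \<subseteq> carrier A \<times> carrier B"
    and "\<And>a b. a \<in>\<^sub>v A \<Longrightarrow> b \<in>\<^sub>v B \<Longrightarrow> f a b = g a b"
  shows "sweedler U t f = sweedler U t g"
  unfolding sweedler_def by (rule foldr_cong) (use assms in \<open>auto simp: el_def\<close>)

lemma sw_cong [cong]:
  "t = t' \<Longrightarrow> (\<And>a b. a \<in>\<^sub>v A \<Longrightarrow> b \<in>\<^sub>v B \<Longrightarrow> f a b = g a b) \<Longrightarrow> sw K A B U t f = sw K A B U t' g"
  by (auto simp: sw_def intro: sweedler_cong)

lemma bilinI:
  "(\<And>a. a \<in>\<^sub>v A \<Longrightarrow> lin K B U (\<lambda>b. f a b)) \<Longrightarrow> (\<And>b. b \<in>\<^sub>v B \<Longrightarrow> lin K A U (\<lambda>a. f a b)) \<Longrightarrow>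
    bilin K A B U (\<lambda>a b. f a b)"
  by (simp add: bilin_def)

lemma el_lin: "lin K V W f \<Longrightarrow> x \<in>\<^sub>v V \<Longrightarrow> f x \<in>\<^sub>v W"
  by (simp add: lin_def el_def)

lemma lin_module: "lin K V W f \<Longrightarrow> module K V" "lin K V W f \<Longrightarrow> module K W"
  by (auto simp: lin_def)

lemma lin_comp: "lin K B C f \<Longrightarrow> lin K A B g \<Longrightarrow> lin K A C (\<lambda>x. f (g x))"
  by (simp add: lin_def)

lemma lin_id: "module K V \<Longrightarrow> lin K V V (\<lambda>x. x)"
  by (simp add: lin_def module.smult_closed)

lemma lin_zero:
  assumes "lin K V W f" shows "f \<zero>\<^bsub>V\<^esub> = \<zero>\<^bsub>W\<^esub>"
proof -
  interpret V: module K V using assms by (simp add: lin_def)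
  interpret W: module K W using assms by (simp add: lin_def)
  have "f \<zero>\<^bsub>V\<^esub> \<in> carrier W" using assms V.zero_closed unfolding lin_def by blast
  moreover have "f (\<zero>\<^bsub>K\<^esub> \<odot>\<^bsub>V\<^esub> \<zero>\<^bsub>V\<^esub>) = \<zero>\<^bsub>K\<^esub> \<odot>\<^bsub>W\<^esub> f \<zero>\<^bsub>V\<^esub>"
    using assms V.zero_closed V.R.zero_closed unfolding lin_def by blast
  ultimately show ?thesis by simp
qed

section \<open>Sums over lists of pairs\<close>

context
  fixes K :: "('k, 'r) ring_scheme" and U :: "('k, 'w) module"
begin

text \<open>The sum behind \<open>sweedler\<close>, but for arbitrary lists, so that it can be
  treated by induction on the list and compared on congruent lists.\<close>

definition fsum :: "('u \<Rightarrow> 'v \<Rightarrow> 'w) \<Rightarrow> ('u \<times> 'v) list \<Rightarrow> 'w" where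
  "fsum f xs = foldr (\<lambda>(x, y) s. f x y \<oplus>\<^bsub>U\<^esub> s) xs \<zero>\<^bsub>U\<^esub>"

lemma fsum_simps [simp]:
  "fsum f [] = \<zero>\<^bsub>U\<^esub>" "fsum f ((x, y) # xs) = f x y \<oplus>\<^bsub>U\<^esub> fsum f xs"
  by (simp_all add: fsum_def)

end

lemma fsum_closed:
  assumes "module K U" "\<And>x y. (x, y) \<in> set xs \<Longrightarrow> f x y \<in> carrier U"
  shows "fsum U f xs \<in> carrier U"
proof -
  interpret U: module K U by fact
  show ?thesis using assms(2) by (induction xs) auto
qed

lemma fsum_append:
  assumes "module K U" "\<And>x y. (x, y) \<in> set xs \<union> set ys \<Longrightarrow> f x y \<in> carrier U"
  shows "fsum U f (xs @ ys) = fsum U f xs \<oplus>\<^bsub>U\<^esub> fsum U f ys"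
proof -
  interpret U: module K U by fact
  show ?thesis using assms(2)
  proof (induction xs)
    case Nil
    then show ?case using fsum_closed[OF assms(1), of ys f] by auto
  next
    case (Cons x xs)
    then show ?case using fsum_closed[OF assms(1), of ys f] fsum_closed[OF assms(1), of xs f]
      by (cases x) (auto simp: U.a_assoc)
  qed
qed

lemma fsum_add:
  assumes "module K U" "\<And>x y. (x, y) \<in> set xs \<Longrightarrow> f x y \<in> carrier U \<and> g x y \<in> carrier U"
  shows "fsum U (\<lambda>x y. f x y \<oplus>\<^bsub>U\<^esub> g x y) xs = fsum U f xs \<oplus>\<^bsub>U\<^esub> fsum U g xs"
proof -
  interpret U: module K U by fact
  show ?thesis using assms(2)
  proof (induction xs)
    case (Cons x xs)
    then show ?case using fsum_closed[OF assms(1), of xs f] fsum_closed[OF assms(1), of xs g]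
      by (cases x) (auto simp: U.a_ac)
  qed auto
qed

lemma fsum_lin:
  assumes "lin K U W \<phi>" "\<And>x y. (x, y) \<in> set xs \<Longrightarrow> f x y \<in> carrier U"
  shows "\<phi> (fsum U f xs) = fsum W (\<lambda>x y. \<phi> (f x y)) xs"
  using assms(2)
proof (induction xs)
  case Nil
  then show ?case using lin_zero[OF assms(1)] by simp
next
  case (Cons x xs)
  then show ?case using fsum_closed[OF lin_module(1)[OF assms(1)], of xs f] assms(1)
    by (cases x) (auto simp: lin_def)
qed

lemma fsum_swap:
  assumes "module K U" "\<And>x y z w. (x, y) \<in> set xs \<Longrightarrow> (z, w) \<in> set ys \<Longrightarrow> f x y z w \<in> carrier U"
  shows "fsum U (\<lambda>x y. fsum U (\<lambda>z w. f x y z w) ys) xs = fsum U (\<lambda>z w. fsum U (\<lambda>x y. f x y z w) xs) ys"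
proof -
  interpret U: module K U by fact
  have zero: "fsum U (\<lambda>_ _. \<zero>\<^bsub>U\<^esub>) zs = \<zero>\<^bsub>U\<^esub>" for zs :: "('x \<times> 'y) list"
    by (induction zs) auto
  show ?thesis using assms(2)
  proof (induction xs)
    case Nil
    then show ?case by (simp add: zero)
  next
    case (Cons x xs)
    obtain a b where x: "x = (a, b)" by (cases x)
    have "fsum U (\<lambda>z w. f a b z w \<oplus>\<^bsub>U\<^esub> fsum U (\<lambda>x y. f x y z w) xs) ys
        = fsum U (\<lambda>z w. f a b z w) ys \<oplus>\<^bsub>U\<^esub> fsum U (\<lambda>z w. fsum U (\<lambda>x y. f x y z w) xs) ys"
      by (rule fsum_add[OF assms(1)]) (use Cons.prems x in \<open>auto intro!: fsum_closed[OF assms(1)]\<close>)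
    then show ?case using Cons x by simp
  qed
qed

text \<open>The universal property of the tensor product: a bilinear map respects each generating
  relation, hence the whole congruence. All independence of chosen representatives comes from
  here.\<close>

lemma (in two_modules) fsum_congruent:
  assumes f: "bilin K V W U f"
  shows "xs \<approx> ys \<Longrightarrow> fsum U f xs = fsum U f ys"
proof (induction rule: tensor_eq.induct)
  case (append xs xs' ys ys')
  have cl: "f x y \<in> carrier U" if "x \<in> carrier V" "y \<in> carrier W" for x y
    using f that by (simp add: bilin_def el_def lin_def)
  have U: "module K U"
    using f V.zero_closed by (auto simp: bilin_def el_def lin_def)
  have "xs \<in> formal_sums" "ys \<in> formal_sums" "xs' \<in> formal_sums" "ys' \<in> formal_sums"
    using append congruent_closed by blast+
  then show ?case
    using append.IH by (subst (1 2) fsum_append[OF U]) (auto simp: cl)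
next
  case (commute v w v' w')
  then interpret U: module K U
    using f by (auto simp: bilin_def el_def lin_def)
  show ?case using commute f
    by (auto simp: bilin_def el_def lin_def U.a_ac)
next
  case (zero_left w)
  then interpret U: module K U
    using f by (auto simp: bilin_def el_def lin_def)
  show ?case using zero_left f lin_zero[of K V U "\<lambda>v. f v w"]
    by (auto simp: bilin_def el_def)
next
  case (zero_right v)
  then interpret U: module K U
    using f by (auto simp: bilin_def el_def lin_def)
  show ?case using zero_right f lin_zero[of K W U "f v"]
    by (auto simp: bilin_def el_def)
next
  case (add_left v v' w)
  then interpret U: module K U
    using f by (auto simp: bilin_def el_def lin_def)
  show ?case using add_left f
    by (auto simp: bilin_def el_def lin_def U.a_ac)
next
  case (add_right v w w')
  then interpret U: module K U
    using f by (auto simp: bilin_def el_def lin_def)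
  show ?case using add_right f
    by (auto simp: bilin_def el_def lin_def U.a_ac)
next
  case (scale c v w)
  then show ?case using f
    by (auto simp: bilin_def el_def lin_def)
qed auto

section \<open>Sweedler sums over the chosen representative\<close>

context
  fixes K :: "('k, 'r) ring_scheme" and A B :: "('k, 'a) vect"
  assumes A: "module K A" and B: "module K B"
begin

interpretation two_vects K A B
  using A B by (intro two_vects.intro two_modules.intro)

lemma terms_subset: "t \<in>\<^sub>v tensor K A B \<Longrightarrow> set (terms t) \<subseteq> carrier A \<times> carrier B"
  using terms_closed[of t] by (auto simp: el_def)

lemma sw_eq_fsum: "t \<in>\<^sub>v tensor K A B \<Longrightarrow> sw K A B U t f = fsum U f (terms t)"
  using terms_subset by (simp add: sw_def sweedler_def fsum_def)

lemma sweedler_eq_sw: "t \<in>\<^sub>v tensor K A B \<Longrightarrow> sweedler U t f = sw K A B U t f"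
  using terms_subset by (simp add: sw_def)

lemma sw_cls:
  "bilin K A B U f \<Longrightarrow> xs \<in> formal_sums \<Longrightarrow> sw K A B U (cls xs) f = fsum U f xs"
  using fsum_congruent[OF _ terms_congruent, of U f xs] by (simp add: sw_eq_fsum el_def cls_closed)

lemma el_pure: "a \<in>\<^sub>v A \<Longrightarrow> b \<in>\<^sub>v B \<Longrightarrow> pure K a A B b \<in>\<^sub>v tensor K A B"
  by (simp add: el_def pure_def cls_closed)

lemma bilin_pure: "bilin K A B (tensor K A B) (\<lambda>a b. pure K a A B b)"
proof -
  have "pure K (x \<oplus>\<^bsub>A\<^esub> y) A B b = pure K x A B b \<oplus>\<^bsub>tensor K A B\<^esub> pure K y A B b"
    if "x \<in> carrier A" "y \<in> carrier A" "b \<in> carrier B" for x y b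
    unfolding pure_def using that by (subst cls_add) (auto intro!: cls_eqI tensor_eq.add_left)
  moreover have "pure K a A B (x \<oplus>\<^bsub>B\<^esub> y) = pure K a A B x \<oplus>\<^bsub>tensor K A B\<^esub> pure K a A B y"
    if "x \<in> carrier B" "y \<in> carrier B" "a \<in> carrier A" for x y a
    unfolding pure_def using that by (subst cls_add) (auto intro!: cls_eqI tensor_eq.add_right)
  moreover have "pure K (c \<odot>\<^bsub>A\<^esub> a) A B b = c \<odot>\<^bsub>tensor K A B\<^esub> pure K a A B b"
    if "c \<in> carrier K" "a \<in> carrier A" "b \<in> carrier B" for a b c
    unfolding pure_def using that by (subst cls_smult) auto
  moreover have "pure K a A B (c \<odot>\<^bsub>B\<^esub> b) = c \<odot>\<^bsub>tensor K A B\<^esub> pure K a A B b"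
    if "c \<in> carrier K" "a \<in> carrier A" "b \<in> carrier B" for a b c
    unfolding pure_def using that
    by (subst cls_smult) (auto intro!: cls_eqI tensor_eq.scale[THEN tensor_eq.sym])
  ultimately show ?thesis
    using A B tensor_module el_pure by (simp add: bilin_def lin_def el_def)
qed

lemma sw_pure:
  assumes "bilin K A B U f" "a \<in>\<^sub>v A" "b \<in>\<^sub>v B"
  shows "sw K A B U (pure K a A B b) f = f a b"
proof -
  interpret U: module K U using assms by (auto simp: bilin_def lin_def)
  have "f a b \<in> carrier U" using assms by (simp add: bilin_def el_def lin_def)
  then show ?thesis using assms by (simp add: pure_def sw_cls el_def)
qed

lemma sw_el:
  assumes "t \<in>\<^sub>v tensor K A B" "module K U" "\<And>a b. a \<in>\<^sub>v A \<Longrightarrow> b \<in>\<^sub>v B \<Longrightarrow> f a b \<in>\<^sub>v U"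
  shows "sw K A B U t f \<in>\<^sub>v U"
  using assms terms_subset[OF assms(1)] fsum_closed[OF assms(2), of "terms t" f]
  by (auto simp: sw_eq_fsum el_def subset_iff)

lemma lin_sw:
  assumes "bilin K A B U f" "module K U"
  shows "lin K (tensor K A B) U (\<lambda>t. sw K A B U t f)"
proof -
  interpret U: module K U by fact
  have cl: "f a b \<in> carrier U" if "a \<in> carrier A" "b \<in> carrier B" for a b
    using assms that by (simp add: bilin_def el_def lin_def)
  have "sw K A B U t f \<in>\<^sub>v U" if "t \<in>\<^sub>v tensor K A B" for t
    using that cl by (intro sw_el) (auto simp: el_def assms)
  moreover have "sw K A B U (s \<oplus>\<^bsub>tensor K A B\<^esub> t) f = sw K A B U s f \<oplus>\<^bsub>U\<^esub> sw K A B U t f"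
    if st: "s \<in> carrier (tensor K A B)" "t \<in> carrier (tensor K A B)" for s t
  proof -
    obtain xs ys where xs: "xs \<in> formal_sums" "s = cls xs" "ys \<in> formal_sums" "t = cls ys"
      using tensor_cases[OF st(1)] tensor_cases[OF st(2)] by metis
    have "fsum U f (xs @ ys) = fsum U f xs \<oplus>\<^bsub>U\<^esub> fsum U f ys"
      using xs cl by (intro fsum_append[OF assms(2)]) auto
    then show ?thesis using xs by (simp add: cls_add sw_cls[OF assms(1)])
  qed
  moreover have "sw K A B U (c \<odot>\<^bsub>tensor K A B\<^esub> t) f = c \<odot>\<^bsub>U\<^esub> sw K A B U t f"
    if c: "c \<in> carrier K" and t: "t \<in> carrier (tensor K A B)" for c t
  proof -
    obtain xs where xs: "xs \<in> formal_sums" "t = cls xs"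
      using tensor_cases[OF t] by metis
    have "fsum U f (scale_left c xs) = c \<odot>\<^bsub>U\<^esub> fsum U f xs"
      using xs(1)
    proof (induction xs)
      case Nil
      then show ?case using c by simp
    next
      case (Cons x xs)
      have "fsum U f xs \<in> carrier U"
        using Cons cl by (intro fsum_closed[OF assms(2)]) auto
      moreover have "f (c \<odot>\<^bsub>A\<^esub> fst x) (snd x) = c \<odot>\<^bsub>U\<^esub> f (fst x) (snd x)"
        using assms Cons.hyps c by (auto simp: bilin_def el_def lin_def)
      ultimately show ?case
        using Cons c cl by (cases x) (auto simp: U.smult_r_distr)
    qed
    then show ?thesis
      using xs c by (simp add: cls_smult sw_cls[OF assms(1)] scale_left_closed)
  qed
  ultimately show ?thesis
    using A B tensor_module assms by (simp add: lin_def el_def)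
qed

text \<open>The list of summands is fixed by t, so this is additivity of \<phi> along a list. It is
  the source of all rules that move a linear map into a Sweedler sum.\<close>

lemma lin_push_sw:
  assumes "lin K U W \<phi>" "t \<in>\<^sub>v tensor K A B" "\<And>a b. a \<in>\<^sub>v A \<Longrightarrow> b \<in>\<^sub>v B \<Longrightarrow> f a b \<in>\<^sub>v U"
  shows "\<phi> (sw K A B U t f) = sw K A B W t (\<lambda>a b. \<phi> (f a b))"
  using assms terms_subset[OF assms(2)] fsum_lin[OF assms(1), of "terms t" f]
  by (auto simp: sw_eq_fsum el_def)

lemma sw_pure_self:
  assumes "t \<in>\<^sub>v tensor K A B"
  shows "sw K A B (tensor K A B) t (\<lambda>a b. pure K a A B b) = t"
proof -
  have "fsum (tensor K A B) (\<lambda>a b. pure K a A B b) xs = cls xs" if "xs \<in> formal_sums" for xs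
    using that
  proof (induction xs)
    case (Cons x xs)
    obtain a b where x: "x = (a, b)" by (cases x)
    then have "[(a, b)] \<in> formal_sums" "xs \<in> formal_sums" using Cons by auto
    then have "cls [(a, b)] \<oplus>\<^bsub>tensor K A B\<^esub> cls xs = cls ((a, b) # xs)"
      by (subst cls_add) auto
    then show ?case using Cons x by (simp add: pure_def)
  qed (simp add: cls_zero)
  then show ?thesis
    using assms cls_terms terms_closed by (simp add: sw_eq_fsum el_def)
qed

lemma lin_eq_sw:
  assumes "lin K (tensor K A B) U f" "t \<in>\<^sub>v tensor K A B"
  shows "f t = sw K A B U t (\<lambda>a b. f (pure K a A B b))"
  using lin_push_sw[OF assms, of "\<lambda>a b. pure K a A B b"] assms sw_pure_self el_pure by simp

text \<open>Complements \<open>lin_sw\<close>: the tensor t is fixed and linearity is in a parameter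
  of the body. Both are needed to decide linearity of nested sums.\<close>

lemma lin_sw_body:
  assumes "t \<in>\<^sub>v tensor K A B" "module K V" "module K U"
    and "\<And>a b. a \<in>\<^sub>v A \<Longrightarrow> b \<in>\<^sub>v B \<Longrightarrow> lin K V U (\<lambda>x. f x a b)"
  shows "lin K V U (\<lambda>x. sw K A B U t (\<lambda>a b. f x a b))"
proof -
  have l: "lin K V U (\<lambda>x. f x a b)" if "(a, b) \<in> set (terms t)" for a b
    using assms(4)[of a b] terms_subset[OF assms(1)] that by (auto simp: el_def)
  show ?thesis
    unfolding lin_def sw_eq_fsum[OF assms(1)]
  proof (intro conjI ballI)
    fix x assume x: "x \<in> carrier V"
    show "fsum U (f x) (terms t) \<in> carrier U"
      using l x by (intro fsum_closed[OF assms(3)]) (simp add: lin_def)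
    fix y assume y: "y \<in> carrier V"
    have "fsum U (f (x \<oplus>\<^bsub>V\<^esub> y)) (terms t) = fsum U (\<lambda>a b. f x a b \<oplus>\<^bsub>U\<^esub> f y a b) (terms t)"
      unfolding fsum_def by (rule foldr_cong) (use l x y in \<open>auto simp: lin_def\<close>)
    also have "\<dots> = fsum U (f x) (terms t) \<oplus>\<^bsub>U\<^esub> fsum U (f y) (terms t)"
      using l x y by (intro fsum_add[OF assms(3)]) (simp add: lin_def)
    finally show "fsum U (f (x \<oplus>\<^bsub>V\<^esub> y)) (terms t) = fsum U (f x) (terms t) \<oplus>\<^bsub>U\<^esub> fsum U (f y) (terms t)" .
  next
    fix c x assume c: "c \<in> carrier K" and x: "x \<in> carrier V"
    have "lin K U U (\<lambda>u. c \<odot>\<^bsub>U\<^esub> u)"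
    proof -
      interpret U: module K U by fact
      show ?thesis using c by (auto simp: lin_def assms U.smult_r_distr V.R.m_comm simp flip: U.smult_assoc1)
    qed
    then have "c \<odot>\<^bsub>U\<^esub> fsum U (f x) (terms t) = fsum U (\<lambda>a b. c \<odot>\<^bsub>U\<^esub> f x a b) (terms t)"
      using l x by (intro fsum_lin) (auto simp: lin_def)
    also have "\<dots> = fsum U (f (c \<odot>\<^bsub>V\<^esub> x)) (terms t)"
      unfolding fsum_def by (rule foldr_cong) (use l x c in \<open>auto simp: lin_def\<close>)
    finally show "fsum U (f (c \<odot>\<^bsub>V\<^esub> x)) (terms t) = c \<odot>\<^bsub>U\<^esub> fsum U (f x) (terms t)" ..
  qed (use assms in auto)
qed

text \<open>Every tensor is the sum of the pure tensors in its representative, so linear maps are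
  determined on pure tensors. Nearly all identities between maps on tensor products are reduced to
  elements by this rule.\<close>

lemma tensor_ext:
  fixes U :: "('k, 'a) vect"
  assumes "lin K (tensor K A B) U f" "lin K (tensor K A B) U g" "t \<in>\<^sub>v tensor K A B"
    and "\<And>a b. a \<in>\<^sub>v A \<Longrightarrow> b \<in>\<^sub>v B \<Longrightarrow> f (pure K a A B b) = g (pure K a A B b)"
  shows "f t = g t"
  using assms(4) by (simp add: lin_eq_sw[OF assms(1,3)] lin_eq_sw[OF assms(2,3)])

end

text \<open>Both sums run over fixed representatives, so this is the exchange of two finite sums in
  an abelian group. It permutes indefinitely as a rewrite rule and is therefore applied only in
  chosen instances.\<close>

lemma sw_swap:
  assumes "module K A" "module K B" "module K C" "module K D" "module K U"
    and "s \<in>\<^sub>v tensor K A B" "t \<in>\<^sub>v tensor K C D"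
    and "\<And>a b c d. a \<in>\<^sub>v A \<Longrightarrow> b \<in>\<^sub>v B \<Longrightarrow> c \<in>\<^sub>v C \<Longrightarrow> d \<in>\<^sub>v D \<Longrightarrow> f a b c d \<in>\<^sub>v U"
  shows "sw K A B U s (\<lambda>a b. sw K C D U t (\<lambda>c d. f a b c d))
    = sw K C D U t (\<lambda>c d. sw K A B U s (\<lambda>a b. f a b c d))"
proof -
  have "f a b c d \<in> carrier U" if "(a, b) \<in> set (terms s)" "(c, d) \<in> set (terms t)" for a b c d
    using that assms(8)[of a b c d] terms_subset[OF assms(1,2,6)] terms_subset[OF assms(3,4,7)]
    by (auto simp: el_def)
  then show ?thesis
    using fsum_swap[OF assms(5), of "terms s" "terms t" f] by (simp add: sw_eq_fsum assms)
qed

definition trilin :: "('k, 'r) ring_scheme \<Rightarrow> ('k, 't) module \<Rightarrow> ('k, 'u) module \<Rightarrow> ('k, 'v) module \<Rightarrow>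
    ('k, 'w) module \<Rightarrow> ('t \<Rightarrow> 'u \<Rightarrow> 'v \<Rightarrow> 'w) \<Rightarrow> bool" where
  "trilin K A B C U f \<longleftrightarrow>
     (\<forall>b c. b \<in>\<^sub>v B \<longrightarrow> c \<in>\<^sub>v C \<longrightarrow> lin K A U (\<lambda>a. f a b c)) \<and>
     (\<forall>a c. a \<in>\<^sub>v A \<longrightarrow> c \<in>\<^sub>v C \<longrightarrow> lin K B U (\<lambda>b. f a b c)) \<and>
     (\<forall>a b. a \<in>\<^sub>v A \<longrightarrow> b \<in>\<^sub>v B \<longrightarrow> lin K C U (\<lambda>c. f a b c))"

lemma trilinI:
  assumes "\<And>b c. b \<in>\<^sub>v B \<Longrightarrow> c \<in>\<^sub>v C \<Longrightarrow> lin K A U (\<lambda>a. f a b c)"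
    and "\<And>a c. a \<in>\<^sub>v A \<Longrightarrow> c \<in>\<^sub>v C \<Longrightarrow> lin K B U (\<lambda>b. f a b c)"
    and "\<And>a b. a \<in>\<^sub>v A \<Longrightarrow> b \<in>\<^sub>v B \<Longrightarrow> lin K C U (\<lambda>c. f a b c)"
  shows "trilin K A B C U (\<lambda>a b c. f a b c)"
  using assms by (simp add: trilin_def)

lemma trilinD:
  assumes "trilin K A B C U f"
  shows "b \<in>\<^sub>v B \<Longrightarrow> c \<in>\<^sub>v C \<Longrightarrow> lin K A U (\<lambda>a. f a b c)"
    and "a \<in>\<^sub>v A \<Longrightarrow> c \<in>\<^sub>v C \<Longrightarrow> lin K B U (\<lambda>b. f a b c)"
    and "a \<in>\<^sub>v A \<Longrightarrow> b \<in>\<^sub>v B \<Longrightarrow> lin K C U (\<lambda>c. f a b c)"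
    and "a \<in>\<^sub>v A \<Longrightarrow> b \<in>\<^sub>v B \<Longrightarrow> c \<in>\<^sub>v C \<Longrightarrow> f a b c \<in>\<^sub>v U"
  using assms el_lin[of K C U "\<lambda>c. f a b c"] by (auto simp: trilin_def)

lemma bilinD:
  assumes "bilin K A B U f"
  shows "a \<in>\<^sub>v A \<Longrightarrow> lin K B U (\<lambda>b. f a b)"
    and "b \<in>\<^sub>v B \<Longrightarrow> lin K A U (\<lambda>a. f a b)"
    and "a \<in>\<^sub>v A \<Longrightarrow> b \<in>\<^sub>v B \<Longrightarrow> f a b \<in>\<^sub>v U"
  using assms by (auto simp: bilin_def intro: el_lin)

lemma linear_maps_lin:
  assumes "module K V" "module K W"
  shows "f \<in> linear_maps K V W \<longleftrightarrow> lin K V W f \<and> f \<in> extensional (carrier V)"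
  using assms by (auto simp: linear_maps_def lin_def PiE_def)

lemma linear_maps_eqI:
  assumes "f \<in> linear_maps K V W" "g \<in> linear_maps K V W" "\<And>x. x \<in>\<^sub>v V \<Longrightarrow> f x = g x"
  shows "f = g"
  using assms by (auto simp: linear_maps_def el_def intro: PiE_ext)

section \<open>Untwisting Hom-bialgebras, modules and comodules\<close>

locale bijective_hom_bialgebra =
  fixes K :: "('k, 'r) ring_scheme" and H :: "('k, 'a) hom_bialg"
  assumes bialgebra: "hom_bialgebra K H" and bijective: "\<alpha>_bij H"
begin

abbreviation tensor_space  (infixr \<open>\<otimes>\<^sub>v\<close> 75) where "V \<otimes>\<^sub>v W \<equiv> tensor K V W"
abbreviation pure_tensor  (\<open>(_ \<otimes>\<langle>_,_\<rangle> _)\<close> [76, 0, 0, 75] 75) where "v \<otimes>\<langle>V, W\<rangle> w \<equiv> pure K v V W w"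
abbreviation vspace where "vspace \<equiv> module K"
abbreviation L where "L \<equiv> lin K"
abbreviation S where "S \<equiv> sw K"

text \<open>From here on the simplifier acts as a type checker: typing and linearity goals are
  decomposed along the syntax of the term. Together with the rules that push linear maps into sums
  and flatten sums over sums, it brings an expression to nested sums with a pure body.\<close>

lemmas [simp] = bilinI[where K = K] trilinI[where K = K] tensor_module[where K = K] lin_id[where K = K] el_pure[where K = K]
  sw_el[where K = K] sw_pure[where K = K]

lemma lin_pure [simp]:
  assumes "vspace A" "vspace B"
  shows "L V A f \<Longrightarrow> b \<in>\<^sub>v B \<Longrightarrow> L V (A \<otimes>\<^sub>v B) (\<lambda>x. f x \<otimes>\<langle>A, B\<rangle> b)"
    and "L V B g \<Longrightarrow> a \<in>\<^sub>v A \<Longrightarrow> L V (A \<otimes>\<^sub>v B) (\<lambda>x. a \<otimes>\<langle>A, B\<rangle> g x)"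
  using bilin_pure[OF assms] by (auto intro: lin_comp dest: bilinD)

lemma lin_sw_arg [simp]:
  "vspace A \<Longrightarrow> vspace B \<Longrightarrow> vspace U \<Longrightarrow> L V (A \<otimes>\<^sub>v B) t \<Longrightarrow> bilin K A B U (\<lambda>a b. f a b) \<Longrightarrow>
    L V U (\<lambda>x. S A B U (t x) (\<lambda>a b. f a b))"
  by (rule lin_comp[OF lin_sw])

lemmas [simp] = lin_sw_body[where K = K]

lemma pure_sw [simp]:
  assumes "vspace A" "vspace B" "vspace C" "vspace D" "t \<in>\<^sub>v A \<otimes>\<^sub>v B"
  shows "(\<And>a b. a \<in>\<^sub>v A \<Longrightarrow> b \<in>\<^sub>v B \<Longrightarrow> f a b \<in>\<^sub>v C) \<Longrightarrow> d \<in>\<^sub>v D \<Longrightarrow>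
      S A B C t (\<lambda>a b. f a b) \<otimes>\<langle>C, D\<rangle> d = S A B (C \<otimes>\<^sub>v D) t (\<lambda>a b. f a b \<otimes>\<langle>C, D\<rangle> d)"
    and "(\<And>a b. a \<in>\<^sub>v A \<Longrightarrow> b \<in>\<^sub>v B \<Longrightarrow> g a b \<in>\<^sub>v D) \<Longrightarrow> c \<in>\<^sub>v C \<Longrightarrow>
      c \<otimes>\<langle>C, D\<rangle> S A B D t (\<lambda>a b. g a b) = S A B (C \<otimes>\<^sub>v D) t (\<lambda>a b. c \<otimes>\<langle>C, D\<rangle> g a b)"
  by (rule lin_push_sw[of K A B C "C \<otimes>\<^sub>v D" "\<lambda>x. x \<otimes>\<langle>C, D\<rangle> d" t f]; simp add: assms)
    (rule lin_push_sw[of K A B D "C \<otimes>\<^sub>v D" "\<lambda>x. c \<otimes>\<langle>C, D\<rangle> x" t g]; simp add: assms)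

lemma sw_sw [simp]:
  assumes "vspace A" "vspace B" "vspace C" "vspace D" "vspace U" "t \<in>\<^sub>v C \<otimes>\<^sub>v D"
    and "\<And>c d. c \<in>\<^sub>v C \<Longrightarrow> d \<in>\<^sub>v D \<Longrightarrow> g c d \<in>\<^sub>v A \<otimes>\<^sub>v B"
    and "bilin K A B U (\<lambda>a b. f a b)"
  shows "S A B U (S C D (A \<otimes>\<^sub>v B) t (\<lambda>c d. g c d)) (\<lambda>a b. f a b)
    = S C D U t (\<lambda>c d. S A B U (g c d) (\<lambda>a b. f a b))"
  by (rule lin_push_sw[of K C D "A \<otimes>\<^sub>v B" U "\<lambda>t. S A B U t f" t g]; simp add: assms lin_sw)

section \<open>Spaces with a bijective structure map\<close>

definition hspace :: "('k, 'a, 'z) hom_space_scheme \<Rightarrow> bool" where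
  "hspace M \<longleftrightarrow> vspace (vs M) \<and> \<alpha> M \<in> linear_maps K (vs M) (vs M) \<and> \<alpha>_bij M"

lemma hspace_vspace [simp]: "hspace M \<Longrightarrow> vspace (vs M)"
  by (simp add: hspace_def)

lemma hspace_lin: "hspace M \<Longrightarrow> L (vs M) (vs M) (\<alpha> M)"
  unfolding hspace_def using linear_maps_lin by blast

context
  fixes M :: "('k, 'a, 'z) hom_space_scheme"
  assumes M: "hspace M"
begin

lemma bij_\<alpha>: "bij_betw (\<alpha> M) (elts M) (elts M)"
  using M unfolding hspace_def \<alpha>_bij_def by blast

lemma \<alpha>_\<alpha>inv [simp]: "x \<in>\<^sub>v vs M \<Longrightarrow> \<alpha> M (\<alpha>inv M x) = x"
  unfolding \<alpha>inv_def el_def by (rule bij_betw_inv_into_right[OF bij_\<alpha>])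

lemma \<alpha>inv_\<alpha> [simp]: "x \<in>\<^sub>v vs M \<Longrightarrow> \<alpha>inv M (\<alpha> M x) = x"
  unfolding \<alpha>inv_def el_def by (rule bij_betw_inv_into_left[OF bij_\<alpha>])

lemma \<alpha>_el: "x \<in>\<^sub>v vs M \<Longrightarrow> \<alpha> M x \<in>\<^sub>v vs M"
  using hspace_lin[OF M] by (rule el_lin)

lemma \<alpha>inv_el: "x \<in>\<^sub>v vs M \<Longrightarrow> \<alpha>inv M x \<in>\<^sub>v vs M"
  unfolding \<alpha>inv_def el_def by (rule bij_betw_apply[OF bij_betw_inv_into[OF bij_\<alpha>]])

lemma \<alpha>inv_lin: "L (vs M) (vs M) (\<alpha>inv M)"
proof -
  interpret V: module K "vs M" using M by simp
  note 1 = \<alpha>inv_el[unfolded el_def] \<alpha>_\<alpha>inv[unfolded el_def]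
  have lin: "\<alpha> M (x \<oplus>\<^bsub>vs M\<^esub> y) = \<alpha> M x \<oplus>\<^bsub>vs M\<^esub> \<alpha> M y" "\<alpha> M (c \<odot>\<^bsub>vs M\<^esub> x) = c \<odot>\<^bsub>vs M\<^esub> \<alpha> M x"
    if "x \<in> elts M" "y \<in> elts M" "c \<in> carrier K" for x y c
    using hspace_lin[OF M] that by (auto simp: lin_def)
  have "\<alpha>inv M (x \<oplus>\<^bsub>vs M\<^esub> y) = \<alpha>inv M x \<oplus>\<^bsub>vs M\<^esub> \<alpha>inv M y" if "x \<in> elts M" "y \<in> elts M" for x y
    using that 1 lin(1)[of "\<alpha>inv M x" "\<alpha>inv M y"] V.R.zero_closed
    by (metis \<alpha>inv_\<alpha> el_def V.a_closed)
  moreover have "\<alpha>inv M (c \<odot>\<^bsub>vs M\<^esub> x) = c \<odot>\<^bsub>vs M\<^esub> \<alpha>inv M x" if "x \<in> elts M" "c \<in> carrier K" for x c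
    using that 1 lin(2)[of "\<alpha>inv M x" "\<alpha>inv M x" c]
    by (metis \<alpha>inv_\<alpha> el_def V.smult_closed)
  ultimately show ?thesis
    using M 1 by (simp add: lin_def)
qed

lemma \<alpha>_inject: "x \<in>\<^sub>v vs M \<Longrightarrow> y \<in>\<^sub>v vs M \<Longrightarrow> \<alpha> M x = \<alpha> M y \<Longrightarrow> x = y"
  by (metis \<alpha>inv_\<alpha>)

text \<open>The premise \<open>W = vs M\<close> makes the rules applicable when \<open>vs M\<close> has been rewritten to a tensor product.\<close>

lemma \<alpha>_closed [simp]: "W = vs M \<Longrightarrow> x \<in>\<^sub>v W \<Longrightarrow> \<alpha> M x \<in>\<^sub>v W"
  by (simp only: \<alpha>_el)

lemma \<alpha>inv_closed [simp]: "W = vs M \<Longrightarrow> x \<in>\<^sub>v W \<Longrightarrow> \<alpha>inv M x \<in>\<^sub>v W"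
  by (simp only: \<alpha>inv_el)

lemma \<alpha>inv_eqI: "y \<in>\<^sub>v vs M \<Longrightarrow> x = \<alpha> M y \<Longrightarrow> \<alpha>inv M x = y"
  by simp

lemma lin_\<alpha> [simp]: "W = vs M \<Longrightarrow> L V W f \<Longrightarrow> L V W (\<lambda>x. \<alpha> M (f x))"
  using lin_comp[OF hspace_lin[OF M]] by blast

lemma lin_\<alpha>inv [simp]: "W = vs M \<Longrightarrow> L V W f \<Longrightarrow> L V W (\<lambda>x. \<alpha>inv M (f x))"
  using lin_comp[OF \<alpha>inv_lin] by blast

lemma \<alpha>_sw [simp]:
  "W = vs M \<Longrightarrow> vspace A \<Longrightarrow> vspace B \<Longrightarrow> t \<in>\<^sub>v A \<otimes>\<^sub>v B \<Longrightarrow>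
    (\<And>a b. a \<in>\<^sub>v A \<Longrightarrow> b \<in>\<^sub>v B \<Longrightarrow> f a b \<in>\<^sub>v W) \<Longrightarrow>
    \<alpha> M (S A B W t (\<lambda>a b. f a b)) = S A B W t (\<lambda>a b. \<alpha> M (f a b))"
  using lin_push_sw[OF _ _ hspace_lin[OF M]] by blast

lemma \<alpha>inv_sw [simp]:
  "W = vs M \<Longrightarrow> vspace A \<Longrightarrow> vspace B \<Longrightarrow> t \<in>\<^sub>v A \<otimes>\<^sub>v B \<Longrightarrow>
    (\<And>a b. a \<in>\<^sub>v A \<Longrightarrow> b \<in>\<^sub>v B \<Longrightarrow> f a b \<in>\<^sub>v W) \<Longrightarrow>
    \<alpha>inv M (S A B W t (\<lambda>a b. f a b)) = S A B W t (\<lambda>a b. \<alpha>inv M (f a b))"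
  using lin_push_sw[OF _ _ \<alpha>inv_lin] by blast

end

section \<open>The untwisted bialgebra\<close>

lemma
  shows vspace_H: "vspace (vs H)"
    and \<alpha>_linear_map: "\<alpha> H \<in> linear_maps K (vs H) (vs H)"
    and \<mu>_linear_map: "\<mu> H \<in> linear_maps K (vs H \<otimes>\<^sub>v vs H) (vs H)"
    and \<Delta>_linear_map: "\<Delta> H \<in> linear_maps K (vs H) (vs H \<otimes>\<^sub>v vs H)"
    and \<alpha>_\<mu>: "\<forall>h \<in> elts H. \<forall>k \<in> elts H. \<alpha> H (hmult K H h k) = hmult K H (\<alpha> H h) (\<alpha> H k)"
    and \<mu>_hom_assoc: "\<forall>h \<in> elts H. \<forall>k \<in> elts H. \<forall>l \<in> elts H.
      hmult K H (\<alpha> H h) (hmult K H k l) = hmult K H (hmult K H h k) (\<alpha> H l)"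
    and \<Delta>_hom_coassoc: "\<forall>h \<in> elts H.
      sweedler (HHH K H) (\<Delta> H h) (\<lambda>h1 h2. sweedler (HHH K H) (\<Delta> H h1) (\<lambda>x y.
        x \<otimes>\<langle>vs H, HH K H\<rangle> (y \<otimes>\<langle>vs H, vs H\<rangle> \<alpha> H h2)))
      = sweedler (HHH K H) (\<Delta> H h) (\<lambda>h1 h2. \<alpha> H h1 \<otimes>\<langle>vs H, HH K H\<rangle> \<Delta> H h2)"
    and \<Delta>_\<mu>: "\<forall>h \<in> elts H. \<forall>k \<in> elts H. \<Delta> H (hmult K H h k) =
      sweedler (HH K H) (\<Delta> H h) (\<lambda>h1 h2. sweedler (HH K H) (\<Delta> H k) (\<lambda>k1 k2.
        hmult K H h1 k1 \<otimes>\<langle>vs H, vs H\<rangle> hmult K H h2 k2))"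
    and \<Delta>_\<alpha>: "\<forall>h \<in> elts H. \<Delta> H (\<alpha> H h) =
      sweedler (HH K H) (\<Delta> H h) (\<lambda>h1 h2. \<alpha> H h1 \<otimes>\<langle>vs H, vs H\<rangle> \<alpha> H h2)"
  using bialgebra unfolding hom_bialgebra_def by - (elim conjE, assumption)+

lemma hspace_H [simp]: "hspace H"
  unfolding hspace_def using vspace_H \<alpha>_linear_map bijective by (intro conjI)

definition mul :: "'a univ \<Rightarrow> 'a univ \<Rightarrow> 'a univ"  (infixl \<open>\<star>\<close> 80) where
  "x \<star> y = \<alpha>inv H (\<mu> H (x \<otimes>\<langle>vs H, vs H\<rangle> y))"

definition De :: "'a univ \<Rightarrow> 'a univ" where
  "De h = \<Delta> H (\<alpha>inv H h)"

lemma lin_\<mu>: "L (vs H \<otimes>\<^sub>v vs H) (vs H) (\<mu> H)" and lin_\<Delta>: "L (vs H) (vs H \<otimes>\<^sub>v vs H) (\<Delta> H)"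
  using \<mu>_linear_map \<Delta>_linear_map by (simp_all add: linear_maps_lin)

lemma el_\<mu> [simp]: "t \<in>\<^sub>v (vs H \<otimes>\<^sub>v vs H) \<Longrightarrow> \<mu> H t \<in>\<^sub>v vs H"
  by (rule el_lin[OF lin_\<mu>])

lemma el_\<Delta> [simp]: "x \<in>\<^sub>v vs H \<Longrightarrow> \<Delta> H x \<in>\<^sub>v (vs H \<otimes>\<^sub>v vs H)"
  by (rule el_lin[OF lin_\<Delta>])

lemma \<mu>_eq: "x \<in>\<^sub>v vs H \<Longrightarrow> y \<in>\<^sub>v vs H \<Longrightarrow> \<mu> H (x \<otimes>\<langle>vs H, vs H\<rangle> y) = \<alpha> H (x \<star> y)"
  by (simp add: mul_def)

lemma \<Delta>_eq: "x \<in>\<^sub>v vs H \<Longrightarrow> \<Delta> H x = De (\<alpha> H x)"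
  by (simp add: De_def)

lemma el_mul [simp]: "x \<in>\<^sub>v vs H \<Longrightarrow> y \<in>\<^sub>v vs H \<Longrightarrow> x \<star> y \<in>\<^sub>v vs H"
  unfolding mul_def by simp

lemma el_De [simp]: "x \<in>\<^sub>v vs H \<Longrightarrow> De x \<in>\<^sub>v (vs H \<otimes>\<^sub>v vs H)"
  unfolding De_def by simp

lemma lin_mul [simp]:
  "L V (vs H) f \<Longrightarrow> y \<in>\<^sub>v vs H \<Longrightarrow> L V (vs H) (\<lambda>x. f x \<star> y)"
  "L V (vs H) f \<Longrightarrow> y \<in>\<^sub>v vs H \<Longrightarrow> L V (vs H) (\<lambda>x. y \<star> f x)"
  unfolding mul_def by (simp_all add: lin_comp[OF lin_\<mu>])

lemma lin_De [simp]: "L V (vs H) f \<Longrightarrow> L V (vs H \<otimes>\<^sub>v vs H) (\<lambda>x. De (f x))"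
  unfolding De_def by (simp add: lin_comp[OF lin_\<Delta>])

lemma \<alpha>_mul [simp]:
  assumes "x \<in>\<^sub>v vs H" "y \<in>\<^sub>v vs H"
  shows "\<alpha> H (x \<star> y) = \<alpha> H x \<star> \<alpha> H y"
proof -
  have "\<alpha> H (\<mu> H (x \<otimes>\<langle>vs H, vs H\<rangle> y)) = \<mu> H (\<alpha> H x \<otimes>\<langle>vs H, vs H\<rangle> \<alpha> H y)"
    using \<alpha>_\<mu> assms by (simp add: el_def)
  then have "\<alpha> H (\<alpha> H (x \<star> y)) = \<alpha> H (\<alpha> H x \<star> \<alpha> H y)"
    using assms by (simp add: \<mu>_eq)
  from \<alpha>_inject[OF hspace_H _ _ this] show ?thesis
    using assms by simp
qed

lemma \<alpha>inv_mul [simp]: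
  assumes "x \<in>\<^sub>v vs H" "y \<in>\<^sub>v vs H"
  shows "\<alpha>inv H (x \<star> y) = \<alpha>inv H x \<star> \<alpha>inv H y"
  using assms by (auto intro: \<alpha>inv_eqI)

lemma mul_assoc [simp]:
  assumes "x \<in>\<^sub>v vs H" "y \<in>\<^sub>v vs H" "z \<in>\<^sub>v vs H"
  shows "(x \<star> y) \<star> z = x \<star> (y \<star> z)"
proof -
  have "\<mu> H (\<alpha> H x \<otimes>\<langle>vs H, vs H\<rangle> \<mu> H (y \<otimes>\<langle>vs H, vs H\<rangle> z)) = \<mu> H (\<mu> H (x \<otimes>\<langle>vs H, vs H\<rangle> y) \<otimes>\<langle>vs H, vs H\<rangle> \<alpha> H z)"
    using \<mu>_hom_assoc assms unfolding el_def by blast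
  then have "\<alpha> H (\<alpha> H (x \<star> (y \<star> z))) = \<alpha> H (\<alpha> H (x \<star> y \<star> z))"
    using assms by (simp add: \<mu>_eq)
  then show ?thesis
    using assms by (metis \<alpha>_el \<alpha>_inject el_mul hspace_H)
qed

lemma De_\<alpha>:
  assumes "h \<in>\<^sub>v vs H"
  shows "De (\<alpha> H h) = S (vs H) (vs H) (vs H \<otimes>\<^sub>v vs H) (De h) (\<lambda>x y. \<alpha> H x \<otimes>\<langle>vs H, vs H\<rangle> \<alpha> H y)"
proof -
  have "\<Delta> H (\<alpha> H (\<alpha>inv H h)) = sweedler (vs H \<otimes>\<^sub>v vs H) (\<Delta> H (\<alpha>inv H h)) (\<lambda>x y. \<alpha> H x \<otimes>\<langle>vs H, vs H\<rangle> \<alpha> H y)"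
    using \<Delta>_\<alpha> \<alpha>inv_el[OF hspace_H assms] unfolding el_def by blast
  then show ?thesis
    using assms by (simp add: sweedler_eq_sw[of K "vs H" "vs H"] De_def)
qed

text \<open>Moves \<alpha> from the tensor that is summed over into the body, where it travels on to
  the variables. The rules for \<open>\<alpha>inv\<close> and for the coactions serve the same
  normal form.\<close>

lemma sw_De_\<alpha> [simp]:
  assumes "vspace U" "h \<in>\<^sub>v vs H" "bilin K (vs H) (vs H) U (\<lambda>a b. f a b)"
  shows "S (vs H) (vs H) U (De (\<alpha> H h)) (\<lambda>a b. f a b) = S (vs H) (vs H) U (De h) (\<lambda>a b. f (\<alpha> H a) (\<alpha> H b))"
  using assms by (simp add: De_\<alpha>)

lemma sw_De_\<alpha>inv [simp]:
  assumes "vspace U" "h \<in>\<^sub>v vs H" "bilin K (vs H) (vs H) U (\<lambda>a b. f a b)"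
  shows "S (vs H) (vs H) U (De (\<alpha>inv H h)) (\<lambda>a b. f a b) = S (vs H) (vs H) U (De h) (\<lambda>a b. f (\<alpha>inv H a) (\<alpha>inv H b))"
proof -
  note [simp] = bilinD[OF assms(3)]
  have "bilin K (vs H) (vs H) U (\<lambda>a b. f (\<alpha>inv H a) (\<alpha>inv H b))"
    by (simp add: lin_comp[of K "vs H" U "f _"] lin_comp[of K "vs H" U "\<lambda>a. f a _"])
  then show ?thesis
    using sw_De_\<alpha>[of U "\<alpha>inv H h" "\<lambda>a b. f (\<alpha>inv H a) (\<alpha>inv H b)"] assms by simp
qed

lemma sw_De_mul [simp]:
  assumes "vspace U" "h \<in>\<^sub>v vs H" "k \<in>\<^sub>v vs H" "bilin K (vs H) (vs H) U (\<lambda>a b. f a b)"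
  shows "S (vs H) (vs H) U (De (h \<star> k)) (\<lambda>a b. f a b)
    = S (vs H) (vs H) U (De h) (\<lambda>a b. S (vs H) (vs H) U (De k) (\<lambda>c d. f (a \<star> c) (b \<star> d)))"
proof -
  have "\<Delta> H (\<mu> H (h \<otimes>\<langle>vs H, vs H\<rangle> k)) = sweedler (vs H \<otimes>\<^sub>v vs H) (\<Delta> H h) (\<lambda>a b. sweedler (vs H \<otimes>\<^sub>v vs H) (\<Delta> H k) (\<lambda>c d.
      \<mu> H (a \<otimes>\<langle>vs H, vs H\<rangle> c) \<otimes>\<langle>vs H, vs H\<rangle> \<mu> H (b \<otimes>\<langle>vs H, vs H\<rangle> d)))"
    if "h \<in>\<^sub>v vs H" "k \<in>\<^sub>v vs H" for h k
    using \<Delta>_\<mu> that unfolding el_def by blast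
  \<comment> \<open>The two inverses compensate for one \<alpha> in
    \<open>\<mu> = \<alpha> \<circ> \<star>\<close> and one in
    \<open>\<Delta> = De \<circ> \<alpha>\<close>.\<close>
  from this[of "\<alpha>inv H (\<alpha>inv H h)" "\<alpha>inv H (\<alpha>inv H k)"]
  have "De (h \<star> k)
    = S (vs H) (vs H) (vs H \<otimes>\<^sub>v vs H) (De h) (\<lambda>a b. S (vs H) (vs H) (vs H \<otimes>\<^sub>v vs H) (De k) (\<lambda>c d. (a \<star> c) \<otimes>\<langle>vs H, vs H\<rangle> (b \<star> d)))"
    using assms(2,3) by (simp add: sweedler_eq_sw[of K "vs H" "vs H"] \<Delta>_eq \<mu>_eq)
  then show ?thesis
    using assms by simp
qed

text \<open>A trilinear f induces a linear map from H \<otimes> (H \<otimes> H) to U, and applying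
  it to the coassociativity identity gives the statement. In this form coassociativity regroups
  nested Sweedler sums under any body.\<close>

lemma De_coassoc:
  assumes "vspace U" "h \<in>\<^sub>v vs H" "trilin K (vs H) (vs H) (vs H) U (\<lambda>a b c. f a b c)"
  shows "S (vs H) (vs H) U (De h) (\<lambda>a b. S (vs H) (vs H) U (De a) (\<lambda>c d. f c d b))
    = S (vs H) (vs H) U (De h) (\<lambda>a b. S (vs H) (vs H) U (De b) (\<lambda>c d. f a c d))"
proof -
  let ?H = "vs H"
  let ?HH = "?H \<otimes>\<^sub>v ?H"
  let ?HHH = "?H \<otimes>\<^sub>v ?HH"
  note [simp] = trilinD[OF assms(3)]
  \<comment> \<open>Each of the two nested applications of
    \<open>\<Delta> = De \<circ> \<alpha>\<close> contributes one \<alpha>; on the leg that is not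
    split again, the second one is the \<alpha> of the Hom-axiom.\<close>
  let ?h = "\<alpha>inv H (\<alpha>inv H h)"
  have "sweedler ?HHH (\<Delta> H ?h) (\<lambda>h1 h2. sweedler ?HHH (\<Delta> H h1) (\<lambda>x y.
          x \<otimes>\<langle>vs H, ?HH\<rangle> (y \<otimes>\<langle>vs H, vs H\<rangle> \<alpha> H h2)))
        = sweedler ?HHH (\<Delta> H ?h) (\<lambda>h1 h2. \<alpha> H h1 \<otimes>\<langle>vs H, ?HH\<rangle> \<Delta> H h2)"
    using \<Delta>_hom_coassoc \<alpha>inv_el[OF hspace_H \<alpha>inv_el[OF hspace_H assms(2)]] unfolding el_def by blast
  then have "S ?H ?H ?HHH (De h) (\<lambda>a b. S ?H ?H ?HHH (De a) (\<lambda>c d. c \<otimes>\<langle>?H, ?HH\<rangle> (d \<otimes>\<langle>?H, ?H\<rangle> b)))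
    = S ?H ?H ?HHH (De h) (\<lambda>a b. a \<otimes>\<langle>?H, ?HH\<rangle> De b)"
    using assms(2) by (simp add: sweedler_eq_sw[of K "vs H" "vs H"] \<Delta>_eq)
  \<comment> \<open>Both sides are mapped to U by the linear map that f induces.\<close>
  then have "S ?H ?HH U
      (S ?H ?H ?HHH (De h) (\<lambda>a b. S ?H ?H ?HHH (De a) (\<lambda>c d. c \<otimes>\<langle>?H, ?HH\<rangle> (d \<otimes>\<langle>?H, ?H\<rangle> b))))
       (\<lambda>a t. S ?H ?H U t (\<lambda>b c. f a b c))
    = S ?H ?HH U (S ?H ?H ?HHH (De h) (\<lambda>a b. a \<otimes>\<langle>?H, ?HH\<rangle> De b))
       (\<lambda>a t. S ?H ?H U t (\<lambda>b c. f a b c))"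
    by simp
  then show ?thesis
    using assms by simp
qed

lemma tensor_map_eq:
  "vspace V \<Longrightarrow> vspace W \<Longrightarrow> t \<in>\<^sub>v V \<otimes>\<^sub>v W \<Longrightarrow>
    tensor_map K V W V' W' f g t = S V W (V' \<otimes>\<^sub>v W') t (\<lambda>v w. f v \<otimes>\<langle>V', W'\<rangle> g w)"
  by (simp add: tensor_map_def el_def sweedler_eq_sw)

section \<open>Untwisted modules\<close>

definition ac :: "('k, 'a, 'z) hom_module_scheme \<Rightarrow> 'a univ \<Rightarrow> 'a univ \<Rightarrow> 'a univ" where
  "ac M h m = \<alpha>inv M (act M (h \<otimes>\<langle>vs H, vs M\<rangle> m))"

text \<open>Linear data without the module axioms. The typing rules depend on this only, so they are
  available while the axioms of a new module are still being proved; \<open>hcoact\<close> plays the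
  same role for comodules.\<close>

definition hact :: "('k, 'a, 'z) hom_module_scheme \<Rightarrow> bool" where
  "hact M \<longleftrightarrow> hspace M \<and> act M \<in> linear_maps K (vs H \<otimes>\<^sub>v vs M) (vs M)"

definition hmod :: "('k, 'a, 'z) hom_module_scheme \<Rightarrow> bool" where
  "hmod M \<longleftrightarrow> left_module K H M \<and> \<alpha>_bij M"

lemma hact_hspace [simp]: "hact M \<Longrightarrow> hspace M"
  unfolding hact_def by blast

lemma hmod_hact [simp]: "hmod M \<Longrightarrow> hact M"
  unfolding hmod_def left_module_def hspace_def hact_def by blast

context
  fixes M :: "('k, 'a, 'z) hom_module_scheme"
  assumes M: "hact M"
begin

lemma act_linear_map: "act M \<in> linear_maps K (vs H \<otimes>\<^sub>v vs M) (vs M)"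
  using M unfolding hact_def by blast

lemma lin_act: "L (vs H \<otimes>\<^sub>v vs M) (vs M) (act M)"
  using act_linear_map M by (simp add: linear_maps_lin)

lemma el_act [simp]: "W = vs M \<Longrightarrow> t \<in>\<^sub>v vs H \<otimes>\<^sub>v W \<Longrightarrow> act M t \<in>\<^sub>v W"
  using el_lin[OF lin_act] by blast

lemma act_eq: "W = vs M \<Longrightarrow> h \<in>\<^sub>v vs H \<Longrightarrow> m \<in>\<^sub>v W \<Longrightarrow> act M (h \<otimes>\<langle>vs H, W\<rangle> m) = \<alpha> M (ac M h m)"
  using M by (simp add: ac_def)

lemma el_ac [simp]: "W = vs M \<Longrightarrow> h \<in>\<^sub>v vs H \<Longrightarrow> m \<in>\<^sub>v W \<Longrightarrow> ac M h m \<in>\<^sub>v W"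
  unfolding ac_def using M by simp

lemma lin_ac [simp]:
  "W = vs M \<Longrightarrow> L V (vs H) f \<Longrightarrow> m \<in>\<^sub>v W \<Longrightarrow> L V W (\<lambda>x. ac M (f x) m)"
  "W = vs M \<Longrightarrow> L V W g \<Longrightarrow> h \<in>\<^sub>v vs H \<Longrightarrow> L V W (\<lambda>x. ac M h (g x))"
  unfolding ac_def using M by (simp_all add: lin_comp[OF lin_act])

lemma ac_sw [simp]:
  assumes "vspace A" "vspace B" "t \<in>\<^sub>v A \<otimes>\<^sub>v B"
  shows "(\<And>a b. a \<in>\<^sub>v A \<Longrightarrow> b \<in>\<^sub>v B \<Longrightarrow> f a b \<in>\<^sub>v vs H) \<Longrightarrow> m \<in>\<^sub>v vs M \<Longrightarrow>
      ac M (S A B (vs H) t (\<lambda>a b. f a b)) m = S A B (vs M) t (\<lambda>a b. ac M (f a b) m)"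
    and "W = vs M \<Longrightarrow> (\<And>a b. a \<in>\<^sub>v A \<Longrightarrow> b \<in>\<^sub>v B \<Longrightarrow> g a b \<in>\<^sub>v W) \<Longrightarrow> h \<in>\<^sub>v vs H \<Longrightarrow>
      ac M h (S A B W t (\<lambda>a b. g a b)) = S A B W t (\<lambda>a b. ac M h (g a b))"
  by (rule lin_push_sw[of K A B "vs H" "vs M" "\<lambda>x. ac M x m" t f]; simp add: assms M)
    (rule lin_push_sw[of K A B W W "\<lambda>x. ac M h x" t g]; simp add: assms M)

end

context
  fixes M :: "('k, 'a, 'z) hom_module_scheme"
  assumes M: "hmod M"
begin

lemma \<alpha>_ac [simp]:
  assumes "h \<in>\<^sub>v vs H" "m \<in>\<^sub>v vs M"
  shows "\<alpha> M (ac M h m) = ac M (\<alpha> H h) (\<alpha> M m)"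
proof -
  have "\<alpha> M (act M (h \<otimes>\<langle>vs H, vs M\<rangle> m)) = act M (\<alpha> H h \<otimes>\<langle>vs H, vs M\<rangle> \<alpha> M m)"
    using M assms unfolding hmod_def left_module_def el_def by blast
  then have "\<alpha> M (\<alpha> M (ac M h m)) = \<alpha> M (ac M (\<alpha> H h) (\<alpha> M m))"
    using M assms by (simp add: act_eq)
  from \<alpha>_inject[OF _ _ _ this] show ?thesis
    using M assms by simp
qed

lemma \<alpha>inv_ac [simp]:
  assumes "h \<in>\<^sub>v vs H" "m \<in>\<^sub>v vs M"
  shows "\<alpha>inv M (ac M h m) = ac M (\<alpha>inv H h) (\<alpha>inv M m)"
  using assms M by (intro \<alpha>inv_eqI) simp_all

lemma ac_assoc [simp]:
  assumes "h \<in>\<^sub>v vs H" "k \<in>\<^sub>v vs H" "m \<in>\<^sub>v vs M"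
  shows "ac M h (ac M k m) = ac M (h \<star> k) m"
proof -
  have "act M (\<alpha> H h \<otimes>\<langle>vs H, vs M\<rangle> act M (k \<otimes>\<langle>vs H, vs M\<rangle> m)) =
      act M (\<mu> H (h \<otimes>\<langle>vs H, vs H\<rangle> k) \<otimes>\<langle>vs H, vs M\<rangle> \<alpha> M m)"
    using M assms unfolding hmod_def left_module_def el_def by blast
  then have "\<alpha> M (\<alpha> M (ac M h (ac M k m))) = \<alpha> M (\<alpha> M (ac M (h \<star> k) m))"
    using M assms by (simp add: act_eq \<mu>_eq)
  from \<alpha>_inject[OF _ _ _ \<alpha>_inject[OF _ _ _ this]] show ?thesis
    using M assms by simp
qed

end

lemma hmodI:
  fixes M :: "('k, 'a, 'z) hom_module_scheme"
  assumes M: "hact M"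
    and equivariant: "\<And>h m. h \<in>\<^sub>v vs H \<Longrightarrow> m \<in>\<^sub>v vs M \<Longrightarrow> \<alpha> M (ac M h m) = ac M (\<alpha> H h) (\<alpha> M m)"
    and assoc: "\<And>h k m. h \<in>\<^sub>v vs H \<Longrightarrow> k \<in>\<^sub>v vs H \<Longrightarrow> m \<in>\<^sub>v vs M \<Longrightarrow> ac M h (ac M k m) = ac M (h \<star> k) m"
  shows "hmod M"
  unfolding hmod_def left_module_def el_def[symmetric] Ball_def
proof (intro conjI allI impI)
  show "module K (vs M)" using M by simp
  show "\<alpha> M \<in> linear_maps K (vs M) (vs M)" "\<alpha>_bij M"
    using hact_hspace[OF M] unfolding hspace_def by blast+
qed (use M act_linear_map[OF M] in \<open>simp_all add: act_eq \<mu>_eq equivariant assoc\<close>)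

section \<open>Untwisted comodules\<close>

definition co :: "('k, 'a) hom_yd \<Rightarrow> 'a univ \<Rightarrow> 'a univ" where
  "co M m = coact M (\<alpha>inv M m)"

definition hcoact :: "('k, 'a) hom_yd \<Rightarrow> bool" where
  "hcoact M \<longleftrightarrow> hspace M \<and> coact M \<in> linear_maps K (vs M) (vs H \<otimes>\<^sub>v vs M)"

lemma hcoact_hspace [simp]: "hcoact M \<Longrightarrow> hspace M"
  unfolding hcoact_def by blast

context
  fixes M :: "('k, 'a) hom_yd"
  assumes M: "hcoact M"
begin

lemma coact_linear_map: "coact M \<in> linear_maps K (vs M) (vs H \<otimes>\<^sub>v vs M)"
  using M unfolding hcoact_def by blast

lemma lin_coact: "L (vs M) (vs H \<otimes>\<^sub>v vs M) (coact M)"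
  using coact_linear_map M by (simp add: linear_maps_lin)

lemma co_linear: "L (vs M) (vs H \<otimes>\<^sub>v vs M) (co M)"
  unfolding co_def using M by (simp add: lin_comp[OF lin_coact])

lemma coact_eq: "m \<in>\<^sub>v vs M \<Longrightarrow> coact M m = co M (\<alpha> M m)"
  using M by (simp add: co_def)

lemma el_co [simp]: "W = vs M \<Longrightarrow> m \<in>\<^sub>v W \<Longrightarrow> co M m \<in>\<^sub>v vs H \<otimes>\<^sub>v W"
  using el_lin[OF co_linear] by blast

lemma lin_co [simp]: "W = vs M \<Longrightarrow> L V W f \<Longrightarrow> L V (vs H \<otimes>\<^sub>v W) (\<lambda>x. co M (f x))"
  using lin_comp[OF co_linear] by blast

lemma co_sw [simp]:
  "W = vs M \<Longrightarrow> vspace A \<Longrightarrow> vspace B \<Longrightarrow> t \<in>\<^sub>v A \<otimes>\<^sub>v B \<Longrightarrow>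
    (\<And>a b. a \<in>\<^sub>v A \<Longrightarrow> b \<in>\<^sub>v B \<Longrightarrow> f a b \<in>\<^sub>v W) \<Longrightarrow>
    co M (S A B W t (\<lambda>a b. f a b)) = S A B (vs H \<otimes>\<^sub>v W) t (\<lambda>a b. co M (f a b))"
  using lin_push_sw[OF _ _ co_linear] by blast

end

definition hcomod :: "('k, 'a) hom_yd \<Rightarrow> bool" where
  "hcomod M \<longleftrightarrow> left_comodule K H M \<and> \<alpha>_bij M"

lemma hcomod_hcoact [simp]: "hcomod M \<Longrightarrow> hcoact M"
  unfolding hcomod_def left_comodule_def hcoact_def hspace_def Let_def by blast

text \<open>The equation is assumed for the single m in question, so that the rule can be used
  inside the proof of \<open>hcomod_iff\<close>, before the comodule axioms are available in
  untwisted form.\<close>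

lemma co_\<alpha>_rule:
  assumes "hspace M" "vspace U" "L (vs M) (vs H \<otimes>\<^sub>v vs M) (co M)" "m \<in>\<^sub>v vs M"
    and "co M (\<alpha> M m) = S (vs H) (vs M) (vs H \<otimes>\<^sub>v vs M) (co M m) (\<lambda>x n. \<alpha> H x \<otimes>\<langle>vs H, vs M\<rangle> \<alpha> M n)"
    and "bilin K (vs H) (vs M) U (\<lambda>x n. f x n)"
  shows "S (vs H) (vs M) U (co M (\<alpha> M m)) (\<lambda>x n. f x n) = S (vs H) (vs M) U (co M m) (\<lambda>x n. f (\<alpha> H x) (\<alpha> M n))"
  using assms by (simp add: el_lin[OF assms(3)])

lemma co_coassoc_rule:
  assumes M: "hspace M" and co: "L (vs M) (vs H \<otimes>\<^sub>v vs M) (co M)" and m: "m \<in>\<^sub>v vs M"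
    and coassoc: "S (vs H) (vs M) (vs H \<otimes>\<^sub>v vs H \<otimes>\<^sub>v vs M) (co M m)
        (\<lambda>x n. S (vs H) (vs H) (vs H \<otimes>\<^sub>v vs H \<otimes>\<^sub>v vs M) (De x)
          (\<lambda>a b. a \<otimes>\<langle>vs H, vs H \<otimes>\<^sub>v vs M\<rangle> (b \<otimes>\<langle>vs H, vs M\<rangle> n)))
      = S (vs H) (vs M) (vs H \<otimes>\<^sub>v vs H \<otimes>\<^sub>v vs M) (co M m) (\<lambda>x n. x \<otimes>\<langle>vs H, vs H \<otimes>\<^sub>v vs M\<rangle> co M n)"
    and U: "vspace U" and f: "trilin K (vs H) (vs H) (vs M) U (\<lambda>a b n. f a b n)"
  shows "S (vs H) (vs M) U (co M m) (\<lambda>x n. S (vs H) (vs H) U (De x) (\<lambda>a b. f a b n))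
    = S (vs H) (vs M) U (co M m) (\<lambda>x n. S (vs H) (vs M) U (co M n) (\<lambda>y p. f x y p))"
proof -
  note [simp] = trilinD[OF f] el_lin[OF co] lin_comp[OF co] M U m
  have "S (vs H) (vs H \<otimes>\<^sub>v vs M) U (S (vs H) (vs M) (vs H \<otimes>\<^sub>v vs H \<otimes>\<^sub>v vs M) (co M m)
        (\<lambda>x n. S (vs H) (vs H) (vs H \<otimes>\<^sub>v vs H \<otimes>\<^sub>v vs M) (De x)
          (\<lambda>a b. a \<otimes>\<langle>vs H, vs H \<otimes>\<^sub>v vs M\<rangle> (b \<otimes>\<langle>vs H, vs M\<rangle> n))))
        (\<lambda>a t. S (vs H) (vs M) U t (\<lambda>b n. f a b n))
      = S (vs H) (vs H \<otimes>\<^sub>v vs M) U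
        (S (vs H) (vs M) (vs H \<otimes>\<^sub>v vs H \<otimes>\<^sub>v vs M) (co M m) (\<lambda>x n. x \<otimes>\<langle>vs H, vs H \<otimes>\<^sub>v vs M\<rangle> co M n))
        (\<lambda>a t. S (vs H) (vs M) U t (\<lambda>b n. f a b n))"
    using coassoc by simp
  then show ?thesis by simp
qed

text \<open>As \<alpha> is bijective, an axiom for all m may equally be stated for all
  \<alpha>^-k(m); k is chosen so that the twists cancel. An equivalence is proved because the axioms
  have to be both used and established.\<close>

lemma hcomod_iff:
  assumes M: "hspace M"
  shows "hcomod M \<longleftrightarrow> coact M \<in> linear_maps K (vs M) (vs H \<otimes>\<^sub>v vs M) \<and>
    (\<forall>m. m \<in>\<^sub>v vs M \<longrightarrow>
      co M (\<alpha> M m) = S (vs H) (vs M) (vs H \<otimes>\<^sub>v vs M) (co M m) (\<lambda>x n. \<alpha> H x \<otimes>\<langle>vs H, vs M\<rangle> \<alpha> M n)) \<and>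
    (\<forall>m. m \<in>\<^sub>v vs M \<longrightarrow>
      S (vs H) (vs M) (vs H \<otimes>\<^sub>v vs H \<otimes>\<^sub>v vs M) (co M m)
        (\<lambda>x n. S (vs H) (vs H) (vs H \<otimes>\<^sub>v vs H \<otimes>\<^sub>v vs M) (De x)
          (\<lambda>a b. a \<otimes>\<langle>vs H, vs H \<otimes>\<^sub>v vs M\<rangle> (b \<otimes>\<langle>vs H, vs M\<rangle> n)))
      = S (vs H) (vs M) (vs H \<otimes>\<^sub>v vs H \<otimes>\<^sub>v vs M) (co M m) (\<lambda>x n. x \<otimes>\<langle>vs H, vs H \<otimes>\<^sub>v vs M\<rangle> co M n))"
    (is "_ \<longleftrightarrow> ?lin \<and> (\<forall>m. _ \<longrightarrow> ?eq m) \<and> (\<forall>m. _ \<longrightarrow> ?coassoc m)")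
proof -
  let ?HM = "vs H \<otimes>\<^sub>v vs M"
  let ?HHM = "vs H \<otimes>\<^sub>v vs H \<otimes>\<^sub>v vs M"
  let ?eq' = "\<lambda>m. tensor_map K (vs H) (vs M) (vs H) (vs M) (\<alpha> H) (\<alpha> M) (coact M m) = coact M (\<alpha> M m)"
  let ?coassoc' = "\<lambda>m. sweedler ?HHM (coact M m) (\<lambda>x n. sweedler ?HHM (\<Delta> H x) (\<lambda>x1 x2.
          x1 \<otimes>\<langle>vs H, ?HM\<rangle> (x2 \<otimes>\<langle>vs H, vs M\<rangle> \<alpha> M n)))
        = sweedler ?HHM (coact M m) (\<lambda>x n. \<alpha> H x \<otimes>\<langle>vs H, ?HM\<rangle> coact M n)"
  have "\<alpha> M \<in> linear_maps K (vs M) (vs M)" "\<alpha>_bij M"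
    using M unfolding hspace_def by blast+
  then have 1: "hcomod M \<longleftrightarrow> ?lin \<and> (\<forall>m. m \<in>\<^sub>v vs M \<longrightarrow> ?eq' m) \<and> (\<forall>m. m \<in>\<^sub>v vs M \<longrightarrow> ?coassoc' m)"
    using M hspace_vspace[OF M] unfolding hcomod_def left_comodule_def Let_def el_def Ball_def by blast
  show ?thesis
  proof (cases ?lin)
    case True
    note [simp] = M
    have lin: "L (vs M) ?HM (coact M)"
      using True by (simp add: linear_maps_lin)
    then have lin_co: "L (vs M) ?HM (co M)"
      unfolding co_def by (rule lin_comp) simp
    have [simp]: "coact M m \<in>\<^sub>v ?HM" "co M m \<in>\<^sub>v ?HM" if "m \<in>\<^sub>v vs M" for m
      using that lin lin_co by (auto intro: el_lin)
    have coact_eq: "coact M m = co M (\<alpha> M m)" if "m \<in>\<^sub>v vs M" for m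
      using that by (simp add: co_def)
    note [simp] = lin_comp[OF lin_co]
    have eq: "?eq' (\<alpha>inv M m) \<longleftrightarrow> ?eq m" if "m \<in>\<^sub>v vs M" for m
      using that by (auto simp: tensor_map_eq coact_eq)
    have "(\<forall>m. m \<in>\<^sub>v vs M \<longrightarrow> ?eq' m) \<longleftrightarrow> (\<forall>m. m \<in>\<^sub>v vs M \<longrightarrow> ?eq m)"
      using eq by (metis M \<alpha>_el \<alpha>inv_\<alpha> \<alpha>inv_el)
    \<comment> \<open>Untwisting coassociativity moves \<alpha> past \<open>co\<close>, hence it
      presupposes the untwisted compatibility with \<alpha>.\<close>
    moreover have "(\<forall>m. m \<in>\<^sub>v vs M \<longrightarrow> ?coassoc' m) \<longleftrightarrow> (\<forall>m. m \<in>\<^sub>v vs M \<longrightarrow> ?coassoc m)"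
      if *: "\<forall>m. m \<in>\<^sub>v vs M \<longrightarrow> ?eq m"
    proof -
      have [simp]: "S (vs H) (vs M) U (co M (\<alpha> M m)) (\<lambda>x n. f x n) = S (vs H) (vs M) U (co M m) (\<lambda>x n. f (\<alpha> H x) (\<alpha> M n))"
        if "vspace U" "m \<in>\<^sub>v vs M" "bilin K (vs H) (vs M) U (\<lambda>x n. f x n)" for U m f
        using that * lin_co by (intro co_\<alpha>_rule) auto
      \<comment> \<open>One inverse for the outer coaction and one for the inner \<Delta> or
        coaction, each of which is its untwisted form composed with \<alpha>.\<close>
      have coassoc: "?coassoc' (\<alpha>inv M (\<alpha>inv M m)) \<longleftrightarrow> ?coassoc m" if m: "m \<in>\<^sub>v vs M" for m
      proof -
        have "S (vs H) (vs M) U (co M (\<alpha>inv M m)) (\<lambda>x n. f x n) = S (vs H) (vs M) U (co M m) (\<lambda>x n. f (\<alpha>inv H x) (\<alpha>inv M n))"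
          if "vspace U" "m \<in>\<^sub>v vs M" "bilin K (vs H) (vs M) U (\<lambda>x n. f x n)" for U m f
        proof -
          note [simp] = bilinD[OF that(3)] that
          have "bilin K (vs H) (vs M) U (\<lambda>a b. f (\<alpha>inv H a) (\<alpha>inv M b))"
            by (simp add: lin_comp[of K "vs M" U "f _"] lin_comp[of K "vs H" U "\<lambda>a. f a _"])
          then show ?thesis
            using co_\<alpha>_rule[OF M that(1) lin_co, of "\<alpha>inv M m" "\<lambda>a b. f (\<alpha>inv H a) (\<alpha>inv M b)"]
                *[rule_format, of "\<alpha>inv M m"] by simp
        qed
        then show ?thesis
          using m by (simp add: sweedler_eq_sw[of K "vs H" "vs H"] sweedler_eq_sw[of K "vs H" "vs M"] coact_eq \<Delta>_eq)
      qed
      then show ?thesis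
        by (metis M \<alpha>_el \<alpha>inv_\<alpha> \<alpha>inv_el)
    qed
    ultimately show ?thesis
      unfolding 1 using True by blast
  next
    case False
    then show ?thesis unfolding 1 by blast
  qed
qed

context
  fixes M :: "('k, 'a) hom_yd"
  assumes M: "hcomod M"
begin

lemma co_\<alpha>:
  "m \<in>\<^sub>v vs M \<Longrightarrow>
    co M (\<alpha> M m) = S (vs H) (vs M) (vs H \<otimes>\<^sub>v vs M) (co M m) (\<lambda>x n. \<alpha> H x \<otimes>\<langle>vs H, vs M\<rangle> \<alpha> M n)"
  using M hcomod_iff[OF hcoact_hspace[OF hcomod_hcoact[OF M]]] by blast

lemma sw_co_\<alpha> [simp]:
  "W = vs M \<Longrightarrow> vspace U \<Longrightarrow> m \<in>\<^sub>v W \<Longrightarrow> bilin K (vs H) W U (\<lambda>x n. f x n) \<Longrightarrow>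
    S (vs H) W U (co M (\<alpha> M m)) (\<lambda>x n. f x n) = S (vs H) W U (co M m) (\<lambda>x n. f (\<alpha> H x) (\<alpha> M n))"
  using co_\<alpha>_rule[OF hcoact_hspace[OF hcomod_hcoact[OF M]] _ co_linear[OF hcomod_hcoact[OF M]] _ co_\<alpha>] by blast

lemma sw_co_\<alpha>inv [simp]:
  assumes "W = vs M" "vspace U" "m \<in>\<^sub>v W" "bilin K (vs H) W U (\<lambda>x n. f x n)"
  shows "S (vs H) W U (co M (\<alpha>inv M m)) (\<lambda>x n. f x n) = S (vs H) W U (co M m) (\<lambda>x n. f (\<alpha>inv H x) (\<alpha>inv M n))"
proof -
  note f = assms(4)[unfolded assms(1)]
  note [simp] = bilinD[OF f] assms(2) assms(3)[unfolded assms(1)] M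
  have "bilin K (vs H) (vs M) U (\<lambda>a b. f (\<alpha>inv H a) (\<alpha>inv M b))"
    by (simp add: lin_comp[of K "vs M" U "f _"] lin_comp[of K "vs H" U "\<lambda>a. f a _"])
  then show ?thesis
    unfolding assms(1)
    using sw_co_\<alpha>[of "vs M" U "\<alpha>inv M m" "\<lambda>a b. f (\<alpha>inv H a) (\<alpha>inv M b)"] by simp
qed

lemma co_coassoc:
  assumes "W = vs M" "vspace U" "m \<in>\<^sub>v W" "trilin K (vs H) (vs H) W U (\<lambda>a b n. f a b n)"
  shows "S (vs H) W U (co M m) (\<lambda>x n. S (vs H) (vs H) U (De x) (\<lambda>a b. f a b n))
    = S (vs H) W U (co M m) (\<lambda>x n. S (vs H) W U (co M n) (\<lambda>y p. f x y p))"
  unfolding assms(1)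
  by (rule co_coassoc_rule[OF hcoact_hspace[OF hcomod_hcoact[OF M]] co_linear[OF hcomod_hcoact[OF M]]])
    (use assms M hcomod_iff[OF hcoact_hspace[OF hcomod_hcoact[OF M]]] in blast)+

end

lemma hcomodI:
  fixes M :: "('k, 'a) hom_yd"
  assumes M: "hcoact M"
    and "\<And>m. m \<in>\<^sub>v vs M \<Longrightarrow>
      co M (\<alpha> M m) = S (vs H) (vs M) (vs H \<otimes>\<^sub>v vs M) (co M m) (\<lambda>x n. \<alpha> H x \<otimes>\<langle>vs H, vs M\<rangle> \<alpha> M n)"
    and "\<And>m. m \<in>\<^sub>v vs M \<Longrightarrow>
      S (vs H) (vs M) (vs H \<otimes>\<^sub>v vs H \<otimes>\<^sub>v vs M) (co M m)
        (\<lambda>x n. S (vs H) (vs H) (vs H \<otimes>\<^sub>v vs H \<otimes>\<^sub>v vs M) (De x)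
          (\<lambda>a b. a \<otimes>\<langle>vs H, vs H \<otimes>\<^sub>v vs M\<rangle> (b \<otimes>\<langle>vs H, vs M\<rangle> n)))
      = S (vs H) (vs M) (vs H \<otimes>\<^sub>v vs H \<otimes>\<^sub>v vs M) (co M m) (\<lambda>x n. x \<otimes>\<langle>vs H, vs H \<otimes>\<^sub>v vs M\<rangle> co M n)"
  shows "hcomod M"
  unfolding hcomod_iff[OF hcoact_hspace[OF M]] using assms(2,3) coact_linear_map[OF M] by blast

section \<open>The untwisted Yetter-Drinfeld condition\<close>

definition ydm :: "('k, 'a) hom_yd \<Rightarrow> bool" where
  "ydm M \<longleftrightarrow> yetter_drinfeld K H M \<and> \<alpha>_bij M"

lemma ydm_hmod [simp]: "ydm M \<Longrightarrow> hmod M"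
  and ydm_hcomod [simp]: "ydm M \<Longrightarrow> hcomod M"
  unfolding ydm_def yetter_drinfeld_def hmod_def hcomod_def by blast+

text \<open>The condition is assumed for one pair h, m as an identity of tensors, so that the rule
  already serves in the proof of \<open>ydm_iff\<close>.\<close>

lemma yd_rule:
  assumes M: "hmod M" "hcomod M"
    and yd: "S (vs H) (vs H) (vs H \<otimes>\<^sub>v vs M) (De h)
        (\<lambda>a b. S (vs H) (vs M) (vs H \<otimes>\<^sub>v vs M) (co M (ac M a m)) (\<lambda>x n. (x \<star> b) \<otimes>\<langle>vs H, vs M\<rangle> n))
      = S (vs H) (vs H) (vs H \<otimes>\<^sub>v vs M) (De h)
        (\<lambda>a b. S (vs H) (vs M) (vs H \<otimes>\<^sub>v vs M) (co M m) (\<lambda>x n. (a \<star> x) \<otimes>\<langle>vs H, vs M\<rangle> ac M b n))"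
    and "vspace U" "h \<in>\<^sub>v vs H" "m \<in>\<^sub>v vs M" and f: "bilin K (vs H) (vs M) U (\<lambda>x n. f x n)"
  shows "S (vs H) (vs H) U (De h)
        (\<lambda>a b. S (vs H) (vs M) U (co M (ac M a m)) (\<lambda>x n. f (x \<star> b) n))
      = S (vs H) (vs H) U (De h)
        (\<lambda>a b. S (vs H) (vs M) U (co M m) (\<lambda>x n. f (a \<star> x) (ac M b n)))"
proof -
  note [simp] = bilinD[OF f] assms(4-6) M f
  have "S (vs H) (vs M) U (S (vs H) (vs H) (vs H \<otimes>\<^sub>v vs M) (De h)
        (\<lambda>a b. S (vs H) (vs M) (vs H \<otimes>\<^sub>v vs M) (co M (ac M a m)) (\<lambda>x n. (x \<star> b) \<otimes>\<langle>vs H, vs M\<rangle> n)))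
        (\<lambda>x n. f x n)
      = S (vs H) (vs M) U (S (vs H) (vs H) (vs H \<otimes>\<^sub>v vs M) (De h)
        (\<lambda>a b. S (vs H) (vs M) (vs H \<otimes>\<^sub>v vs M) (co M m) (\<lambda>x n. (a \<star> x) \<otimes>\<langle>vs H, vs M\<rangle> ac M b n)))
        (\<lambda>x n. f x n)"
    by (simp only: yd)
  then show ?thesis by simp
qed

lemma ydm_iff:
  assumes M: "hmod M" "hcomod M"
  shows "ydm M \<longleftrightarrow> (\<forall>h m. h \<in>\<^sub>v vs H \<longrightarrow> m \<in>\<^sub>v vs M \<longrightarrow>
      S (vs H) (vs H) (vs H \<otimes>\<^sub>v vs M) (De h)
        (\<lambda>a b. S (vs H) (vs M) (vs H \<otimes>\<^sub>v vs M) (co M (ac M a m)) (\<lambda>x n. (x \<star> b) \<otimes>\<langle>vs H, vs M\<rangle> n))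
      = S (vs H) (vs H) (vs H \<otimes>\<^sub>v vs M) (De h)
        (\<lambda>a b. S (vs H) (vs M) (vs H \<otimes>\<^sub>v vs M) (co M m) (\<lambda>x n. (a \<star> x) \<otimes>\<langle>vs H, vs M\<rangle> ac M b n)))"
    (is "_ \<longleftrightarrow> (\<forall>h m. _ \<longrightarrow> _ \<longrightarrow> ?yd h m)")
proof -
  let ?HM = "vs H \<otimes>\<^sub>v vs M"
  let ?yd' = "\<lambda>h m. sweedler ?HM (\<Delta> H h) (\<lambda>h1 h2. sweedler ?HM (coact M (act M (h1 \<otimes>\<langle>vs H, vs M\<rangle> m))) (\<lambda>x n.
         \<mu> H (x \<otimes>\<langle>vs H, vs H\<rangle> \<alpha> H (\<alpha> H h2)) \<otimes>\<langle>vs H, vs M\<rangle> n))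
       = sweedler ?HM (\<Delta> H h) (\<lambda>h1 h2. sweedler ?HM (coact M m) (\<lambda>x n.
         \<mu> H (\<alpha> H (\<alpha> H h1) \<otimes>\<langle>vs H, vs H\<rangle> \<alpha> H x) \<otimes>\<langle>vs H, vs M\<rangle> act M (\<alpha> H h2 \<otimes>\<langle>vs H, vs M\<rangle> n)))"
  note [simp] = M
  have 1: "ydm M \<longleftrightarrow> (\<forall>h m. h \<in>\<^sub>v vs H \<longrightarrow> m \<in>\<^sub>v vs M \<longrightarrow> ?yd' h m)"
    using M unfolding ydm_def yetter_drinfeld_def hmod_def hcomod_def Let_def el_def Ball_def by blast
  \<comment> \<open>The original condition with every \<alpha> collected at the variables:
    \<alpha>^3 accompanies h and \<alpha>^2 accompanies m in the arguments of the action on both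
    sides.\<close>
  have 2: "?yd' h m \<longleftrightarrow>
      S (vs H) (vs H) ?HM (De h) (\<lambda>a b. S (vs H) (vs M) ?HM (co M (ac M (\<alpha> H (\<alpha> H (\<alpha> H a))) (\<alpha> M (\<alpha> M m))))
        (\<lambda>x n. (\<alpha> H x \<star> \<alpha> H (\<alpha> H (\<alpha> H (\<alpha> H b)))) \<otimes>\<langle>vs H, vs M\<rangle> n))
    = S (vs H) (vs H) ?HM (De h) (\<lambda>a b. S (vs H) (vs M) ?HM (co M m)
        (\<lambda>x n. (\<alpha> H (\<alpha> H (\<alpha> H (\<alpha> H a))) \<star> \<alpha> H (\<alpha> H (\<alpha> H x))) \<otimes>\<langle>vs H, vs M\<rangle> ac M (\<alpha> H (\<alpha> H (\<alpha> H b))) (\<alpha> M (\<alpha> M n))))"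
    if "h \<in>\<^sub>v vs H" "m \<in>\<^sub>v vs M" for h m
    using that by (simp add: sweedler_eq_sw[of K "vs H" "vs H"] sweedler_eq_sw[of K "vs H" "vs M"] coact_eq \<Delta>_eq \<mu>_eq act_eq)
  show ?thesis
    unfolding 1
  proof (intro iffI allI impI)
    fix h m assume yd: "\<forall>h m. h \<in>\<^sub>v vs H \<longrightarrow> m \<in>\<^sub>v vs M \<longrightarrow> ?yd' h m" and [simp]: "h \<in>\<^sub>v vs H" "m \<in>\<^sub>v vs M"
    \<comment> \<open>These powers cancel the \<alpha>^3 and \<alpha>^2 in \<open>2\<close> and
      leave a single \<alpha> on each factor of the H-leg.\<close>
    let ?h = "\<alpha>inv H (\<alpha>inv H (\<alpha>inv H h))" and ?m = "\<alpha>inv M (\<alpha>inv M m)"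
    have "?yd' ?h ?m" by (intro yd[rule_format]) simp_all
    then have "S (vs H) (vs H) ?HM (De h) (\<lambda>a b. S (vs H) (vs M) ?HM (co M (ac M a m)) (\<lambda>x n. (\<alpha> H x \<star> \<alpha> H b) \<otimes>\<langle>vs H, vs M\<rangle> n))
      = S (vs H) (vs H) ?HM (De h) (\<lambda>a b. S (vs H) (vs M) ?HM (co M m) (\<lambda>x n. (\<alpha> H a \<star> \<alpha> H x) \<otimes>\<langle>vs H, vs M\<rangle> ac M b n))"
      by (subst (asm) 2) simp_all
    \<comment> \<open>The remaining \<alpha> on the H-leg is removed by the map that is \<alpha>^-1
      on H and the identity on M.\<close>
    then have "S (vs H) (vs M) ?HM (S (vs H) (vs H) ?HM (De h)
        (\<lambda>a b. S (vs H) (vs M) ?HM (co M (ac M a m)) (\<lambda>x n. (\<alpha> H x \<star> \<alpha> H b) \<otimes>\<langle>vs H, vs M\<rangle> n)))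
        (\<lambda>x n. \<alpha>inv H x \<otimes>\<langle>vs H, vs M\<rangle> n)
      = S (vs H) (vs M) ?HM (S (vs H) (vs H) ?HM (De h)
        (\<lambda>a b. S (vs H) (vs M) ?HM (co M m) (\<lambda>x n. (\<alpha> H a \<star> \<alpha> H x) \<otimes>\<langle>vs H, vs M\<rangle> ac M b n)))
        (\<lambda>x n. \<alpha>inv H x \<otimes>\<langle>vs H, vs M\<rangle> n)"
      by simp
    then show "?yd h m" by simp
  next
    fix h m assume yd: "\<forall>h m. h \<in>\<^sub>v vs H \<longrightarrow> m \<in>\<^sub>v vs M \<longrightarrow> ?yd h m" and [simp]: "h \<in>\<^sub>v vs H" "m \<in>\<^sub>v vs M"
    have "?yd (\<alpha> H (\<alpha> H (\<alpha> H h))) (\<alpha> M (\<alpha> M m))" by (intro yd[rule_format]) simp_all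
    from yd_rule[OF M this, of ?HM "\<lambda>x n. \<alpha> H x \<otimes>\<langle>vs H, vs M\<rangle> n"] show "?yd' h m"
      by (subst 2) simp_all
  qed
qed

lemma yd:
  assumes "ydm M" "vspace U" "h \<in>\<^sub>v vs H" "m \<in>\<^sub>v vs M" "bilin K (vs H) (vs M) U (\<lambda>x n. f x n)"
  shows "S (vs H) (vs H) U (De h)
        (\<lambda>a b. S (vs H) (vs M) U (co M (ac M a m)) (\<lambda>x n. f (x \<star> b) n))
      = S (vs H) (vs H) U (De h)
        (\<lambda>a b. S (vs H) (vs M) U (co M m) (\<lambda>x n. f (a \<star> x) (ac M b n)))"
  using assms by (intro yd_rule[OF _ _ ydm_iff[THEN iffD1, rule_format]]) simp_all

section \<open>The tensor product of Yetter-Drinfeld modules\<close>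

text \<open>\<open>linear_maps\<close> consists of extensional functions, so maps given by a formula
  are cut off outside the carrier. Linearity is read off from a formula g that agrees with f
  inside.\<close>

lemma restrict_linear_map:
  assumes "L V W g" "\<And>x. x \<in>\<^sub>v V \<Longrightarrow> f x = g x"
  shows "(\<lambda>x \<in> carrier V. f x) \<in> linear_maps K V W"
proof -
  interpret V: module K V using assms by (simp add: lin_def)
  show ?thesis
    using assms by (auto simp: linear_maps_def lin_def el_def)
qed

lemma tensor_map_linear:
  assumes "L V V' f" "L W W' g"
  shows "tensor_map K V W V' W' f g \<in> linear_maps K (V \<otimes>\<^sub>v W) (V' \<otimes>\<^sub>v W')"
proof -
  note [simp] = assms[THEN lin_module(1)] assms[THEN lin_module(2)] assms assms[THEN el_lin]
  show ?thesis
    unfolding tensor_map_def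
    by (rule restrict_linear_map[of _ _ "\<lambda>t. S V W (V' \<otimes>\<^sub>v W') t (\<lambda>v w. f v \<otimes>\<langle>V', W'\<rangle> g w)"])
      (simp_all add: sweedler_eq_sw)
qed

lemma tensor_map_pure:
  assumes "L V V' f" "L W W' g" "v \<in>\<^sub>v V" "w \<in>\<^sub>v W"
  shows "tensor_map K V W V' W' f g (v \<otimes>\<langle>V, W\<rangle> w) = f v \<otimes>\<langle>V', W'\<rangle> g w"
proof -
  note [simp] = assms(1,2)[THEN lin_module(1)] assms(1,2)[THEN lin_module(2)] assms assms(1,2)[THEN el_lin]
  show ?thesis by (simp add: tensor_map_eq)
qed

definition ten :: "('k, 'a) hom_yd \<Rightarrow> ('k, 'a) hom_yd \<Rightarrow> ('k, 'a) hom_yd" where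
  "ten M N = \<lparr>vs = vs M \<otimes>\<^sub>v vs N, \<alpha> = tensor_\<alpha> K M N, act = tensor_act K H M N, coact = tensor_coact K H M N\<rparr>"

lemma vs_ten [simp]: "vs (ten M N) = vs M \<otimes>\<^sub>v vs N"
  by (simp add: ten_def)

context
  fixes M N :: "('k, 'a) hom_yd"
  assumes M: "hspace M" and N: "hspace N"
begin

lemma \<alpha>_ten [simp]:
  "A = vs M \<Longrightarrow> B = vs N \<Longrightarrow> m \<in>\<^sub>v A \<Longrightarrow> n \<in>\<^sub>v B \<Longrightarrow>
    \<alpha> (ten M N) (m \<otimes>\<langle>A, B\<rangle> n) = \<alpha> M m \<otimes>\<langle>A, B\<rangle> \<alpha> N n"
  by (simp add: ten_def tensor_\<alpha>_def tensor_map_pure[OF M[THEN hspace_lin] N[THEN hspace_lin]])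

lemma hspace_ten [simp]: "hspace (ten M N)"
proof -
  note [simp] = M N
  have lin: "\<alpha> (ten M N) \<in> linear_maps K (vs M \<otimes>\<^sub>v vs N) (vs M \<otimes>\<^sub>v vs N)"
    by (simp add: ten_def tensor_\<alpha>_def tensor_map_linear hspace_lin)
  then have L: "L (vs M \<otimes>\<^sub>v vs N) (vs M \<otimes>\<^sub>v vs N) (\<alpha> (ten M N))"
    by (simp add: linear_maps_lin)
  note [simp] = lin_comp[OF L]
  \<comment> \<open>The inverse of \<alpha> \<otimes> \<alpha> is \<alpha>^-1 \<otimes> \<alpha>^-1;
    both composites are compared with the identity on pure tensors.\<close>
  let ?i = "\<lambda>t. S (vs M) (vs N) (vs M \<otimes>\<^sub>v vs N) t (\<lambda>m n. \<alpha>inv M m \<otimes>\<langle>vs M, vs N\<rangle> \<alpha>inv N n)"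
  have "?i (\<alpha> (ten M N) t) = t" if "t \<in>\<^sub>v vs M \<otimes>\<^sub>v vs N" for t
    by (rule tensor_ext[OF _ _ _ _ that, of "vs M \<otimes>\<^sub>v vs N" "\<lambda>t. ?i (\<alpha> (ten M N) t)" "\<lambda>t. t"]) simp_all
  moreover have "\<alpha> (ten M N) (?i t) = t" if "t \<in>\<^sub>v vs M \<otimes>\<^sub>v vs N" for t
    by (rule tensor_ext[OF _ _ _ _ that, of "vs M \<otimes>\<^sub>v vs N" "\<lambda>t. \<alpha> (ten M N) (?i t)" "\<lambda>t. t"]) simp_all
  moreover have "?i t \<in>\<^sub>v vs M \<otimes>\<^sub>v vs N" if "t \<in>\<^sub>v vs M \<otimes>\<^sub>v vs N" for t
    using that by simp
  ultimately have "bij_betw (\<alpha> (ten M N)) (elts (ten M N)) (elts (ten M N))"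
    using el_lin[OF L] by (intro bij_betwI[of _ _ _ ?i]) (auto simp: el_def)
  then show ?thesis
    unfolding hspace_def \<alpha>_bij_def using lin by simp
qed

lemma \<alpha>inv_ten [simp]:
  assumes "A = vs M" "B = vs N" "m \<in>\<^sub>v A" "n \<in>\<^sub>v B"
  shows "\<alpha>inv (ten M N) (m \<otimes>\<langle>A, B\<rangle> n) = \<alpha>inv M m \<otimes>\<langle>A, B\<rangle> \<alpha>inv N n"
  using M N assms(3,4) unfolding assms(1,2) by (intro \<alpha>inv_eqI[OF hspace_ten]) simp_all

end

context
  fixes M N :: "('k, 'a) hom_yd"
  assumes M: "hmod M" and N: "hmod N"
begin

lemma act_ten_eq:
  assumes "t \<in>\<^sub>v vs H \<otimes>\<^sub>v vs M \<otimes>\<^sub>v vs N"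
  shows "act (ten M N) t = S (vs H) (vs M \<otimes>\<^sub>v vs N) (vs M \<otimes>\<^sub>v vs N) t
      (\<lambda>h s. S (vs M) (vs N) (vs M \<otimes>\<^sub>v vs N) s
        (\<lambda>m n. S (vs H) (vs H) (vs M \<otimes>\<^sub>v vs N) (De h)
          (\<lambda>a b. ac M (\<alpha> H (\<alpha> H a)) (\<alpha> M m) \<otimes>\<langle>vs M, vs N\<rangle> ac N (\<alpha> H (\<alpha> H b)) (\<alpha> N n))))"
  using assms M N
  by (simp add: ten_def tensor_act_def Let_def el_def[of t, symmetric]
      sweedler_eq_sw[of K "vs H" "vs H"] sweedler_eq_sw[of K "vs M" "vs N"]
      sweedler_eq_sw[of K "vs H" "vs M \<otimes>\<^sub>v vs N"] \<Delta>_eq act_eq)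

lemma hact_ten [simp]: "hact (ten M N)"
proof -
  note [simp] = M N
  have "act (ten M N) = (\<lambda>t \<in> carrier (vs H \<otimes>\<^sub>v vs M \<otimes>\<^sub>v vs N). act (ten M N) t)"
    by (auto simp: ten_def tensor_act_def Let_def intro: restrict_ext)
  also have "\<dots> \<in> linear_maps K (vs H \<otimes>\<^sub>v vs M \<otimes>\<^sub>v vs N) (vs M \<otimes>\<^sub>v vs N)"
    by (rule restrict_linear_map[OF _ act_ten_eq]) simp_all
  finally show ?thesis unfolding hact_def by simp
qed

text \<open>The factors \<alpha> remain because \<open>\<Delta> = De \<circ> \<alpha>\<close>:
  untwisting leaves the ordinary tensor product action of \<alpha>(h) in place of h.\<close>

lemma ac_ten [simp]:
  assumes "A = vs M" "B = vs N" "h \<in>\<^sub>v vs H" "m \<in>\<^sub>v A" "n \<in>\<^sub>v B"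
  shows "ac (ten M N) h (m \<otimes>\<langle>A, B\<rangle> n) = S (vs H) (vs H) (A \<otimes>\<^sub>v B) (De h)
      (\<lambda>a b. ac M (\<alpha> H a) m \<otimes>\<langle>A, B\<rangle> ac N (\<alpha> H b) n)"
  using assms(3-5) M N unfolding assms(1,2) by (simp add: ac_def[of "ten M N"] act_ten_eq)

lemma hmod_ten [simp]: "hmod (ten M N)"
proof (rule hmodI)
  note [simp] = M N
  let ?P = "vs M \<otimes>\<^sub>v vs N"
  fix h t assume [simp]: "h \<in>\<^sub>v vs H" and "t \<in>\<^sub>v vs (ten M N)"
  then have t: "t \<in>\<^sub>v ?P" by simp
  show "\<alpha> (ten M N) (ac (ten M N) h t) = ac (ten M N) (\<alpha> H h) (\<alpha> (ten M N) t)"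
    by (rule tensor_ext[OF _ _ _ _ t, of ?P "\<lambda>t. \<alpha> (ten M N) (ac (ten M N) h t)"
          "\<lambda>t. ac (ten M N) (\<alpha> H h) (\<alpha> (ten M N) t)"]) simp_all
  fix k assume [simp]: "k \<in>\<^sub>v vs H"
  \<comment> \<open>On pure tensors the left side sums over \<open>De k\<close> outside
    \<open>De h\<close>, the right side the other way round.\<close>
  show "ac (ten M N) h (ac (ten M N) k t) = ac (ten M N) (h \<star> k) t"
    by (rule tensor_ext[OF _ _ _ _ t, of ?P "\<lambda>t. ac (ten M N) h (ac (ten M N) k t)"
          "\<lambda>t. ac (ten M N) (h \<star> k) t"])
      (simp_all add: sw_swap[of K "vs H" "vs H" "vs H" "vs H" _ "De k" "De h"])
qed simp

end

context
  fixes M N :: "('k, 'a) hom_yd"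
  assumes M: "hcomod M" and N: "hcomod N"
begin

lemma coact_ten_eq:
  assumes "t \<in>\<^sub>v vs M \<otimes>\<^sub>v vs N"
  shows "coact (ten M N) t = S (vs M) (vs N) (vs H \<otimes>\<^sub>v vs M \<otimes>\<^sub>v vs N) t
      (\<lambda>m n. S (vs H) (vs M) (vs H \<otimes>\<^sub>v vs M \<otimes>\<^sub>v vs N) (co M m)
        (\<lambda>x p. S (vs H) (vs N) (vs H \<otimes>\<^sub>v vs M \<otimes>\<^sub>v vs N) (co N n)
          (\<lambda>y q. (x \<star> y) \<otimes>\<langle>vs H, vs M \<otimes>\<^sub>v vs N\<rangle> (\<alpha> M p \<otimes>\<langle>vs M, vs N\<rangle> \<alpha> N q))))"
  using assms M N
  by (simp add: ten_def tensor_coact_def Let_def el_def[of t, symmetric]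
      sweedler_eq_sw[of K "vs H" "vs M"] sweedler_eq_sw[of K "vs H" "vs N"]
      sweedler_eq_sw[of K "vs M" "vs N"] coact_eq \<mu>_eq)

lemma hcoact_ten [simp]: "hcoact (ten M N)"
proof -
  note [simp] = M N
  have "coact (ten M N) = (\<lambda>t \<in> carrier (vs M \<otimes>\<^sub>v vs N). coact (ten M N) t)"
    by (auto simp: ten_def tensor_coact_def Let_def intro: restrict_ext)
  also have "\<dots> \<in> linear_maps K (vs M \<otimes>\<^sub>v vs N) (vs H \<otimes>\<^sub>v vs M \<otimes>\<^sub>v vs N)"
    by (rule restrict_linear_map[OF _ coact_ten_eq]) simp_all
  finally show ?thesis unfolding hcoact_def by simp
qed

text \<open>Of the prescribed \<alpha>^-2 one inverse is absorbed by
  \<open>\<mu> = \<alpha> \<circ> \<star>\<close>; the other remains on the H-leg of the ordinary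
  tensor product coaction.\<close>

lemma co_ten [simp]:
  assumes "A = vs M" "B = vs N" "m \<in>\<^sub>v A" "n \<in>\<^sub>v B"
  shows "co (ten M N) (m \<otimes>\<langle>A, B\<rangle> n) = S (vs H) A (vs H \<otimes>\<^sub>v A \<otimes>\<^sub>v B) (co M m)
        (\<lambda>x p. S (vs H) B (vs H \<otimes>\<^sub>v A \<otimes>\<^sub>v B) (co N n)
          (\<lambda>y q. (\<alpha>inv H x \<star> \<alpha>inv H y) \<otimes>\<langle>vs H, A \<otimes>\<^sub>v B\<rangle> (p \<otimes>\<langle>A, B\<rangle> q)))"
  using assms(3,4) M N unfolding assms(1,2) by (simp add: co_def[of "ten M N"] coact_ten_eq)

lemma hcomod_ten [simp]: "hcomod (ten M N)"
proof (rule hcomodI)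
  note [simp] = M N
  let ?P = "vs M \<otimes>\<^sub>v vs N"
  let ?HP = "vs H \<otimes>\<^sub>v ?P"
  let ?HHP = "vs H \<otimes>\<^sub>v vs H \<otimes>\<^sub>v ?P"
  fix t assume "t \<in>\<^sub>v vs (ten M N)"
  then have t: "t \<in>\<^sub>v ?P" by simp
  have "co (ten M N) (\<alpha> (ten M N) t) = S (vs H) ?P ?HP (co (ten M N) t) (\<lambda>x n. \<alpha> H x \<otimes>\<langle>vs H, ?P\<rangle> \<alpha> (ten M N) n)"
    by (rule tensor_ext[OF _ _ _ _ t, of ?HP "\<lambda>t. co (ten M N) (\<alpha> (ten M N) t)"
          "\<lambda>t. S (vs H) ?P ?HP (co (ten M N) t) (\<lambda>x n. \<alpha> H x \<otimes>\<langle>vs H, ?P\<rangle> \<alpha> (ten M N) n)"]) simp_all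
  then show "co (ten M N) (\<alpha> (ten M N) t) = S (vs H) (vs (ten M N)) (vs H \<otimes>\<^sub>v vs (ten M N)) (co (ten M N) t)
      (\<lambda>x n. \<alpha> H x \<otimes>\<langle>vs H, vs (ten M N)\<rangle> \<alpha> (ten M N) n)"
    unfolding vs_ten .
  \<comment> \<open>Coassociativity is applied to each factor separately; the exchanges bring the
    sums belonging to M and to N next to each other.\<close>
  have "S (vs H) ?P ?HHP (co (ten M N) t) (\<lambda>x n. S (vs H) (vs H) ?HHP (De x)
          (\<lambda>a b. a \<otimes>\<langle>vs H, ?HP\<rangle> (b \<otimes>\<langle>vs H, ?P\<rangle> n)))
      = S (vs H) ?P ?HHP (co (ten M N) t) (\<lambda>x n. x \<otimes>\<langle>vs H, ?HP\<rangle> co (ten M N) n)"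
    by (rule tensor_ext[OF _ _ _ _ t, of ?HHP "\<lambda>t. S (vs H) ?P ?HHP (co (ten M N) t) (\<lambda>x n. S (vs H) (vs H) ?HHP (De x)
          (\<lambda>a b. a \<otimes>\<langle>vs H, ?HP\<rangle> (b \<otimes>\<langle>vs H, ?P\<rangle> n)))"
          "\<lambda>t. S (vs H) ?P ?HHP (co (ten M N) t) (\<lambda>x n. x \<otimes>\<langle>vs H, ?HP\<rangle> co (ten M N) n)"])
      (simp_all add: sw_swap[of K "vs H" "vs N" "vs H" "vs H"] sw_swap[of K "vs H" "vs N" "vs H" "vs M"] co_coassoc)
  then show "S (vs H) (vs (ten M N)) (vs H \<otimes>\<^sub>v vs H \<otimes>\<^sub>v vs (ten M N)) (co (ten M N) t)
        (\<lambda>x n. S (vs H) (vs H) (vs H \<otimes>\<^sub>v vs H \<otimes>\<^sub>v vs (ten M N)) (De x)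
          (\<lambda>a b. a \<otimes>\<langle>vs H, vs H \<otimes>\<^sub>v vs (ten M N)\<rangle> (b \<otimes>\<langle>vs H, vs (ten M N)\<rangle> n)))
      = S (vs H) (vs (ten M N)) (vs H \<otimes>\<^sub>v vs H \<otimes>\<^sub>v vs (ten M N)) (co (ten M N) t)
        (\<lambda>x n. x \<otimes>\<langle>vs H, vs H \<otimes>\<^sub>v vs (ten M N)\<rangle> co (ten M N) n)"
    unfolding vs_ten .
qed simp

end

text \<open>The Yetter-Drinfeld condition at \<alpha>(h), in the shape in which actions on tensor
  products produce it.\<close>

lemma yd_\<alpha>:
  assumes M: "ydm M" and "vspace U" "h \<in>\<^sub>v vs H" "m \<in>\<^sub>v vs M" and f: "bilin K (vs H) (vs M) U (\<lambda>x n. f x n)"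
  shows "S (vs H) (vs H) U (De h)
        (\<lambda>a b. S (vs H) (vs M) U (co M (ac M (\<alpha> H a) m)) (\<lambda>x n. f (x \<star> \<alpha> H b) n))
      = S (vs H) (vs H) U (De h)
        (\<lambda>a b. S (vs H) (vs M) U (co M m) (\<lambda>x n. f (\<alpha> H a \<star> x) (ac M (\<alpha> H b) n)))"
proof -
  note [simp] = assms bilinD[OF f] lin_comp[of K "vs H" U "\<lambda>x. f x _"] lin_comp[of K "vs M" U "f _"]
  show ?thesis
    using yd[of M U "\<alpha> H h" m f] by simp
qed

text \<open>With h split into three legs, the left side is built from h_1 m, h_2 n and the right
  factor h_3. The condition for N moves h_3 past n and turns h_2 into a left factor of its coaction
  leg, the condition for M then does the same with h_2 and m. Coassociativity supplies the grouping
  that each move needs.\<close>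

lemma ydm_ten [simp]:
  assumes M: "ydm M" and N: "ydm N"
  shows "ydm (ten M N)"
proof -
  note [simp] = M N
  let ?H = "vs H" and ?M = "vs M" and ?N = "vs N"
  let ?P = "?M \<otimes>\<^sub>v ?N"
  let ?HP = "?H \<otimes>\<^sub>v ?P"
  have "S ?H ?H ?HP (De h)
        (\<lambda>a b. S ?H ?P ?HP (co (ten M N) (ac (ten M N) a t)) (\<lambda>x n. (x \<star> b) \<otimes>\<langle>?H, ?P\<rangle> n))
      = S ?H ?H ?HP (De h)
        (\<lambda>a b. S ?H ?P ?HP (co (ten M N) t) (\<lambda>x n. (a \<star> x) \<otimes>\<langle>?H, ?P\<rangle> ac (ten M N) b n))"
    (is "?lhs t = ?rhs t") if h [simp]: "h \<in>\<^sub>v ?H" and t: "t \<in>\<^sub>v ?P" for h t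
  proof (rule tensor_ext[OF _ _ _ _ t, of ?HP ?lhs ?rhs])
    fix m n assume [simp]: "m \<in>\<^sub>v ?M" "n \<in>\<^sub>v ?N"
    \<comment> \<open>The factor b is displayed as \<alpha>^-1(\<alpha>(b)) next to y, which
      prepares \<open>yd_\<alpha>\<close> for N.\<close>
    have "?lhs (m \<otimes>\<langle>?M, ?N\<rangle> n) = S ?H ?H ?HP (De h) (\<lambda>a b. S ?H ?H ?HP (De a) (\<lambda>c d.
        S ?H ?M ?HP (co M (ac M (\<alpha> H c) m)) (\<lambda>x p. S ?H ?N ?HP (co N (ac N (\<alpha> H d) n)) (\<lambda>y q.
          (\<alpha>inv H x \<star> \<alpha>inv H (y \<star> \<alpha> H b)) \<otimes>\<langle>?H, ?P\<rangle> (p \<otimes>\<langle>?M, ?N\<rangle> q)))))"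
      by simp
    also have "\<dots> = S ?H ?H ?HP (De h) (\<lambda>a b. S ?H ?H ?HP (De b) (\<lambda>c d.
        S ?H ?M ?HP (co M (ac M (\<alpha> H a) m)) (\<lambda>x p. S ?H ?N ?HP (co N (ac N (\<alpha> H c) n)) (\<lambda>y q.
          (\<alpha>inv H x \<star> \<alpha>inv H (y \<star> \<alpha> H d)) \<otimes>\<langle>?H, ?P\<rangle> (p \<otimes>\<langle>?M, ?N\<rangle> q)))))"
      by (rule De_coassoc) simp_all
    also have "\<dots> = S ?H ?H ?HP (De h) (\<lambda>a b.
        S ?H ?M ?HP (co M (ac M (\<alpha> H a) m)) (\<lambda>x p. S ?H ?H ?HP (De b) (\<lambda>c d. S ?H ?N ?HP (co N (ac N (\<alpha> H c) n)) (\<lambda>y q.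
          (\<alpha>inv H x \<star> \<alpha>inv H (y \<star> \<alpha> H d)) \<otimes>\<langle>?H, ?P\<rangle> (p \<otimes>\<langle>?M, ?N\<rangle> q)))))"
      by (rule sw_cong[OF HOL.refl sw_swap]) simp_all
    also have "\<dots> = S ?H ?H ?HP (De h) (\<lambda>a b.
        S ?H ?M ?HP (co M (ac M (\<alpha> H a) m)) (\<lambda>x p. S ?H ?H ?HP (De b) (\<lambda>c d. S ?H ?N ?HP (co N n) (\<lambda>y q.
          (\<alpha>inv H x \<star> \<alpha>inv H (\<alpha> H c \<star> y)) \<otimes>\<langle>?H, ?P\<rangle> (p \<otimes>\<langle>?M, ?N\<rangle> ac N (\<alpha> H d) q)))))"
      by (rule sw_cong[OF HOL.refl sw_cong[OF HOL.refl yd_\<alpha>]]) simp_all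
    also have "\<dots> = S ?H ?H ?HP (De h) (\<lambda>a b. S ?H ?H ?HP (De b) (\<lambda>c d.
        S ?H ?M ?HP (co M (ac M (\<alpha> H a) m)) (\<lambda>x p. S ?H ?N ?HP (co N n) (\<lambda>y q.
          (\<alpha>inv H x \<star> \<alpha>inv H (\<alpha> H c \<star> y)) \<otimes>\<langle>?H, ?P\<rangle> (p \<otimes>\<langle>?M, ?N\<rangle> ac N (\<alpha> H d) q)))))"
      by (rule sw_cong[OF HOL.refl sw_swap]) simp_all
    also have "\<dots> = S ?H ?H ?HP (De h) (\<lambda>a b. S ?H ?H ?HP (De a) (\<lambda>c d.
        S ?H ?M ?HP (co M (ac M (\<alpha> H c) m)) (\<lambda>x p. S ?H ?N ?HP (co N n) (\<lambda>y q.
          (\<alpha>inv H x \<star> \<alpha>inv H (\<alpha> H d \<star> y)) \<otimes>\<langle>?H, ?P\<rangle> (p \<otimes>\<langle>?M, ?N\<rangle> ac N (\<alpha> H b) q)))))"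
      by (rule De_coassoc[symmetric]) simp_all
    \<comment> \<open>By associativity the middle factor passes from y to x, which prepares
      \<open>yd_\<alpha>\<close> for M.\<close>
    also have "\<dots> = S ?H ?H ?HP (De h) (\<lambda>a b. S ?H ?H ?HP (De a) (\<lambda>c d.
        S ?H ?M ?HP (co M (ac M (\<alpha> H c) m)) (\<lambda>x p. S ?H ?N ?HP (co N n) (\<lambda>y q.
          (\<alpha>inv H (x \<star> \<alpha> H d) \<star> \<alpha>inv H y) \<otimes>\<langle>?H, ?P\<rangle> (p \<otimes>\<langle>?M, ?N\<rangle> ac N (\<alpha> H b) q)))))"
      by simp
    also have "\<dots> = S ?H ?H ?HP (De h) (\<lambda>a b. S ?H ?H ?HP (De a) (\<lambda>c d.
        S ?H ?M ?HP (co M m) (\<lambda>x p. S ?H ?N ?HP (co N n) (\<lambda>y q.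
          (\<alpha>inv H (\<alpha> H c \<star> x) \<star> \<alpha>inv H y) \<otimes>\<langle>?H, ?P\<rangle> (ac M (\<alpha> H d) p \<otimes>\<langle>?M, ?N\<rangle> ac N (\<alpha> H b) q)))))"
      by (rule sw_cong[OF HOL.refl yd_\<alpha>]) simp_all
    also have "\<dots> = S ?H ?H ?HP (De h) (\<lambda>a b. S ?H ?H ?HP (De b) (\<lambda>c d.
        S ?H ?M ?HP (co M m) (\<lambda>x p. S ?H ?N ?HP (co N n) (\<lambda>y q.
          (\<alpha>inv H (\<alpha> H a \<star> x) \<star> \<alpha>inv H y) \<otimes>\<langle>?H, ?P\<rangle> (ac M (\<alpha> H c) p \<otimes>\<langle>?M, ?N\<rangle> ac N (\<alpha> H d) q)))))"
      by (rule De_coassoc) simp_all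
    also have "\<dots> = ?rhs (m \<otimes>\<langle>?M, ?N\<rangle> n)"
      by (simp add: sw_swap[of K "vs H" "vs H" "vs H" "vs N"] sw_swap[of K "vs H" "vs H" "vs H" "vs M"])
    finally show "?lhs (m \<otimes>\<langle>?M, ?N\<rangle> n) = ?rhs (m \<otimes>\<langle>?M, ?N\<rangle> n)" .
  qed simp_all
  then show ?thesis
    unfolding ydm_iff[OF hmod_ten[OF ydm_hmod[OF M] ydm_hmod[OF N]] hcomod_ten[OF ydm_hcomod[OF M] ydm_hcomod[OF N]]]
      vs_ten by blast
qed

section \<open>Morphisms of Yetter-Drinfeld modules\<close>

definition mor :: "('k, 'a) hom_yd \<Rightarrow> ('k, 'a) hom_yd \<Rightarrow> ('a univ \<Rightarrow> 'a univ) set" where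
  "mor M N = module_morphisms K H M N \<inter> comodule_morphisms K H M N"

lemma co_hom_iff:
  assumes M: "hcomod M" "hcomod N" and f: "L (vs M) (vs N) f" and \<alpha>: "\<And>m. m \<in>\<^sub>v vs M \<Longrightarrow> f (\<alpha> M m) = \<alpha> N (f m)"
  shows "(\<forall>m. m \<in>\<^sub>v vs M \<longrightarrow> tensor_map K (vs H) (vs M) (vs H) (vs N) (\<lambda>h. h) f (coact M m) = coact N (f m)) \<longleftrightarrow>
    (\<forall>m. m \<in>\<^sub>v vs M \<longrightarrow> co N (f m) = S (vs H) (vs M) (vs H \<otimes>\<^sub>v vs N) (co M m) (\<lambda>x n. x \<otimes>\<langle>vs H, vs N\<rangle> f n))"
    (is "(\<forall>m. _ \<longrightarrow> ?raw m) \<longleftrightarrow> (\<forall>m. _ \<longrightarrow> ?eq m)")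
proof -
  note [simp] = M f lin_comp[OF f] el_lin[OF f] \<alpha>[symmetric]
  have 1: "?raw m \<longleftrightarrow> ?eq (\<alpha> M m)" if "m \<in>\<^sub>v vs M" for m
    using that by (auto simp: tensor_map_eq coact_eq[of M m] coact_eq[of N "f m"])
  then show ?thesis
    by (metis M(1) \<alpha>_\<alpha>inv \<alpha>_el \<alpha>inv_el hcoact_hspace hcomod_hcoact)
qed

lemma mor_iff:
  assumes M: "ydm M" and N: "ydm N"
  shows "f \<in> mor M N \<longleftrightarrow> f \<in> linear_maps K (vs M) (vs N) \<and>
    (\<forall>m. m \<in>\<^sub>v vs M \<longrightarrow> f (\<alpha> M m) = \<alpha> N (f m)) \<and>
    (\<forall>h m. h \<in>\<^sub>v vs H \<longrightarrow> m \<in>\<^sub>v vs M \<longrightarrow> f (ac M h m) = ac N h (f m)) \<and>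
    (\<forall>m. m \<in>\<^sub>v vs M \<longrightarrow> co N (f m) = S (vs H) (vs M) (vs H \<otimes>\<^sub>v vs N) (co M m) (\<lambda>x n. x \<otimes>\<langle>vs H, vs N\<rangle> f n))"
    (is "_ \<longleftrightarrow> ?lin \<and> ?\<alpha> \<and> (\<forall>h m. _ \<longrightarrow> _ \<longrightarrow> ?act h m) \<and> ?co")
proof -
  let ?act' = "\<lambda>h m. f (act M (h \<otimes>\<langle>vs H, vs M\<rangle> m)) = act N (h \<otimes>\<langle>vs H, vs N\<rangle> f m)"
  let ?co' = "\<forall>m. m \<in>\<^sub>v vs M \<longrightarrow> tensor_map K (vs H) (vs M) (vs H) (vs N) (\<lambda>h. h) f (coact M m) = coact N (f m)"
  have 1: "f \<in> mor M N \<longleftrightarrow> ?lin \<and> ?\<alpha> \<and> (\<forall>h m. h \<in>\<^sub>v vs H \<longrightarrow> m \<in>\<^sub>v vs M \<longrightarrow> ?act' h m) \<and> ?co'"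
    unfolding mor_def module_morphisms_def comodule_morphisms_def el_def by (auto simp: eq_commute[of "\<alpha> N _"])
  show ?thesis
  proof (cases "?lin \<and> ?\<alpha>")
    case True
    note [simp] = M N
    have f: "L (vs M) (vs N) f" using True by (simp add: linear_maps_lin)
    note [simp] = el_lin[OF f]
    have "f (\<alpha> M m) = \<alpha> N (f m)" if "m \<in>\<^sub>v vs M" for m using True that by blast
    note \<alpha> = this this[symmetric]
    have co: "?co' \<longleftrightarrow> ?co"
      using True by (intro co_hom_iff f) auto
    have act: "?act' h m \<longleftrightarrow> ?act h m" if "h \<in>\<^sub>v vs H" "m \<in>\<^sub>v vs M" for h m
    proof -
      have "?act' h m \<longleftrightarrow> \<alpha> N (f (ac M h m)) = \<alpha> N (ac N h (f m))"
        using that by (simp add: act_eq \<alpha>(1) del: \<alpha>_ac)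
      also have "\<dots> \<longleftrightarrow> ?act h m"
        using that \<alpha>_inject[of N "f (ac M h m)" "ac N h (f m)"] by auto
      finally show ?thesis .
    qed
    show ?thesis unfolding 1 co using act by auto
  next
    case False
    then show ?thesis unfolding 1 by blast
  qed
qed

lemma morI:
  assumes "ydm M" "ydm N" "f \<in> linear_maps K (vs M) (vs N)"
    and "\<And>m. m \<in>\<^sub>v vs M \<Longrightarrow> f (\<alpha> M m) = \<alpha> N (f m)"
    and "\<And>h m. h \<in>\<^sub>v vs H \<Longrightarrow> m \<in>\<^sub>v vs M \<Longrightarrow> f (ac M h m) = ac N h (f m)"
    and "\<And>m. m \<in>\<^sub>v vs M \<Longrightarrow> co N (f m) = S (vs H) (vs M) (vs H \<otimes>\<^sub>v vs N) (co M m) (\<lambda>x n. x \<otimes>\<langle>vs H, vs N\<rangle> f n)"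
  shows "f \<in> mor M N"
  unfolding mor_iff[OF assms(1,2)] using assms(3-) by blast

context
  fixes M N f
  assumes M: "ydm M" and N: "ydm N" and f: "f \<in> mor M N"
begin

lemma mor_linear_map: "f \<in> linear_maps K (vs M) (vs N)"
  using f unfolding mor_iff[OF M N] by blast

lemma mor_linear: "L (vs M) (vs N) f"
  using mor_linear_map M N by (simp add: linear_maps_lin)

lemma mor_el: "W = vs M \<Longrightarrow> W' = vs N \<Longrightarrow> m \<in>\<^sub>v W \<Longrightarrow> f m \<in>\<^sub>v W'"
  using el_lin[OF mor_linear] by blast

lemma mor_lin: "W = vs N \<Longrightarrow> W' = vs M \<Longrightarrow> L V W' g \<Longrightarrow> L V W (\<lambda>x. f (g x))"
  using lin_comp[OF mor_linear] by blast

lemma mor_\<alpha>: "m \<in>\<^sub>v vs M \<Longrightarrow> f (\<alpha> M m) = \<alpha> N (f m)"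
  using f unfolding mor_iff[OF M N] by blast

lemma mor_\<alpha>inv: "m \<in>\<^sub>v vs M \<Longrightarrow> f (\<alpha>inv M m) = \<alpha>inv N (f m)"
  using M N mor_\<alpha>[of "\<alpha>inv M m"] mor_el \<alpha>inv_eqI[of N "f (\<alpha>inv M m)" "f m"] by simp

lemma mor_ac: "h \<in>\<^sub>v vs H \<Longrightarrow> m \<in>\<^sub>v vs M \<Longrightarrow> f (ac M h m) = ac N h (f m)"
  using f unfolding mor_iff[OF M N] by blast

lemma mor_co: "m \<in>\<^sub>v vs M \<Longrightarrow>
    co N (f m) = S (vs H) (vs M) (vs H \<otimes>\<^sub>v vs N) (co M m) (\<lambda>x n. x \<otimes>\<langle>vs H, vs N\<rangle> f n)"
  using f unfolding mor_iff[OF M N] by blast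

end

lemma mor_id:
  assumes [simp]: "ydm M"
  shows "(\<lambda>m \<in> elts M. m) \<in> mor M M"
proof (rule morI)
  show "(\<lambda>m \<in> elts M. m) \<in> linear_maps K (vs M) (vs M)"
    by (rule restrict_linear_map[of _ _ "\<lambda>m. m"]) simp_all
  have id [simp]: "restrict (\<lambda>m. m) (elts M) m = m" if "m \<in>\<^sub>v vs M" for m
    using that by (simp add: el_def)
  fix m assume [simp]: "m \<in>\<^sub>v vs M"
  show "restrict (\<lambda>m. m) (elts M) (\<alpha> M m) = \<alpha> M (restrict (\<lambda>m. m) (elts M) m)"
    "co M (restrict (\<lambda>m. m) (elts M) m) = S (vs H) (vs M) (vs H \<otimes>\<^sub>v vs M) (co M m)
      (\<lambda>x n. x \<otimes>\<langle>vs H, vs M\<rangle> restrict (\<lambda>m. m) (elts M) n)"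
    by (simp_all add: sw_pure_self del: restrict_apply)
  fix h assume [simp]: "h \<in>\<^sub>v vs H"
  show "restrict (\<lambda>m. m) (elts M) (ac M h m) = ac M h (restrict (\<lambda>m. m) (elts M) m)"
    by (simp del: restrict_apply)
qed simp_all

lemma mor_comp:
  assumes [simp]: "ydm M" "ydm N" "ydm P" and f: "f \<in> mor M N" and g: "g \<in> mor N P"
  shows "compose (elts M) g f \<in> mor M P"
proof (rule morI)
  note [simp] = mor_linear[OF _ _ f] mor_linear[OF _ _ g] mor_el[OF _ _ f] mor_el[OF _ _ g] mor_lin[OF _ _ f]
    mor_lin[OF _ _ g] mor_\<alpha>[OF _ _ f] mor_\<alpha>[OF _ _ g] mor_ac[OF _ _ f] mor_ac[OF _ _ g] mor_co[OF _ _ f] mor_co[OF _ _ g]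
  have [simp]: "compose (elts M) g f m = g (f m)" if "m \<in>\<^sub>v vs M" for m
    using that by (simp add: el_def compose_def)
  show "compose (elts M) g f \<in> linear_maps K (vs M) (vs P)"
    unfolding compose_def by (rule restrict_linear_map[of _ _ "\<lambda>m. g (f m)"]) simp_all
  fix m assume [simp]: "m \<in>\<^sub>v vs M"
  show "compose (elts M) g f (\<alpha> M m) = \<alpha> P (compose (elts M) g f m)"
    "co P (compose (elts M) g f m) = S (vs H) (vs M) (vs H \<otimes>\<^sub>v vs P) (co M m)
      (\<lambda>x n. x \<otimes>\<langle>vs H, vs P\<rangle> compose (elts M) g f n)"
    by simp_all
  fix h assume [simp]: "h \<in>\<^sub>v vs H"
  show "compose (elts M) g f (ac M h m) = ac P h (compose (elts M) g f m)"
    by simp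
qed simp_all

lemma tensor_ext3:
  fixes A B C U :: "('k, 'b) vect"
  assumes "vspace A" "vspace B" "vspace C" "L ((A \<otimes>\<^sub>v B) \<otimes>\<^sub>v C) U f" "L ((A \<otimes>\<^sub>v B) \<otimes>\<^sub>v C) U g"
    and t: "t \<in>\<^sub>v (A \<otimes>\<^sub>v B) \<otimes>\<^sub>v C"
    and eq: "\<And>a b c. a \<in>\<^sub>v A \<Longrightarrow> b \<in>\<^sub>v B \<Longrightarrow> c \<in>\<^sub>v C \<Longrightarrow>
      f ((a \<otimes>\<langle>A, B\<rangle> b) \<otimes>\<langle>A \<otimes>\<^sub>v B, C\<rangle> c) = g ((a \<otimes>\<langle>A, B\<rangle> b) \<otimes>\<langle>A \<otimes>\<^sub>v B, C\<rangle> c)"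
  shows "f t = g t"
proof (rule tensor_ext[OF _ _ assms(4,5) t])
  fix s c assume s: "s \<in>\<^sub>v A \<otimes>\<^sub>v B" and c: "c \<in>\<^sub>v C"
  show "f (s \<otimes>\<langle>A \<otimes>\<^sub>v B, C\<rangle> c) = g (s \<otimes>\<langle>A \<otimes>\<^sub>v B, C\<rangle> c)"
    by (rule tensor_ext[OF _ _ _ _ s, of U "\<lambda>s. f (s \<otimes>\<langle>A \<otimes>\<^sub>v B, C\<rangle> c)" "\<lambda>s. g (s \<otimes>\<langle>A \<otimes>\<^sub>v B, C\<rangle> c)"])
      (simp_all add: assms c lin_comp[OF assms(4)] lin_comp[OF assms(5)] eq)
qed (simp_all add: assms)

lemma tensor_ext3':
  fixes A B C U :: "('k, 'b) vect"
  assumes "vspace A" "vspace B" "vspace C" "L (A \<otimes>\<^sub>v B \<otimes>\<^sub>v C) U f" "L (A \<otimes>\<^sub>v B \<otimes>\<^sub>v C) U g"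
    and t: "t \<in>\<^sub>v A \<otimes>\<^sub>v B \<otimes>\<^sub>v C"
    and eq: "\<And>a b c. a \<in>\<^sub>v A \<Longrightarrow> b \<in>\<^sub>v B \<Longrightarrow> c \<in>\<^sub>v C \<Longrightarrow>
      f (a \<otimes>\<langle>A, B \<otimes>\<^sub>v C\<rangle> (b \<otimes>\<langle>B, C\<rangle> c)) = g (a \<otimes>\<langle>A, B \<otimes>\<^sub>v C\<rangle> (b \<otimes>\<langle>B, C\<rangle> c))"
  shows "f t = g t"
proof (rule tensor_ext[OF _ _ assms(4,5) t])
  fix a s assume a: "a \<in>\<^sub>v A" and s: "s \<in>\<^sub>v B \<otimes>\<^sub>v C"
  show "f (a \<otimes>\<langle>A, B \<otimes>\<^sub>v C\<rangle> s) = g (a \<otimes>\<langle>A, B \<otimes>\<^sub>v C\<rangle> s)"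
    by (rule tensor_ext[OF _ _ _ _ s, of U "\<lambda>s. f (a \<otimes>\<langle>A, B \<otimes>\<^sub>v C\<rangle> s)" "\<lambda>s. g (a \<otimes>\<langle>A, B \<otimes>\<^sub>v C\<rangle> s)"])
      (simp_all add: assms a lin_comp[OF assms(4)] lin_comp[OF assms(5)] eq)
qed (simp_all add: assms)

lemma mor_tensor:
  assumes [simp]: "ydm M" "ydm N" "ydm M'" "ydm N'" and f: "f \<in> mor M N" and g: "g \<in> mor M' N'"
  shows "tensor_map K (vs M) (vs M') (vs N) (vs N') f g \<in> mor (ten M M') (ten N N')"
proof (rule morI)
  let ?M = "vs M \<otimes>\<^sub>v vs M'" and ?N = "vs N \<otimes>\<^sub>v vs N'"
  let ?T = "tensor_map K (vs M) (vs M') (vs N) (vs N') f g"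
  note fl = mor_linear[OF _ _ f] and gl = mor_linear[OF _ _ g]
  note [simp] = fl gl mor_el[OF _ _ f] mor_el[OF _ _ g] mor_lin[OF _ _ f]
    mor_lin[OF _ _ g] mor_\<alpha>[OF _ _ f] mor_\<alpha>[OF _ _ g] mor_ac[OF _ _ f] mor_ac[OF _ _ g] mor_co[OF _ _ f] mor_co[OF _ _ g]
  have lm: "?T \<in> linear_maps K ?M ?N"
    by (rule tensor_map_linear) simp_all
  then show "?T \<in> linear_maps K (vs (ten M M')) (vs (ten N N'))"
    unfolding vs_ten .
  have l: "L ?M ?N ?T"
    using lm by (simp add: linear_maps_lin)
  note [simp] = l el_lin[OF l] lin_comp[OF l] lin_push_sw[OF _ _ l]
  have [simp]: "?T (m \<otimes>\<langle>vs M, vs M'\<rangle> n) = f m \<otimes>\<langle>vs N, vs N'\<rangle> g n" if "m \<in>\<^sub>v vs M" "n \<in>\<^sub>v vs M'" for m n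
    using that by (intro tensor_map_pure) simp_all
  fix t assume "t \<in>\<^sub>v vs (ten M M')"
  then have t: "t \<in>\<^sub>v ?M" by simp
  show "?T (\<alpha> (ten M M') t) = \<alpha> (ten N N') (?T t)"
    by (rule tensor_ext[OF _ _ _ _ t, of ?N "\<lambda>t. ?T (\<alpha> (ten M M') t)" "\<lambda>t. \<alpha> (ten N N') (?T t)"]) simp_all
  show "co (ten N N') (?T t) = S (vs H) (vs (ten M M')) (vs H \<otimes>\<^sub>v vs (ten N N')) (co (ten M M') t)
      (\<lambda>x n. x \<otimes>\<langle>vs H, vs (ten N N')\<rangle> ?T n)"
    unfolding vs_ten
    by (rule tensor_ext[OF _ _ _ _ t, of "vs H \<otimes>\<^sub>v ?N" "\<lambda>t. co (ten N N') (?T t)"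
          "\<lambda>t. S (vs H) ?M (vs H \<otimes>\<^sub>v ?N) (co (ten M M') t) (\<lambda>x n. x \<otimes>\<langle>vs H, ?N\<rangle> ?T n)"]) simp_all
  fix h assume [simp]: "h \<in>\<^sub>v vs H"
  show "?T (ac (ten M M') h t) = ac (ten N N') h (?T t)"
    by (rule tensor_ext[OF _ _ _ _ t, of ?N "\<lambda>t. ?T (ac (ten M M') h t)" "\<lambda>t. ac (ten N N') h (?T t)"]) simp_all
qed simp_all

text \<open>Writing n as f (g n) turns each morphism property of g into one of f. This spares a
  separate verification for the inverse associator.\<close>

lemma mor_inverse:
  assumes [simp]: "ydm M" "ydm N" and f: "f \<in> mor M N" and g: "g \<in> linear_maps K (vs N) (vs M)"
    and gf: "\<And>m. m \<in>\<^sub>v vs M \<Longrightarrow> g (f m) = m" and fg: "\<And>n. n \<in>\<^sub>v vs N \<Longrightarrow> f (g n) = n"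
  shows "g \<in> mor N M"
proof (rule morI)
  note fl = mor_linear[OF _ _ f]
  have gl: "L (vs N) (vs M) g"
    using g by (simp add: linear_maps_lin)
  note [simp] = fl mor_el[OF _ _ f] mor_lin[OF _ _ f] gl el_lin[OF gl] lin_comp[OF gl] gf fg
  show "g (\<alpha> N n) = \<alpha> M (g n)" if [simp]: "n \<in>\<^sub>v vs N" for n
  proof -
    have "g (\<alpha> N n) = g (f (\<alpha> M (g n)))" by (simp add: mor_\<alpha>[OF _ _ f] del: gf)
    then show ?thesis by simp
  qed
  show "g (ac N h n) = ac M h (g n)" if [simp]: "h \<in>\<^sub>v vs H" "n \<in>\<^sub>v vs N" for h n
  proof -
    have "g (ac N h n) = g (f (ac M h (g n)))" by (simp add: mor_ac[OF _ _ f] del: gf)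
    then show ?thesis by simp
  qed
  show "co M (g n) = S (vs H) (vs N) (vs H \<otimes>\<^sub>v vs M) (co N n) (\<lambda>x n. x \<otimes>\<langle>vs H, vs M\<rangle> g n)"
    if [simp]: "n \<in>\<^sub>v vs N" for n
  proof -
    have "S (vs H) (vs N) (vs H \<otimes>\<^sub>v vs M) (co N n) (\<lambda>x n. x \<otimes>\<langle>vs H, vs M\<rangle> g n)
      = S (vs H) (vs N) (vs H \<otimes>\<^sub>v vs M) (co N (f (g n))) (\<lambda>x n. x \<otimes>\<langle>vs H, vs M\<rangle> g n)"
      by simp
    also have "\<dots> = S (vs H) (vs M) (vs H \<otimes>\<^sub>v vs M) (co M (g n)) (\<lambda>x n. x \<otimes>\<langle>vs H, vs M\<rangle> n)"
      by (simp add: mor_co[OF _ _ f] del: fg)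
    finally show ?thesis
      by (simp add: sw_pure_self)
  qed
qed (simp_all add: g)

subsection \<open>The associativity constraint\<close>

context
  fixes M N P :: "('k, 'a) hom_yd"
  assumes hM: "hspace M" and hN: "hspace N" and hP: "hspace P"
begin

lemma associator_eq:
  assumes "t \<in>\<^sub>v (vs M \<otimes>\<^sub>v vs N) \<otimes>\<^sub>v vs P"
  shows "associator K M N P t = S (vs M \<otimes>\<^sub>v vs N) (vs P) (vs M \<otimes>\<^sub>v vs N \<otimes>\<^sub>v vs P) t
    (\<lambda>s p. S (vs M) (vs N) (vs M \<otimes>\<^sub>v vs N \<otimes>\<^sub>v vs P) s
      (\<lambda>m n. \<alpha>inv M m \<otimes>\<langle>vs M, vs N \<otimes>\<^sub>v vs P\<rangle> (n \<otimes>\<langle>vs N, vs P\<rangle> \<alpha> P p)))"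
  using assms hM hN hP
  by (simp add: associator_def Let_def el_def[of t, symmetric]
      sweedler_eq_sw[of K "vs M" "vs N"] sweedler_eq_sw[of K "vs M \<otimes>\<^sub>v vs N" "vs P"])

lemma associator_linear_map:
  "associator K M N P \<in> linear_maps K ((vs M \<otimes>\<^sub>v vs N) \<otimes>\<^sub>v vs P) (vs M \<otimes>\<^sub>v vs N \<otimes>\<^sub>v vs P)"
proof -
  note [simp] = hM hN hP
  have "associator K M N P = (\<lambda>t \<in> carrier ((vs M \<otimes>\<^sub>v vs N) \<otimes>\<^sub>v vs P). associator K M N P t)"
    by (auto simp: associator_def Let_def intro: restrict_ext)
  also have "\<dots> \<in> linear_maps K ((vs M \<otimes>\<^sub>v vs N) \<otimes>\<^sub>v vs P) (vs M \<otimes>\<^sub>v vs N \<otimes>\<^sub>v vs P)"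
    by (rule restrict_linear_map[OF _ associator_eq]) simp_all
  finally show ?thesis .
qed

lemma associator_linear:
  "L ((vs M \<otimes>\<^sub>v vs N) \<otimes>\<^sub>v vs P) (vs M \<otimes>\<^sub>v vs N \<otimes>\<^sub>v vs P) (associator K M N P)"
  using associator_linear_map hM hN hP by (simp add: linear_maps_lin)

lemma associator_pure [simp]:
  assumes "A = vs M" "B = vs N" "C = vs P" "D = A \<otimes>\<^sub>v B" "m \<in>\<^sub>v A" "n \<in>\<^sub>v B" "p \<in>\<^sub>v C"
  shows "associator K M N P ((m \<otimes>\<langle>A, B\<rangle> n) \<otimes>\<langle>D, C\<rangle> p) = \<alpha>inv M m \<otimes>\<langle>A, B \<otimes>\<^sub>v C\<rangle> (n \<otimes>\<langle>B, C\<rangle> \<alpha> P p)"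
  using assms(5-) hM hN hP unfolding assms(4) unfolding assms(1-3) by (simp add: associator_eq)

definition associator_inv :: "'a univ \<Rightarrow> 'a univ" where
  "associator_inv = (\<lambda>t \<in> carrier (vs M \<otimes>\<^sub>v vs N \<otimes>\<^sub>v vs P).
    S (vs M) (vs N \<otimes>\<^sub>v vs P) ((vs M \<otimes>\<^sub>v vs N) \<otimes>\<^sub>v vs P) t
      (\<lambda>m s. S (vs N) (vs P) ((vs M \<otimes>\<^sub>v vs N) \<otimes>\<^sub>v vs P) s
        (\<lambda>n p. (\<alpha> M m \<otimes>\<langle>vs M, vs N\<rangle> n) \<otimes>\<langle>vs M \<otimes>\<^sub>v vs N, vs P\<rangle> \<alpha>inv P p)))"

lemma associator_inv_linear_map:
  "associator_inv \<in> linear_maps K (vs M \<otimes>\<^sub>v vs N \<otimes>\<^sub>v vs P) ((vs M \<otimes>\<^sub>v vs N) \<otimes>\<^sub>v vs P)"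
  unfolding associator_inv_def using hM hN hP by (rule_tac restrict_linear_map[OF _ HOL.refl]) simp_all

lemma associator_inv_linear:
  "L (vs M \<otimes>\<^sub>v vs N \<otimes>\<^sub>v vs P) ((vs M \<otimes>\<^sub>v vs N) \<otimes>\<^sub>v vs P) associator_inv"
  using associator_inv_linear_map hM hN hP by (simp add: linear_maps_lin)

lemma associator_inv_pure [simp]:
  assumes "A = vs M" "B = vs N" "C = vs P" "D = B \<otimes>\<^sub>v C" "m \<in>\<^sub>v A" "n \<in>\<^sub>v B" "p \<in>\<^sub>v C"
  shows "associator_inv (m \<otimes>\<langle>A, D\<rangle> (n \<otimes>\<langle>B, C\<rangle> p)) = (\<alpha> M m \<otimes>\<langle>A, B\<rangle> n) \<otimes>\<langle>A \<otimes>\<^sub>v B, C\<rangle> \<alpha>inv P p"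
  using assms(5-) hM hN hP unfolding assms(4) unfolding assms(1-3)
  by (simp add: associator_inv_def el_def[of "_ \<otimes>\<langle>_,_\<rangle> _", symmetric])

lemma associator_inv_associator:
  assumes t: "t \<in>\<^sub>v (vs M \<otimes>\<^sub>v vs N) \<otimes>\<^sub>v vs P"
  shows "associator_inv (associator K M N P t) = t"
proof -
  note [simp] = hM hN hP lin_comp[OF associator_linear] lin_comp[OF associator_inv_linear]
  show ?thesis
    by (rule tensor_ext3[OF _ _ _ _ _ t, of "(vs M \<otimes>\<^sub>v vs N) \<otimes>\<^sub>v vs P" "\<lambda>t. associator_inv (associator K M N P t)" "\<lambda>t. t"])
      simp_all
qed

lemma associator_associator_inv:
  assumes t: "t \<in>\<^sub>v vs M \<otimes>\<^sub>v vs N \<otimes>\<^sub>v vs P"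
  shows "associator K M N P (associator_inv t) = t"
proof -
  note [simp] = hM hN hP lin_comp[OF associator_linear] lin_comp[OF associator_inv_linear]
  show ?thesis
    by (rule tensor_ext3'[OF _ _ _ _ _ t, of "vs M \<otimes>\<^sub>v vs N \<otimes>\<^sub>v vs P" "\<lambda>t. associator K M N P (associator_inv t)" "\<lambda>t. t"])
      simp_all
qed

end

text \<open>In untwisted terms h acts on the left bracketed product through \<alpha>^2(h_1),
  \<alpha>^2(h_2), \<alpha>(h_3) and on the right bracketed one through \<alpha>(h_1),
  \<alpha>^2(h_2), \<alpha>^2(h_3). The factors \<alpha>^-1 on M and \<alpha> on P balance this. The
  coaction legs carry the inverse powers and are balanced in the same way.\<close>

lemma associator_mor:
  assumes [simp]: "ydm M" "ydm N" "ydm P"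
  shows "associator K M N P \<in> mor (ten (ten M N) P) (ten M (ten N P))"
proof (rule morI)
  let ?D = "(vs M \<otimes>\<^sub>v vs N) \<otimes>\<^sub>v vs P" and ?C = "vs M \<otimes>\<^sub>v vs N \<otimes>\<^sub>v vs P"
  let ?a = "associator K M N P"
  show "?a \<in> linear_maps K (vs (ten (ten M N) P)) (vs (ten M (ten N P)))"
    unfolding vs_ten by (rule associator_linear_map) simp_all
  have l: "L ?D ?C ?a"
    by (rule associator_linear) simp_all
  note [simp] = l el_lin[OF l] lin_comp[OF l] lin_push_sw[OF _ _ l]
  fix t assume "t \<in>\<^sub>v vs (ten (ten M N) P)"
  then have t: "t \<in>\<^sub>v ?D" by simp
  show "?a (\<alpha> (ten (ten M N) P) t) = \<alpha> (ten M (ten N P)) (?a t)"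
    by (rule tensor_ext3[OF _ _ _ _ _ t, of ?C "\<lambda>t. ?a (\<alpha> (ten (ten M N) P) t)" "\<lambda>t. \<alpha> (ten M (ten N P)) (?a t)"])
      simp_all
  show "co (ten M (ten N P)) (?a t) = S (vs H) (vs (ten (ten M N) P)) (vs H \<otimes>\<^sub>v vs (ten M (ten N P)))
      (co (ten (ten M N) P) t) (\<lambda>x n. x \<otimes>\<langle>vs H, vs (ten M (ten N P))\<rangle> ?a n)"
    unfolding vs_ten
    by (rule tensor_ext3[OF _ _ _ _ _ t, of "vs H \<otimes>\<^sub>v ?C" "\<lambda>t. co (ten M (ten N P)) (?a t)"
          "\<lambda>t. S (vs H) ?D (vs H \<otimes>\<^sub>v ?C) (co (ten (ten M N) P) t) (\<lambda>x n. x \<otimes>\<langle>vs H, ?C\<rangle> ?a n)"])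
      simp_all
  fix h assume [simp]: "h \<in>\<^sub>v vs H"
  show "?a (ac (ten (ten M N) P) h t) = ac (ten M (ten N P)) h (?a t)"
    by (rule tensor_ext3[OF _ _ _ _ _ t, of ?C "\<lambda>t. ?a (ac (ten (ten M N) P) h t)" "\<lambda>t. ac (ten M (ten N P)) h (?a t)"])
      (simp_all add: De_coassoc)
qed simp_all

lemma associator_inv_mor:
  assumes [simp]: "ydm M" "ydm N" "ydm P"
  shows "associator_inv M N P \<in> mor (ten M (ten N P)) (ten (ten M N) P)"
  by (rule mor_inverse[OF _ _ associator_mor])
    (simp_all add: associator_inv_linear_map associator_inv_associator associator_associator_inv)

subsection \<open>The quasi-braiding\<close>

context
  fixes M N :: "('k, 'a) hom_yd"
  assumes M [simp]: "ydm M" and N [simp]: "ydm N"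
begin

text \<open>All twists cancel: what remains is the ordinary braiding of Yetter-Drinfeld modules, the
  coaction leg of m acting on n.\<close>

lemma braiding_eq:
  assumes "t \<in>\<^sub>v vs M \<otimes>\<^sub>v vs N"
  shows "yd_braiding K H M N t = S (vs M) (vs N) (vs N \<otimes>\<^sub>v vs M) t
    (\<lambda>m n. S (vs H) (vs M) (vs N \<otimes>\<^sub>v vs M) (co M m) (\<lambda>x p. ac N x n \<otimes>\<langle>vs N, vs M\<rangle> p))"
  using assms
  by (simp add: yd_braiding_def Let_def el_def[of t, symmetric]
      sweedler_eq_sw[of K "vs M" "vs N"] sweedler_eq_sw[of K "vs H" "vs M"] coact_eq act_eq)

lemma braiding_linear_map: "yd_braiding K H M N \<in> linear_maps K (vs M \<otimes>\<^sub>v vs N) (vs N \<otimes>\<^sub>v vs M)"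
proof -
  have "yd_braiding K H M N = (\<lambda>t \<in> carrier (vs M \<otimes>\<^sub>v vs N). yd_braiding K H M N t)"
    by (auto simp: yd_braiding_def Let_def intro: restrict_ext)
  also have "\<dots> \<in> linear_maps K (vs M \<otimes>\<^sub>v vs N) (vs N \<otimes>\<^sub>v vs M)"
    by (rule restrict_linear_map[OF _ braiding_eq]) simp_all
  finally show ?thesis .
qed

lemma braiding_linear: "L (vs M \<otimes>\<^sub>v vs N) (vs N \<otimes>\<^sub>v vs M) (yd_braiding K H M N)"
  using braiding_linear_map by (simp add: linear_maps_lin)

lemma braiding_pure [simp]:
  assumes "A = vs M" "B = vs N" "m \<in>\<^sub>v A" "n \<in>\<^sub>v B"
  shows "yd_braiding K H M N (m \<otimes>\<langle>A, B\<rangle> n) = S (vs H) A (B \<otimes>\<^sub>v A) (co M m) (\<lambda>x p. ac N x n \<otimes>\<langle>B, A\<rangle> p)"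
  using assms(3-) unfolding assms(1,2) by (simp add: braiding_eq)

text \<open>Linearity rests on the Yetter-Drinfeld condition of M. Colinearity rests on that of N,
  applied to the coaction leg of m as the acting element; coassociativity of M splits this leg
  before and reassembles it afterwards.\<close>

lemma braiding_mor: "yd_braiding K H M N \<in> mor (ten M N) (ten N M)"
proof (rule morI)
  let ?H = "vs H" and ?M = "vs M" and ?N = "vs N"
  let ?D = "?M \<otimes>\<^sub>v ?N" and ?C = "?N \<otimes>\<^sub>v ?M"
  let ?c = "yd_braiding K H M N"
  show "?c \<in> linear_maps K (vs (ten M N)) (vs (ten N M))"
    unfolding vs_ten by (rule braiding_linear_map)
  note l = braiding_linear
  note [simp] = l el_lin[OF l] lin_comp[OF l] lin_push_sw[OF _ _ l]
  fix t assume "t \<in>\<^sub>v vs (ten M N)"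
  then have t: "t \<in>\<^sub>v ?D" by simp
  show "?c (\<alpha> (ten M N) t) = \<alpha> (ten N M) (?c t)"
    by (rule tensor_ext[OF _ _ _ _ t, of ?C "\<lambda>t. ?c (\<alpha> (ten M N) t)" "\<lambda>t. \<alpha> (ten N M) (?c t)"]) simp_all
  have co: "co (ten N M) (?c (m \<otimes>\<langle>?M, ?N\<rangle> n))
      = S ?H ?D (?H \<otimes>\<^sub>v ?C) (co (ten M N) (m \<otimes>\<langle>?M, ?N\<rangle> n)) (\<lambda>x n. x \<otimes>\<langle>?H, ?C\<rangle> ?c n)"
    if [simp]: "m \<in>\<^sub>v ?M" "n \<in>\<^sub>v ?N" for m n
  proof -
    let ?U = "?H \<otimes>\<^sub>v ?C"
    have "co (ten N M) (?c (m \<otimes>\<langle>?M, ?N\<rangle> n))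
        = S ?H ?M ?U (co M m) (\<lambda>x p. S ?H ?N ?U (co N (ac N x n)) (\<lambda>y q. S ?H ?M ?U (co M p) (\<lambda>z r.
            \<alpha>inv H (y \<star> z) \<otimes>\<langle>?H, ?C\<rangle> (q \<otimes>\<langle>?N, ?M\<rangle> r))))"
      by simp
    also have "\<dots> = S ?H ?M ?U (co M m) (\<lambda>x p. S ?H ?M ?U (co M p) (\<lambda>z r. S ?H ?N ?U (co N (ac N x n)) (\<lambda>y q.
            \<alpha>inv H (y \<star> z) \<otimes>\<langle>?H, ?C\<rangle> (q \<otimes>\<langle>?N, ?M\<rangle> r))))"
      by (rule sw_cong[OF HOL.refl sw_swap]) simp_all
    also have "\<dots> = S ?H ?M ?U (co M m) (\<lambda>x r. S ?H ?H ?U (De x) (\<lambda>a b. S ?H ?N ?U (co N (ac N a n)) (\<lambda>y q.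
            \<alpha>inv H (y \<star> b) \<otimes>\<langle>?H, ?C\<rangle> (q \<otimes>\<langle>?N, ?M\<rangle> r))))"
      by (rule co_coassoc[symmetric]) simp_all
    also have "\<dots> = S ?H ?M ?U (co M m) (\<lambda>x r. S ?H ?H ?U (De x) (\<lambda>a b. S ?H ?N ?U (co N n) (\<lambda>y q.
            \<alpha>inv H (a \<star> y) \<otimes>\<langle>?H, ?C\<rangle> (ac N b q \<otimes>\<langle>?N, ?M\<rangle> r))))"
      by (rule sw_cong[OF HOL.refl yd]) simp_all
    also have "\<dots> = S ?H ?M ?U (co M m) (\<lambda>x p. S ?H ?M ?U (co M p) (\<lambda>z r. S ?H ?N ?U (co N n) (\<lambda>y q.
            \<alpha>inv H (x \<star> y) \<otimes>\<langle>?H, ?C\<rangle> (ac N z q \<otimes>\<langle>?N, ?M\<rangle> r))))"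
      by (rule co_coassoc) simp_all
    also have "\<dots> = S ?H ?M ?U (co M m) (\<lambda>x p. S ?H ?N ?U (co N n) (\<lambda>y q. S ?H ?M ?U (co M p) (\<lambda>z r.
            \<alpha>inv H (x \<star> y) \<otimes>\<langle>?H, ?C\<rangle> (ac N z q \<otimes>\<langle>?N, ?M\<rangle> r))))"
      by (rule sw_cong[OF HOL.refl sw_swap]) simp_all
    also have "\<dots> = S ?H ?D (?H \<otimes>\<^sub>v ?C) (co (ten M N) (m \<otimes>\<langle>?M, ?N\<rangle> n)) (\<lambda>x n. x \<otimes>\<langle>?H, ?C\<rangle> ?c n)"
      by simp
    finally show ?thesis .
  qed
  show "co (ten N M) (?c t) = S (vs H) (vs (ten M N)) (vs H \<otimes>\<^sub>v vs (ten N M)) (co (ten M N) t)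
      (\<lambda>x n. x \<otimes>\<langle>vs H, vs (ten N M)\<rangle> ?c n)"
    unfolding vs_ten
    by (rule tensor_ext[OF _ _ _ _ t, of "?H \<otimes>\<^sub>v ?C" "\<lambda>t. co (ten N M) (?c t)"
          "\<lambda>t. S ?H ?D (?H \<otimes>\<^sub>v ?C) (co (ten M N) t) (\<lambda>x n. x \<otimes>\<langle>?H, ?C\<rangle> ?c n)"])
      ((rule co; assumption) | simp)+
  fix h assume [simp]: "h \<in>\<^sub>v vs H"
  have act: "?c (ac (ten M N) h (m \<otimes>\<langle>?M, ?N\<rangle> n)) = ac (ten N M) h (?c (m \<otimes>\<langle>?M, ?N\<rangle> n))"
    if [simp]: "m \<in>\<^sub>v ?M" "n \<in>\<^sub>v ?N" for m n
  proof -
    have "?c (ac (ten M N) h (m \<otimes>\<langle>?M, ?N\<rangle> n)) = S ?H ?H ?C (De h) (\<lambda>a b.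
        S ?H ?M ?C (co M (ac M (\<alpha> H a) m)) (\<lambda>x p. ac N (x \<star> \<alpha> H b) n \<otimes>\<langle>?N, ?M\<rangle> p))"
      by simp
    also have "\<dots> = S ?H ?H ?C (De h) (\<lambda>a b.
        S ?H ?M ?C (co M m) (\<lambda>x p. ac N (\<alpha> H a \<star> x) n \<otimes>\<langle>?N, ?M\<rangle> ac M (\<alpha> H b) p))"
      by (rule yd_\<alpha>) simp_all
    also have "\<dots> = ac (ten N M) h (?c (m \<otimes>\<langle>?M, ?N\<rangle> n))"
      by (simp add: sw_swap[of K "vs H" "vs H" "vs H" "vs M"])
    finally show ?thesis .
  qed
  show "?c (ac (ten M N) h t) = ac (ten N M) h (?c t)"
    by (rule tensor_ext[OF _ _ _ _ t, of ?C "\<lambda>t. ?c (ac (ten M N) h t)" "\<lambda>t. ac (ten N M) h (?c t)"])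
      ((rule act; assumption) | simp)+
qed simp_all

end

section \<open>The category of Yetter-Drinfeld modules\<close>

text \<open>\<open>restrict_apply\<close> would turn identity arrows into case distinctions on
  \<open>carrier\<close>; the following rules, stated with \<open>\<in>\<^sub>v\<close>, replace
  it.\<close>

declare restrict_apply [simp del]

lemma restrict_id_el [simp]: "x \<in>\<^sub>v V \<Longrightarrow> (\<lambda>m \<in> carrier V. m) x = x"
  by (simp add: el_def restrict_apply)

lemma lin_restrict_id [simp]: "vspace V \<Longrightarrow> L V V (\<lambda>m \<in> carrier V. m)"
  using restrict_linear_map[OF lin_id, of V "\<lambda>m. m"] by (simp add: linear_maps_lin)

lemma compose_el [simp]: "x \<in>\<^sub>v V \<Longrightarrow> compose (carrier V) g f x = g (f x)"
  by (simp add: el_def compose_def restrict_apply)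

lemma compose_eqI:
  "(\<And>x. x \<in>\<^sub>v V \<Longrightarrow> g (f x) = g' (f' x)) \<Longrightarrow> compose (carrier V) g f = compose (carrier V) g' f'"
  by (auto simp: el_def compose_def intro: restrict_ext)

context
  fixes V W V' W' :: "('k, 'b) vect" and f g
  assumes f: "L V V' f" and g: "L W W' g"
begin

lemma tensor_map_L: "L (V \<otimes>\<^sub>v W) (V' \<otimes>\<^sub>v W') (tensor_map K V W V' W' f g)"
  using tensor_map_linear[OF f g] f[THEN lin_module(1)] f[THEN lin_module(2)] g[THEN lin_module(1)] g[THEN lin_module(2)]
  by (simp add: linear_maps_lin)

lemmas tensor_map_simps [simp] = tensor_map_pure[OF f g] tensor_map_L el_lin[OF tensor_map_L] lin_comp[OF tensor_map_L]
  lin_push_sw[OF _ _ tensor_map_L]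

end

context
  fixes M N P :: "('k, 'a) hom_yd" and A B
  assumes M: "hspace M" "hspace N" "hspace P" and AB: "A = (vs M \<otimes>\<^sub>v vs N) \<otimes>\<^sub>v vs P" "B = vs M \<otimes>\<^sub>v vs N \<otimes>\<^sub>v vs P"
begin

lemma associator_L: "L A B (associator K M N P)"
  unfolding AB by (rule associator_linear[OF M])

lemma associator_inv_L: "L B A (associator_inv M N P)"
  unfolding AB by (rule associator_inv_linear[OF M])

lemma associator_simps [simp]:
  "L A B (associator K M N P)" "t \<in>\<^sub>v A \<Longrightarrow> associator K M N P t \<in>\<^sub>v B" "L V A f \<Longrightarrow> L V B (\<lambda>x. associator K M N P (f x))"
  "L B A (associator_inv M N P)" "t \<in>\<^sub>v B \<Longrightarrow> associator_inv M N P t \<in>\<^sub>v A" "L V B f \<Longrightarrow> L V A (\<lambda>x. associator_inv M N P (f x))"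
  using el_lin[OF associator_L] lin_comp[OF associator_L] associator_L el_lin[OF associator_inv_L]
    lin_comp[OF associator_inv_L] associator_inv_L by blast+

end

lemma associator_sw [simp]:
  fixes M N P :: "('k, 'a) hom_yd"
  assumes "hspace M" "hspace N" "hspace P" "A = (vs M \<otimes>\<^sub>v vs N) \<otimes>\<^sub>v vs P" "vspace C" "vspace D" "t \<in>\<^sub>v C \<otimes>\<^sub>v D"
    "\<And>a b. a \<in>\<^sub>v C \<Longrightarrow> b \<in>\<^sub>v D \<Longrightarrow> f a b \<in>\<^sub>v A"
  shows "associator K M N P (S C D A t (\<lambda>a b. f a b))
    = S C D (vs M \<otimes>\<^sub>v vs N \<otimes>\<^sub>v vs P) t (\<lambda>a b. associator K M N P (f a b))"
  using lin_push_sw[OF assms(5,6) associator_linear[OF assms(1-3)]] assms(7,8) unfolding assms(4) by blast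

lemma associator_inv_sw [simp]:
  fixes M N P :: "('k, 'a) hom_yd"
  assumes "hspace M" "hspace N" "hspace P" "A = vs M \<otimes>\<^sub>v vs N \<otimes>\<^sub>v vs P" "vspace C" "vspace D" "t \<in>\<^sub>v C \<otimes>\<^sub>v D"
    "\<And>a b. a \<in>\<^sub>v C \<Longrightarrow> b \<in>\<^sub>v D \<Longrightarrow> f a b \<in>\<^sub>v A"
  shows "associator_inv M N P (S C D A t (\<lambda>a b. f a b))
    = S C D ((vs M \<otimes>\<^sub>v vs N) \<otimes>\<^sub>v vs P) t (\<lambda>a b. associator_inv M N P (f a b))"
  using lin_push_sw[OF assms(5,6) associator_inv_linear[OF assms(1-3)]] assms(7,8) unfolding assms(4) by blast

context
  fixes M N :: "('k, 'a) hom_yd" and A B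
  assumes M: "ydm M" and N: "ydm N" and AB: "A = vs M \<otimes>\<^sub>v vs N" "B = vs N \<otimes>\<^sub>v vs M"
begin

lemma braiding_L: "L A B (yd_braiding K H M N)"
  unfolding AB by (rule braiding_linear[OF M N])

lemma braiding_simps [simp]:
  "L A B (yd_braiding K H M N)" "t \<in>\<^sub>v A \<Longrightarrow> yd_braiding K H M N t \<in>\<^sub>v B" "L V A f \<Longrightarrow> L V B (\<lambda>x. yd_braiding K H M N (f x))"
  using el_lin[OF braiding_L] lin_comp[OF braiding_L] braiding_L by blast+

end

section \<open>Structure and axioms of the category\<close>

abbreviation \<Y> where "\<Y> \<equiv> YD K H"

lemma YD_simps [simp]:
  "Obj \<Y> = {M. ydm M}"
  "Arr \<Y> = {(M, f, N). ydm M \<and> ydm N \<and> f \<in> mor M N}"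
  "Dom \<Y> (M, f, N) = M"
  "Cod \<Y> (M, f, N) = N"
  "Id \<Y> M = (M, \<lambda>m \<in> elts M. m, M)"
  "Comp \<Y> (N', g, P) (M, f, N) = (M, compose (elts M) g f, P)"
  "TenO \<Y> M N = ten M N"
  "TenA \<Y> (M, f, N) (M', f', N') = (ten M M', tensor_map K (vs M) (vs M') (vs N) (vs N') f f', ten N N')"
  "Assoc \<Y> M N P = (ten (ten M N) P, associator K M N P, ten M (ten N P))"
  "Braid \<Y> M N = (ten M N, yd_braiding K H M N, ten N M)"
  by (simp_all add: YD_def linear_category_def ydm_def mor_def ten_def)

lemma Hom_YD [simp]: "f \<in> Hom \<Y> A B \<longleftrightarrow> (\<exists>f'. f = (A, f', B) \<and> ydm A \<and> ydm B \<and> f' \<in> mor A B)"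
  by (cases f) (auto simp: Hom_def)

lemma tensor_map_id:
  assumes "vspace A" "vspace B"
  shows "tensor_map K A B A B (\<lambda>m \<in> carrier A. m) (\<lambda>m \<in> carrier B. m) = (\<lambda>m \<in> carrier (A \<otimes>\<^sub>v B). m)"
proof (rule linear_maps_eqI)
  note [simp] = assms
  show "tensor_map K A B A B (\<lambda>m \<in> carrier A. m) (\<lambda>m \<in> carrier B. m) \<in> linear_maps K (A \<otimes>\<^sub>v B) (A \<otimes>\<^sub>v B)"
    by (rule tensor_map_linear) simp_all
  show "(\<lambda>m \<in> carrier (A \<otimes>\<^sub>v B). m) \<in> linear_maps K (A \<otimes>\<^sub>v B) (A \<otimes>\<^sub>v B)"
    by (rule restrict_linear_map[OF lin_id]) simp_all
  fix t assume t: "t \<in>\<^sub>v A \<otimes>\<^sub>v B"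
  show "tensor_map K A B A B (\<lambda>m \<in> carrier A. m) (\<lambda>m \<in> carrier B. m) t = (\<lambda>m \<in> carrier (A \<otimes>\<^sub>v B). m) t"
    by (rule tensor_ext[OF _ _ _ _ t, of "A \<otimes>\<^sub>v B"]) simp_all
qed

lemma tensor_map_compose:
  assumes [simp]: "L A B f" "L B C g" "L A' B' f'" "L B' C' g'"
  shows "tensor_map K A A' C C' (compose (carrier A) g f) (compose (carrier A') g' f') =
    compose (carrier (A \<otimes>\<^sub>v A')) (tensor_map K B B' C C' g g') (tensor_map K A A' B B' f f')"
proof (rule linear_maps_eqI)
  note [simp] = assms[THEN lin_module(1)] assms[THEN lin_module(2)] assms[THEN el_lin] assms[THEN lin_comp]
  have "compose (carrier A) g f \<in> linear_maps K A C" "compose (carrier A') g' f' \<in> linear_maps K A' C'"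
    unfolding compose_def by (rule restrict_linear_map[OF _ HOL.refl]; simp)+
  then have [simp]: "L A C (compose (carrier A) g f)" "L A' C' (compose (carrier A') g' f')"
    by (simp_all add: linear_maps_lin)
  show "tensor_map K A A' C C' (compose (carrier A) g f) (compose (carrier A') g' f') \<in> linear_maps K (A \<otimes>\<^sub>v A') (C \<otimes>\<^sub>v C')"
    by (rule tensor_map_linear) simp_all
  show "compose (carrier (A \<otimes>\<^sub>v A')) (tensor_map K B B' C C' g g') (tensor_map K A A' B B' f f') \<in> linear_maps K (A \<otimes>\<^sub>v A') (C \<otimes>\<^sub>v C')"
    unfolding compose_def by (rule restrict_linear_map[OF _ HOL.refl]) simp
  fix t assume t: "t \<in>\<^sub>v A \<otimes>\<^sub>v A'"
  have "tensor_map K A A' C C' (compose (carrier A) g f) (compose (carrier A') g' f') t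
      = tensor_map K B B' C C' g g' (tensor_map K A A' B B' f f' t)"
    by (rule tensor_ext[OF _ _ _ _ t, of "C \<otimes>\<^sub>v C'" _ "\<lambda>t. tensor_map K B B' C C' g g' (tensor_map K A A' B B' f f' t)"])
      simp_all
  then show "tensor_map K A A' C C' (compose (carrier A) g f) (compose (carrier A') g' f') t
      = compose (carrier (A \<otimes>\<^sub>v A')) (tensor_map K B B' C C' g g') (tensor_map K A A' B B' f f') t"
    using t by simp
qed

lemma mor_funcset: "ydm M \<Longrightarrow> ydm N \<Longrightarrow> f \<in> mor M N \<Longrightarrow> f \<in> elts M \<rightarrow> elts N \<and> f \<in> extensional (elts M)"
  using mor_linear_map[of M N f] by (auto simp: linear_maps_def PiE_def)

lemma category_YD: "category \<Y>"
proof
  fix f assume "f \<in> Arr \<Y>"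
  then show "Dom \<Y> f \<in> Obj \<Y>" "Cod \<Y> f \<in> Obj \<Y>" by (cases f, simp)+
next
  fix A assume "A \<in> Obj \<Y>"
  then show "Id \<Y> A \<in> Hom \<Y> A A" by (simp add: mor_id)
next
  fix f A B g D assume "f \<in> Hom \<Y> A B" "g \<in> Hom \<Y> B D"
  then show "Comp \<Y> g f \<in> Hom \<Y> A D" by (auto intro: mor_comp)
next
  fix f A B assume "f \<in> Hom \<Y> A B"
  then obtain f' where "f = (A, f', B)" "f' \<in> elts A \<rightarrow> elts B" "f' \<in> extensional (elts A)"
    using mor_funcset by auto
  then show "Comp \<Y> f (Id \<Y> A) = f" "Comp \<Y> (Id \<Y> B) f = f"
    by (simp_all add: compose_Id Id_compose)
next
  fix f A B g D h E assume "f \<in> Hom \<Y> A B" "g \<in> Hom \<Y> B D" "h \<in> Hom \<Y> D E"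
  then obtain f' g' h' where "f = (A, f', B)" "g = (B, g', D)" "h = (D, h', E)" "f' \<in> elts A \<rightarrow> elts B"
    using mor_funcset by auto
  then show "Comp \<Y> (Comp \<Y> h g) f = Comp \<Y> h (Comp \<Y> g f)"
    by (auto simp: compose_def restrict_apply intro!: restrict_ext)
qed

lemma inverse_associator:
  assumes [simp]: "ydm U" "ydm V" "ydm W"
  shows "inverse_arrows \<Y> (Assoc \<Y> U V W) (ten U (ten V W), associator_inv U V W, ten (ten U V) W)"
  using associator_inv_mor[of U V W]
  by (auto simp: inverse_arrows_def el_def compose_def restrict_apply intro!: restrict_ext associator_inv_associator associator_associator_inv)

lemma Inv_associator:
  assumes [simp]: "ydm U" "ydm V" "ydm W"
  shows "Inv \<Y> (Assoc \<Y> U V W) = (ten U (ten V W), associator_inv U V W, ten (ten U V) W)"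
proof -
  interpret category \<Y> by (rule category_YD)
  have "Assoc \<Y> U V W \<in> Hom \<Y> (ten (ten U V) W) (ten U (ten V W))"
    by (simp add: associator_mor)
  then show ?thesis
    by (rule Inv_eqI) (rule inverse_associator; simp)
qed

lemma quasi_braided_YD: "quasi_braided_pre_tensor_category \<Y>"
proof -
  interpret category \<Y> by (rule category_YD)
  show ?thesis
  proof
    fix A B assume "A \<in> Obj \<Y>" "B \<in> Obj \<Y>"
    then show "TenO \<Y> A B \<in> Obj \<Y>" "TenA \<Y> (Id \<Y> A) (Id \<Y> B) = Id \<Y> (TenO \<Y> A B)"
      "Braid \<Y> A B \<in> Hom \<Y> (TenO \<Y> A B) (TenO \<Y> B A)"
      by (simp_all add: tensor_map_id braiding_mor)
  next
    fix f A B g A' B' assume "f \<in> Hom \<Y> A B" "g \<in> Hom \<Y> A' B'"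
    then show "TenA \<Y> f g \<in> Hom \<Y> (TenO \<Y> A A') (TenO \<Y> B B')"
      by (auto intro: mor_tensor)
  next
    fix f A B g D f' A' B' g' D'
    assume "f \<in> Hom \<Y> A B" "g \<in> Hom \<Y> B D" "f' \<in> Hom \<Y> A' B'" "g' \<in> Hom \<Y> B' D'"
    then show "TenA \<Y> (Comp \<Y> g f) (Comp \<Y> g' f') = Comp \<Y> (TenA \<Y> g g') (TenA \<Y> f f')"
      using mor_linear by (auto intro!: tensor_map_compose)
  next
    fix U V W assume U: "U \<in> Obj \<Y>" "V \<in> Obj \<Y>" "W \<in> Obj \<Y>"
    then show "Assoc \<Y> U V W \<in> Hom \<Y> (TenO \<Y> (TenO \<Y> U V) W) (TenO \<Y> U (TenO \<Y> V W))"
      by (simp add: associator_mor)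
    show "\<exists>g. inverse_arrows \<Y> (Assoc \<Y> U V W) g"
      by (rule exI, rule inverse_associator) (use U in simp_all)
  next
    fix f U U' g V V' h W W'
    assume "f \<in> Hom \<Y> U U'" "g \<in> Hom \<Y> V V'" "h \<in> Hom \<Y> W W'"
    then obtain f' g' h' where fgh: "f = (U, f', U')" "g = (V, g', V')" "h = (W, h', W')"
      and [simp]: "ydm U" "ydm U'" "ydm V" "ydm V'" "ydm W" "ydm W'"
      and f: "f' \<in> mor U U'" and g: "g' \<in> mor V V'" and h: "h' \<in> mor W W'"
      by auto
    note [simp] = mor_linear[OF _ _ f] mor_linear[OF _ _ g] mor_linear[OF _ _ h] mor_el[OF _ _ f] mor_el[OF _ _ g] mor_el[OF _ _ h]
      mor_\<alpha>inv[OF _ _ f] mor_\<alpha>[OF _ _ h]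
    let ?T1 = "tensor_map K (vs U \<otimes>\<^sub>v vs V) (vs W) (vs U' \<otimes>\<^sub>v vs V') (vs W') (tensor_map K (vs U) (vs V) (vs U') (vs V') f' g') h'"
    let ?T2 = "tensor_map K (vs U) (vs V \<otimes>\<^sub>v vs W) (vs U') (vs V' \<otimes>\<^sub>v vs W') f' (tensor_map K (vs V) (vs W) (vs V') (vs W') g' h')"
    \<comment> \<open>Naturality amounts to f' commuting with \<alpha>^-1 and h' with
      \<alpha>.\<close>
    have "associator K U' V' W' (?T1 t) = ?T2 (associator K U V W t)" if t: "t \<in>\<^sub>v (vs U \<otimes>\<^sub>v vs V) \<otimes>\<^sub>v vs W" for t
      by (rule tensor_ext3[OF _ _ _ _ _ t, of "vs U' \<otimes>\<^sub>v vs V' \<otimes>\<^sub>v vs W'" "\<lambda>t. associator K U' V' W' (?T1 t)" "\<lambda>t. ?T2 (associator K U V W t)"])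
        simp_all
    then show "Comp \<Y> (Assoc \<Y> U' V' W') (TenA \<Y> (TenA \<Y> f g) h) = Comp \<Y> (TenA \<Y> f (TenA \<Y> g h)) (Assoc \<Y> U V W)"
      by (auto simp: fgh intro: compose_eqI)
  next
    fix U V W X assume "U \<in> Obj \<Y>" "V \<in> Obj \<Y>" "W \<in> Obj \<Y>" "X \<in> Obj \<Y>"
    then have [simp]: "ydm U" "ydm V" "ydm W" "ydm X" by simp_all
    let ?D = "((vs U \<otimes>\<^sub>v vs V) \<otimes>\<^sub>v vs W) \<otimes>\<^sub>v vs X" and ?C = "vs U \<otimes>\<^sub>v vs V \<otimes>\<^sub>v vs W \<otimes>\<^sub>v vs X"
    let ?T1 = "tensor_map K (vs U) ((vs V \<otimes>\<^sub>v vs W) \<otimes>\<^sub>v vs X) (vs U) (vs V \<otimes>\<^sub>v vs W \<otimes>\<^sub>v vs X) (\<lambda>m \<in> elts U. m) (associator K V W X)"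
    let ?T2 = "tensor_map K ((vs U \<otimes>\<^sub>v vs V) \<otimes>\<^sub>v vs W) (vs X) (vs U \<otimes>\<^sub>v vs V \<otimes>\<^sub>v vs W) (vs X) (associator K U V W) (\<lambda>m \<in> elts X. m)"
    let ?f = "\<lambda>t. ?T1 (associator K U (ten V W) X (?T2 t))" and ?g = "\<lambda>t. associator K U V (ten W X) (associator K (ten U V) W X t)"
    \<comment> \<open>Up to bracketing both sides apply \<alpha>^-2, \<alpha>^-1, \<alpha> and
      \<alpha>^2 to the four factors.\<close>
    have "?f t = ?g t" if t: "t \<in>\<^sub>v ?D" for t
    proof (rule tensor_ext[OF _ _ _ _ t, of ?C ?f ?g])
      fix s x assume s: "s \<in>\<^sub>v (vs U \<otimes>\<^sub>v vs V) \<otimes>\<^sub>v vs W" and [simp]: "x \<in>\<^sub>v vs X"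
      show "?f (s \<otimes>\<langle>(vs U \<otimes>\<^sub>v vs V) \<otimes>\<^sub>v vs W, vs X\<rangle> x) = ?g (s \<otimes>\<langle>(vs U \<otimes>\<^sub>v vs V) \<otimes>\<^sub>v vs W, vs X\<rangle> x)"
        by (rule tensor_ext3[OF _ _ _ _ _ s, of ?C "\<lambda>s. ?f (s \<otimes>\<langle>(vs U \<otimes>\<^sub>v vs V) \<otimes>\<^sub>v vs W, vs X\<rangle> x)"
              "\<lambda>s. ?g (s \<otimes>\<langle>(vs U \<otimes>\<^sub>v vs V) \<otimes>\<^sub>v vs W, vs X\<rangle> x)"]) simp_all
    qed simp_all
    then show "Comp \<Y> (TenA \<Y> (Id \<Y> U) (Assoc \<Y> V W X)) (Comp \<Y> (Assoc \<Y> U (TenO \<Y> V W) X) (TenA \<Y> (Assoc \<Y> U V W) (Id \<Y> X)))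
        = Comp \<Y> (Assoc \<Y> U V (TenO \<Y> W X)) (Assoc \<Y> (TenO \<Y> U V) W X)"
      by (auto intro: compose_eqI)
  next
    fix f V V' g W W'
    assume "f \<in> Hom \<Y> V V'" "g \<in> Hom \<Y> W W'"
    then obtain f' g' where fg: "f = (V, f', V')" "g = (W, g', W')"
      and [simp]: "ydm V" "ydm V'" "ydm W" "ydm W'"
      and f: "f' \<in> mor V V'" and g: "g' \<in> mor W W'"
      by auto
    note [simp] = mor_linear[OF _ _ f] mor_linear[OF _ _ g] mor_el[OF _ _ f] mor_el[OF _ _ g] mor_lin[OF _ _ f] mor_lin[OF _ _ g]
      mor_co[OF _ _ f] mor_ac[OF _ _ g]
    let ?T1 = "tensor_map K (vs V) (vs W) (vs V') (vs W') f' g'"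
    let ?T2 = "tensor_map K (vs W) (vs V) (vs W') (vs V') g' f'"
    \<comment> \<open>Colinearity of f' and linearity of g' are used: the coaction is taken on V and
      acts on W.\<close>
    have "yd_braiding K H V' W' (?T1 t) = ?T2 (yd_braiding K H V W t)" if t: "t \<in>\<^sub>v vs V \<otimes>\<^sub>v vs W" for t
      by (rule tensor_ext[OF _ _ _ _ t, of "vs W' \<otimes>\<^sub>v vs V'" "\<lambda>t. yd_braiding K H V' W' (?T1 t)" "\<lambda>t. ?T2 (yd_braiding K H V W t)"])
        simp_all
    then show "Comp \<Y> (Braid \<Y> V' W') (TenA \<Y> f g) = Comp \<Y> (TenA \<Y> g f) (Braid \<Y> V W)"
      by (auto simp: fg intro: compose_eqI)
  next
    fix U V W assume "U \<in> Obj \<Y>" "V \<in> Obj \<Y>" "W \<in> Obj \<Y>"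
    then have [simp]: "ydm U" "ydm V" "ydm W" by simp_all
    let ?T1 = "tensor_map K (vs V) (vs U \<otimes>\<^sub>v vs W) (vs V) (vs W \<otimes>\<^sub>v vs U) (\<lambda>m \<in> elts V. m) (yd_braiding K H U W)"
    let ?T2 = "tensor_map K (vs U \<otimes>\<^sub>v vs V) (vs W) (vs V \<otimes>\<^sub>v vs U) (vs W) (yd_braiding K H U V) (\<lambda>m \<in> elts W. m)"
    let ?f = "\<lambda>t. associator K V W U (yd_braiding K H U (ten V W) (associator K U V W t))"
    let ?g = "\<lambda>t. ?T1 (associator K V U W (?T2 t))"
    \<comment> \<open>The coaction leg of u acts on V \<otimes> W through its comultiplication; by
      coassociativity of U this is two successive coactions, as on the right side.\<close>
    have "?f t = ?g t" if t: "t \<in>\<^sub>v (vs U \<otimes>\<^sub>v vs V) \<otimes>\<^sub>v vs W" for t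
      by (rule tensor_ext3[OF _ _ _ _ _ t, of "vs V \<otimes>\<^sub>v vs W \<otimes>\<^sub>v vs U" ?f ?g]) (simp_all add: co_coassoc)
    then show "Comp \<Y> (Assoc \<Y> V W U) (Comp \<Y> (Braid \<Y> U (TenO \<Y> V W)) (Assoc \<Y> U V W))
        = Comp \<Y> (TenA \<Y> (Id \<Y> V) (Braid \<Y> U W)) (Comp \<Y> (Assoc \<Y> V U W) (TenA \<Y> (Braid \<Y> U V) (Id \<Y> W)))"
      by (auto intro: compose_eqI)
    let ?T3 = "tensor_map K (vs U \<otimes>\<^sub>v vs W) (vs V) (vs W \<otimes>\<^sub>v vs U) (vs V) (yd_braiding K H U W) (\<lambda>m \<in> elts V. m)"
    let ?T4 = "tensor_map K (vs U) (vs V \<otimes>\<^sub>v vs W) (vs U) (vs W \<otimes>\<^sub>v vs V) (\<lambda>m \<in> elts U. m) (yd_braiding K H V W)"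
    let ?f = "\<lambda>t. associator_inv W U V (yd_braiding K H (ten U V) W (associator_inv U V W t))"
    let ?g = "\<lambda>t. ?T3 (associator_inv U W V (?T4 t))"
    \<comment> \<open>The coaction leg of U \<otimes> V is a product, and acting by a product is
      acting twice. The sums over the coactions of u and v only come in a different order.\<close>
    have "?f t = ?g t" if t: "t \<in>\<^sub>v vs U \<otimes>\<^sub>v vs V \<otimes>\<^sub>v vs W" for t
      by (rule tensor_ext3'[OF _ _ _ _ _ t, of "(vs W \<otimes>\<^sub>v vs U) \<otimes>\<^sub>v vs V" ?f ?g])
        (simp_all add: sw_swap[of K "vs H" "vs V" "vs H" "vs U"])
    then show "Comp \<Y> (Inv \<Y> (Assoc \<Y> W U V)) (Comp \<Y> (Braid \<Y> (TenO \<Y> U V) W) (Inv \<Y> (Assoc \<Y> U V W)))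
        = Comp \<Y> (TenA \<Y> (Braid \<Y> U W) (Id \<Y> V)) (Comp \<Y> (Inv \<Y> (Assoc \<Y> U W V)) (TenA \<Y> (Id \<Y> U) (Braid \<Y> V W)))"
      \<comment> \<open>The associativity constraint is kept folded, so that the rule for its
        inverse still matches.\<close>
      by (auto simp: Inv_associator simp del: YD_simps(9) intro: compose_eqI)
  qed
qed

end

section \<open>Modules over a quasitriangular Hom-bialgebra\<close>

locale quasitriangular_hom_bialgebra = bijective_hom_bialgebra K H
  for K :: "('k, 'r) ring_scheme" and H :: "('k, 'a) hom_bialg" +
  fixes R :: "'a univ"
  assumes quasi: "quasitriangular K H R"
    and R_invariant: "tensor_map K (vs H) (vs H) (vs H) (vs H) (\<alpha> H) (\<alpha> H) R = R"
begin

section \<open>Quasitriangularity in untwisted form\<close>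

lemma
  shows R_carrier: "R \<in> carrier (vs H \<otimes>\<^sub>v vs H)"
    and R_raw1: "sweedler (HHH K H) R (\<lambda>R1 R2. sweedler (HHH K H) (\<Delta> H R1) (\<lambda>x y.
         x \<otimes>\<langle>vs H, HH K H\<rangle> (y \<otimes>\<langle>vs H, vs H\<rangle> \<alpha> H R2)))
       = sweedler (HHH K H) R (\<lambda>R1 R2. sweedler (HHH K H) R (\<lambda>r1 r2.
           \<alpha> H R1 \<otimes>\<langle>vs H, HH K H\<rangle> (\<alpha> H r1 \<otimes>\<langle>vs H, vs H\<rangle> hmult K H R2 r2)))"
    and R_raw2: "sweedler (HHH K H) R (\<lambda>R1 R2. \<alpha> H R1 \<otimes>\<langle>vs H, HH K H\<rangle> \<Delta> H R2)
       = sweedler (HHH K H) R (\<lambda>R1 R2. sweedler (HHH K H) R (\<lambda>r1 r2.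
           hmult K H R1 r1 \<otimes>\<langle>vs H, HH K H\<rangle> (\<alpha> H r2 \<otimes>\<langle>vs H, vs H\<rangle> \<alpha> H R2)))"
    and R_raw3: "\<forall>h \<in> elts H.
        sweedler (HH K H) (\<Delta> H h) (\<lambda>h1 h2. sweedler (HH K H) R (\<lambda>R1 R2.
          hmult K H h2 R1 \<otimes>\<langle>vs H, vs H\<rangle> hmult K H h1 R2))
        = sweedler (HH K H) R (\<lambda>R1 R2. sweedler (HH K H) (\<Delta> H h) (\<lambda>h1 h2.
            hmult K H R1 h1 \<otimes>\<langle>vs H, vs H\<rangle> hmult K H R2 h2))"
  using quasi unfolding quasitriangular_def by - (elim conjE, assumption)+

lemma el_R [simp]: "R \<in>\<^sub>v vs H \<otimes>\<^sub>v vs H"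
  using R_carrier by (simp add: el_def)

lemma R_\<alpha>: "S (vs H) (vs H) (vs H \<otimes>\<^sub>v vs H) R (\<lambda>x y. \<alpha> H x \<otimes>\<langle>vs H, vs H\<rangle> \<alpha> H y) = R"
  using R_invariant by (simp add: tensor_map_eq)

text \<open>Invariance of R makes it possible to insert or delete \<alpha> on both legs of one copy
  of R at once.\<close>

lemma sw_R_\<alpha>:
  assumes "vspace U" "bilin K (vs H) (vs H) U (\<lambda>x y. f x y)"
  shows "S (vs H) (vs H) U R (\<lambda>x y. f (\<alpha> H x) (\<alpha> H y)) = S (vs H) (vs H) U R (\<lambda>x y. f x y)"
proof -
  have "S (vs H) (vs H) U (S (vs H) (vs H) (vs H \<otimes>\<^sub>v vs H) R (\<lambda>x y. \<alpha> H x \<otimes>\<langle>vs H, vs H\<rangle> \<alpha> H y)) (\<lambda>x y. f x y)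
      = S (vs H) (vs H) U R (\<lambda>x y. f (\<alpha> H x) (\<alpha> H y))"
    using assms by simp
  then show ?thesis unfolding R_\<alpha> by simp
qed

text \<open>In leg notation the classical identity (De \<otimes> id)(R) = R_13 R_23, carried to U
  along the map that f induces.\<close>

lemma R_De_left:
  assumes "vspace U" and f: "trilin K (vs H) (vs H) (vs H) U (\<lambda>a b c. f a b c)"
  shows "S (vs H) (vs H) U R (\<lambda>x y. S (vs H) (vs H) U (De x) (\<lambda>a b. f a b y))
    = S (vs H) (vs H) U R (\<lambda>x y. S (vs H) (vs H) U R (\<lambda>x' y'. f x x' (y \<star> y')))"
proof -
  let ?H = "vs H"
  let ?HHH = "?H \<otimes>\<^sub>v ?H \<otimes>\<^sub>v ?H"
  note [simp] = trilinD[OF f] assms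
  have "S ?H ?H ?HHH R (\<lambda>x y. S ?H ?H ?HHH (De x) (\<lambda>a b. \<alpha> H a \<otimes>\<langle>?H, ?H \<otimes>\<^sub>v ?H\<rangle> (\<alpha> H b \<otimes>\<langle>?H, ?H\<rangle> \<alpha> H y)))
      = S ?H ?H ?HHH R (\<lambda>x y. S ?H ?H ?HHH R (\<lambda>x' y'. \<alpha> H x \<otimes>\<langle>?H, ?H \<otimes>\<^sub>v ?H\<rangle> (\<alpha> H x' \<otimes>\<langle>?H, ?H\<rangle> (\<alpha> H y \<star> \<alpha> H y'))))"
    (is "?l = ?r")
    using R_raw1 by (simp add: sweedler_eq_sw[of K ?H ?H] \<Delta>_eq \<mu>_eq)
  \<comment> \<open>After expansion each of the three legs carries exactly one \<alpha>, so
    \<alpha>^-1 on every leg yields the untwisted identity.\<close>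
  then have "S ?H (?H \<otimes>\<^sub>v ?H) ?HHH ?l (\<lambda>a t. S ?H ?H ?HHH t (\<lambda>b c. \<alpha>inv H a \<otimes>\<langle>?H, ?H \<otimes>\<^sub>v ?H\<rangle> (\<alpha>inv H b \<otimes>\<langle>?H, ?H\<rangle> \<alpha>inv H c)))
      = S ?H (?H \<otimes>\<^sub>v ?H) ?HHH ?r (\<lambda>a t. S ?H ?H ?HHH t (\<lambda>b c. \<alpha>inv H a \<otimes>\<langle>?H, ?H \<otimes>\<^sub>v ?H\<rangle> (\<alpha>inv H b \<otimes>\<langle>?H, ?H\<rangle> \<alpha>inv H c)))"
    by (simp only:)
  then have "S ?H ?H ?HHH R (\<lambda>x y. S ?H ?H ?HHH (De x) (\<lambda>a b. a \<otimes>\<langle>?H, ?H \<otimes>\<^sub>v ?H\<rangle> (b \<otimes>\<langle>?H, ?H\<rangle> y)))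
      = S ?H ?H ?HHH R (\<lambda>x y. S ?H ?H ?HHH R (\<lambda>x' y'. x \<otimes>\<langle>?H, ?H \<otimes>\<^sub>v ?H\<rangle> (x' \<otimes>\<langle>?H, ?H\<rangle> (y \<star> y'))))"
    (is "?l' = ?r'")
    by simp
  then have "S ?H (?H \<otimes>\<^sub>v ?H) U ?l' (\<lambda>a t. S ?H ?H U t (\<lambda>b c. f a b c))
      = S ?H (?H \<otimes>\<^sub>v ?H) U ?r' (\<lambda>a t. S ?H ?H U t (\<lambda>b c. f a b c))"
    by (simp only:)
  then show ?thesis by simp
qed

text \<open>The classical (id \<otimes> De)(R) = R_13 R_12; as H is not assumed unital, the legs are
  written out.\<close>

lemma R_De_right:
  assumes "vspace U" and f: "trilin K (vs H) (vs H) (vs H) U (\<lambda>a b c. f a b c)"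
  shows "S (vs H) (vs H) U R (\<lambda>x y. S (vs H) (vs H) U (De y) (\<lambda>a b. f x a b))
    = S (vs H) (vs H) U R (\<lambda>x y. S (vs H) (vs H) U R (\<lambda>x' y'. f (x \<star> x') y' y))"
proof -
  let ?H = "vs H"
  let ?HHH = "?H \<otimes>\<^sub>v ?H \<otimes>\<^sub>v ?H"
  note [simp] = trilinD[OF f] assms
  have "S ?H ?H ?HHH R (\<lambda>x y. \<alpha> H x \<otimes>\<langle>?H, ?H \<otimes>\<^sub>v ?H\<rangle> De (\<alpha> H y))
      = S ?H ?H ?HHH R (\<lambda>x y. S ?H ?H ?HHH R (\<lambda>x' y'. (\<alpha> H x \<star> \<alpha> H x') \<otimes>\<langle>?H, ?H \<otimes>\<^sub>v ?H\<rangle> (\<alpha> H y' \<otimes>\<langle>?H, ?H\<rangle> \<alpha> H y)))"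
    (is "?l = ?r")
    using R_raw2 by (simp add: sweedler_eq_sw[of K ?H ?H] \<Delta>_eq \<mu>_eq)
  then have "S ?H (?H \<otimes>\<^sub>v ?H) ?HHH ?l (\<lambda>a t. S ?H ?H ?HHH t (\<lambda>b c. \<alpha>inv H a \<otimes>\<langle>?H, ?H \<otimes>\<^sub>v ?H\<rangle> (\<alpha>inv H b \<otimes>\<langle>?H, ?H\<rangle> \<alpha>inv H c)))
      = S ?H (?H \<otimes>\<^sub>v ?H) ?HHH ?r (\<lambda>a t. S ?H ?H ?HHH t (\<lambda>b c. \<alpha>inv H a \<otimes>\<langle>?H, ?H \<otimes>\<^sub>v ?H\<rangle> (\<alpha>inv H b \<otimes>\<langle>?H, ?H\<rangle> \<alpha>inv H c)))"
    by (simp only:)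
  then have "S ?H ?H ?HHH R (\<lambda>x y. S ?H ?H ?HHH (De y) (\<lambda>a b. x \<otimes>\<langle>?H, ?H \<otimes>\<^sub>v ?H\<rangle> (a \<otimes>\<langle>?H, ?H\<rangle> b)))
      = S ?H ?H ?HHH R (\<lambda>x y. S ?H ?H ?HHH R (\<lambda>x' y'. (x \<star> x') \<otimes>\<langle>?H, ?H \<otimes>\<^sub>v ?H\<rangle> (y' \<otimes>\<langle>?H, ?H\<rangle> y)))"
    (is "?l' = ?r'")
    by simp
  then have "S ?H (?H \<otimes>\<^sub>v ?H) U ?l' (\<lambda>a t. S ?H ?H U t (\<lambda>b c. f a b c))
      = S ?H (?H \<otimes>\<^sub>v ?H) U ?r' (\<lambda>a t. S ?H ?H U t (\<lambda>b c. f a b c))"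
    by (simp only:)
  then show ?thesis by simp
qed

text \<open>The classical intertwining of De with its opposite by R. The outer sum is over
  \<open>De h\<close> on both sides, as in the Yetter-Drinfeld condition.\<close>

lemma R_De_commute:
  assumes "vspace U" and h: "h \<in>\<^sub>v vs H" and f: "bilin K (vs H) (vs H) U (\<lambda>a b. f a b)"
  shows "S (vs H) (vs H) U (De h) (\<lambda>a b. S (vs H) (vs H) U R (\<lambda>x y. f (b \<star> x) (a \<star> y)))
    = S (vs H) (vs H) U (De h) (\<lambda>a b. S (vs H) (vs H) U R (\<lambda>x y. f (x \<star> a) (y \<star> b)))"
proof -
  let ?H = "vs H"
  let ?HH = "?H \<otimes>\<^sub>v ?H"
  note [simp] = bilinD[OF f] assms lin_comp[of K "vs H" U "\<lambda>x. f x _"] lin_comp[of K "vs H" U "f _"]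
  have "sweedler ?HH (\<Delta> H (\<alpha>inv H h)) (\<lambda>h1 h2. sweedler ?HH R (\<lambda>R1 R2.
          hmult K H h2 R1 \<otimes>\<langle>?H, ?H\<rangle> hmult K H h1 R2))
        = sweedler ?HH R (\<lambda>R1 R2. sweedler ?HH (\<Delta> H (\<alpha>inv H h)) (\<lambda>h1 h2.
            hmult K H R1 h1 \<otimes>\<langle>?H, ?H\<rangle> hmult K H R2 h2))"
    using R_raw3 \<alpha>inv_el[OF hspace_H h] unfolding el_def by blast
  then have "S ?H ?H ?HH (De h) (\<lambda>a b. S ?H ?H ?HH R (\<lambda>x y. (\<alpha> H b \<star> \<alpha> H x) \<otimes>\<langle>?H, ?H\<rangle> (\<alpha> H a \<star> \<alpha> H y)))
      = S ?H ?H ?HH R (\<lambda>x y. S ?H ?H ?HH (De h) (\<lambda>a b. (\<alpha> H x \<star> \<alpha> H a) \<otimes>\<langle>?H, ?H\<rangle> (\<alpha> H y \<star> \<alpha> H b)))"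
    (is "?l = ?r")
    by (simp add: sweedler_eq_sw[of K ?H ?H] \<Delta>_eq \<mu>_eq)
  then have "S ?H ?H ?HH ?l (\<lambda>a b. \<alpha>inv H a \<otimes>\<langle>?H, ?H\<rangle> \<alpha>inv H b) = S ?H ?H ?HH ?r (\<lambda>a b. \<alpha>inv H a \<otimes>\<langle>?H, ?H\<rangle> \<alpha>inv H b)"
    by (simp only:)
  then have "S ?H ?H ?HH (De h) (\<lambda>a b. S ?H ?H ?HH R (\<lambda>x y. (b \<star> x) \<otimes>\<langle>?H, ?H\<rangle> (a \<star> y)))
      = S ?H ?H ?HH R (\<lambda>x y. S ?H ?H ?HH (De h) (\<lambda>a b. (x \<star> a) \<otimes>\<langle>?H, ?H\<rangle> (y \<star> b)))"
    (is "?l' = ?r'")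
    by simp
  then have "S ?H ?H U ?l' (\<lambda>a b. f a b) = S ?H ?H U ?r' (\<lambda>a b. f a b)"
    by (simp only:)
  then have "S ?H ?H U (De h) (\<lambda>a b. S ?H ?H U R (\<lambda>x y. f (b \<star> x) (a \<star> y)))
      = S ?H ?H U R (\<lambda>x y. S ?H ?H U (De h) (\<lambda>a b. f (x \<star> a) (y \<star> b)))"
    by simp
  also have "\<dots> = S ?H ?H U (De h) (\<lambda>a b. S ?H ?H U R (\<lambda>x y. f (x \<star> a) (y \<star> b)))"
    by (rule sw_swap) simp_all
  finally show ?thesis .
qed

section \<open>The coaction defined by R\<close>

definition rcoact :: "('k, 'a) hom_yd \<Rightarrow> 'a univ \<Rightarrow> 'a univ" where
  "rcoact N = (\<lambda>n \<in> elts N. sweedler (vs H \<otimes>\<^sub>v vs N) R (\<lambda>x y. \<alpha> H y \<otimes>\<langle>vs H, vs N\<rangle> act N (x \<otimes>\<langle>vs H, vs N\<rangle> n)))"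

text \<open>Describes the modules with their R-coaction inside the record type of Yetter-Drinfeld
  modules, so that the theory of \<open>ten\<close>, \<open>co\<close> and \<open>mor\<close>
  applies to them directly.\<close>

definition robj :: "('k, 'a) hom_yd \<Rightarrow> bool" where
  "robj N \<longleftrightarrow> hmod N \<and> coact N = rcoact N"

lemma robj_hmod [simp]: "robj N \<Longrightarrow> hmod N"
  by (simp add: robj_def)

lemma rcoact_eq:
  assumes "hmod N" "n \<in>\<^sub>v vs N"
  shows "rcoact N n = S (vs H) (vs H) (vs H \<otimes>\<^sub>v vs N) R (\<lambda>x y. \<alpha> H y \<otimes>\<langle>vs H, vs N\<rangle> ac N (\<alpha> H x) (\<alpha> N n))"
  using assms by (simp add: rcoact_def restrict_apply el_def[of n, symmetric] sweedler_eq_sw[of K "vs H" "vs H"] act_eq)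

lemma rcoact_linear_map: "hmod N \<Longrightarrow> rcoact N \<in> linear_maps K (vs N) (vs H \<otimes>\<^sub>v vs N)"
proof -
  assume [simp]: "hmod N"
  have "rcoact N = (\<lambda>n \<in> elts N. rcoact N n)"
    by (auto simp: rcoact_def restrict_apply intro: restrict_ext)
  also have "\<dots> \<in> linear_maps K (vs N) (vs H \<otimes>\<^sub>v vs N)"
    by (rule restrict_linear_map[OF _ rcoact_eq]) simp_all
  finally show ?thesis .
qed

context
  fixes N :: "('k, 'a) hom_yd"
  assumes N [simp]: "robj N"
begin

lemma robj_hcoact [simp]: "hcoact N"
  using rcoact_linear_map[of N] N unfolding hcoact_def robj_def by simp

lemma co_robj:
  assumes [simp]: "n \<in>\<^sub>v vs N"
  shows "co N n = S (vs H) (vs H) (vs H \<otimes>\<^sub>v vs N) R (\<lambda>x y. y \<otimes>\<langle>vs H, vs N\<rangle> ac N x n)"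
proof -
  have "coact N = rcoact N" using N unfolding robj_def by blast
  then have "co N n = S (vs H) (vs H) (vs H \<otimes>\<^sub>v vs N) R (\<lambda>x y. \<alpha> H y \<otimes>\<langle>vs H, vs N\<rangle> ac N (\<alpha> H x) n)"
    by (simp add: co_def rcoact_eq)
  also have "\<dots> = S (vs H) (vs H) (vs H \<otimes>\<^sub>v vs N) R (\<lambda>x y. y \<otimes>\<langle>vs H, vs N\<rangle> ac N x n)"
    by (rule sw_R_\<alpha>) simp_all
  finally show ?thesis .
qed

text \<open>Compatibility with \<alpha> is the invariance of R. For coassociativity
  \<open>R_De_right\<close> splits the coaction leg R^2, and the product of the two first legs acts
  like two successive actions; exchanging the copies of R gives the order of the iterated
  coaction.\<close>

lemma robj_hcomod [simp]: "hcomod N"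
proof (rule hcomodI)
  note [simp] = co_robj
  let ?H = "vs H"
  let ?HHN = "?H \<otimes>\<^sub>v ?H \<otimes>\<^sub>v vs N"
  fix n assume [simp]: "n \<in>\<^sub>v vs N"
  have "S ?H ?H (?H \<otimes>\<^sub>v vs N) R (\<lambda>x y. \<alpha> H y \<otimes>\<langle>?H, vs N\<rangle> ac N (\<alpha> H x) (\<alpha> N n))
      = S ?H ?H (?H \<otimes>\<^sub>v vs N) R (\<lambda>x y. y \<otimes>\<langle>?H, vs N\<rangle> ac N x (\<alpha> N n))"
    by (rule sw_R_\<alpha>) simp_all
  then show "co N (\<alpha> N n) = S ?H (vs N) (?H \<otimes>\<^sub>v vs N) (co N n) (\<lambda>x n. \<alpha> H x \<otimes>\<langle>?H, vs N\<rangle> \<alpha> N n)"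
    by simp
  have "S ?H (vs N) ?HHN (co N n) (\<lambda>x n. S ?H ?H ?HHN (De x)
          (\<lambda>a b. a \<otimes>\<langle>?H, ?H \<otimes>\<^sub>v vs N\<rangle> (b \<otimes>\<langle>?H, vs N\<rangle> n)))
      = S ?H ?H ?HHN R (\<lambda>x y. S ?H ?H ?HHN (De y) (\<lambda>a b. a \<otimes>\<langle>?H, ?H \<otimes>\<^sub>v vs N\<rangle> (b \<otimes>\<langle>?H, vs N\<rangle> ac N x n)))"
    by simp
  also have "\<dots> = S ?H ?H ?HHN R (\<lambda>x y. S ?H ?H ?HHN R (\<lambda>x' y'. y' \<otimes>\<langle>?H, ?H \<otimes>\<^sub>v vs N\<rangle> (y \<otimes>\<langle>?H, vs N\<rangle> ac N (x \<star> x') n)))"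
    by (rule R_De_right) simp_all
  also have "\<dots> = S ?H ?H ?HHN R (\<lambda>x' y'. S ?H ?H ?HHN R (\<lambda>x y. y' \<otimes>\<langle>?H, ?H \<otimes>\<^sub>v vs N\<rangle> (y \<otimes>\<langle>?H, vs N\<rangle> ac N (x \<star> x') n)))"
    by (rule sw_swap) simp_all
  also have "\<dots> = S ?H (vs N) ?HHN (co N n) (\<lambda>x n. x \<otimes>\<langle>?H, ?H \<otimes>\<^sub>v vs N\<rangle> co N n)"
    by simp
  finally show "S ?H (vs N) ?HHN (co N n) (\<lambda>x n. S ?H ?H ?HHN (De x)
          (\<lambda>a b. a \<otimes>\<langle>?H, ?H \<otimes>\<^sub>v vs N\<rangle> (b \<otimes>\<langle>?H, vs N\<rangle> n)))
      = S ?H (vs N) ?HHN (co N n) (\<lambda>x n. x \<otimes>\<langle>?H, ?H \<otimes>\<^sub>v vs N\<rangle> co N n)" .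
qed simp

text \<open>This is \<open>R_De_commute\<close> for the bilinear map that sends (u, v) to v
  \<otimes> u n: the first leg of R acts, the second is the coaction leg.\<close>

lemma robj_ydm [simp]: "ydm N"
  unfolding ydm_iff[OF robj_hmod[OF N] robj_hcomod]
proof (intro allI impI)
  note [simp] = co_robj
  let ?H = "vs H"
  let ?HN = "?H \<otimes>\<^sub>v vs N"
  fix h n assume [simp]: "h \<in>\<^sub>v ?H" "n \<in>\<^sub>v vs N"
  have "S ?H ?H ?HN (De h) (\<lambda>a b. S ?H ?H ?HN R (\<lambda>x y. (a \<star> y) \<otimes>\<langle>?H, vs N\<rangle> ac N (b \<star> x) n))
      = S ?H ?H ?HN (De h) (\<lambda>a b. S ?H ?H ?HN R (\<lambda>x y. (y \<star> b) \<otimes>\<langle>?H, vs N\<rangle> ac N (x \<star> a) n))"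
    by (rule R_De_commute) simp_all
  then show "S ?H ?H ?HN (De h) (\<lambda>a b. S ?H (vs N) ?HN (co N (ac N a n)) (\<lambda>x n. (x \<star> b) \<otimes>\<langle>?H, vs N\<rangle> n))
      = S ?H ?H ?HN (De h) (\<lambda>a b. S ?H (vs N) ?HN (co N n) (\<lambda>x n. (a \<star> x) \<otimes>\<langle>?H, vs N\<rangle> ac N b n))"
    by simp
qed

end

text \<open>The coaction is the action of R^1 with R^2 as a spectator, so a linear map that commutes
  with the action is colinear. This gives fullness of the embedding.\<close>

lemma mor_robj:
  assumes [simp]: "robj M" "robj N"
  shows "mor M N = module_morphisms K H M N"
proof -
  have "f \<in> comodule_morphisms K H M N" if f: "f \<in> module_morphisms K H M N" for f
  proof -
    have lin: "f \<in> linear_maps K (vs M) (vs N)"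
      and \<alpha>: "f (\<alpha> M m) = \<alpha> N (f m)" if "m \<in>\<^sub>v vs M" for m
      using f that by (auto simp: module_morphisms_def el_def)
    have act: "f (act M (h \<otimes>\<langle>vs H, vs M\<rangle> m)) = act N (h \<otimes>\<langle>vs H, vs N\<rangle> f m)" if "h \<in>\<^sub>v vs H" "m \<in>\<^sub>v vs M" for h m
      using f that by (auto simp: module_morphisms_def el_def)
    have l: "L (vs M) (vs N) f"
      using f by (simp add: module_morphisms_def linear_maps_lin)
    note [simp] = l el_lin[OF l] lin_comp[OF l] lin_push_sw[OF _ _ l]
    have [simp]: "f (ac M h m) = ac N h (f m)" if "h \<in>\<^sub>v vs H" "m \<in>\<^sub>v vs M" for h m
    proof (rule \<alpha>_inject[of N])
      show "\<alpha> N (f (ac M h m)) = \<alpha> N (ac N h (f m))"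
        using act[OF that] that by (simp add: act_eq \<alpha>[symmetric] del: \<alpha>_ac)
    qed (use that in simp_all)
    have "\<forall>m. m \<in>\<^sub>v vs M \<longrightarrow> co N (f m) = S (vs H) (vs M) (vs H \<otimes>\<^sub>v vs N) (co M m) (\<lambda>x n. x \<otimes>\<langle>vs H, vs N\<rangle> f n)"
      by (simp add: co_robj)
    then have "\<forall>m. m \<in>\<^sub>v vs M \<longrightarrow> tensor_map K (vs H) (vs M) (vs H) (vs N) (\<lambda>h. h) f (coact M m) = coact N (f m)"
      by (subst co_hom_iff) (simp_all add: \<alpha>)
    then show ?thesis
      using f by (simp add: comodule_morphisms_def module_morphisms_def el_def)
  qed
  then show ?thesis
    unfolding mor_def by blast
qed

text \<open>Coacting on both factors involves two copies of R whose second legs are multiplied,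
  which by \<open>R_De_left\<close> is one copy of R whose first leg acts through its
  comultiplication.\<close>

lemma robj_ten [simp]:
  assumes [simp]: "robj M" "robj N"
  shows "robj (ten M N)"
proof -
  let ?H = "vs H" and ?P = "vs M \<otimes>\<^sub>v vs N"
  let ?HP = "?H \<otimes>\<^sub>v ?P"
  have 1: "coact (ten M N) \<in> linear_maps K ?P ?HP" "rcoact (ten M N) \<in> linear_maps K ?P ?HP"
    using coact_linear_map[of "ten M N"] rcoact_linear_map[of "ten M N"] by simp_all
  have l: "L ?P ?HP (coact (ten M N))" "L ?P ?HP (rcoact (ten M N))"
    using 1 by (simp_all add: linear_maps_lin)
  have "coact (ten M N) = rcoact (ten M N)"
  proof (rule linear_maps_eqI[OF 1])
    fix t assume t: "t \<in>\<^sub>v ?P"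
    show "coact (ten M N) t = rcoact (ten M N) t"
    proof (rule tensor_ext[OF _ _ l t])
      fix m n assume [simp]: "m \<in>\<^sub>v vs M" "n \<in>\<^sub>v vs N"
      have "coact (ten M N) (m \<otimes>\<langle>vs M, vs N\<rangle> n) = S ?H ?H ?HP R (\<lambda>x y. S ?H ?H ?HP R (\<lambda>x' y'.
          (y \<star> y') \<otimes>\<langle>?H, ?P\<rangle> (ac M (\<alpha> H x) (\<alpha> M m) \<otimes>\<langle>vs M, vs N\<rangle> ac N (\<alpha> H x') (\<alpha> N n))))"
        by (simp add: coact_ten_eq co_robj)
      \<comment> \<open>Inserting \<alpha> into both copies of R, one after the other, raises the
        actions to \<alpha>^2 and the H-leg to \<alpha>, the powers that occur in
        \<open>rcoact\<close> of the tensor product.\<close>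
      also have "\<dots> = S ?H ?H ?HP R (\<lambda>x y. S ?H ?H ?HP R (\<lambda>x' y'.
          (\<alpha> H y \<star> y') \<otimes>\<langle>?H, ?P\<rangle> (ac M (\<alpha> H (\<alpha> H x)) (\<alpha> M m) \<otimes>\<langle>vs M, vs N\<rangle> ac N (\<alpha> H x') (\<alpha> N n))))"
        by (rule sw_R_\<alpha>[symmetric]) simp_all
      also have "\<dots> = S ?H ?H ?HP R (\<lambda>x y. S ?H ?H ?HP R (\<lambda>x' y'.
          (\<alpha> H y \<star> \<alpha> H y') \<otimes>\<langle>?H, ?P\<rangle> (ac M (\<alpha> H (\<alpha> H x)) (\<alpha> M m) \<otimes>\<langle>vs M, vs N\<rangle> ac N (\<alpha> H (\<alpha> H x')) (\<alpha> N n))))"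
        by (rule sw_cong[OF HOL.refl sw_R_\<alpha>[symmetric]]) simp_all
      also have "\<dots> = S ?H ?H ?HP R (\<lambda>x y. S ?H ?H ?HP R (\<lambda>x' y'.
          \<alpha> H (y \<star> y') \<otimes>\<langle>?H, ?P\<rangle> (ac M (\<alpha> H (\<alpha> H x)) (\<alpha> M m) \<otimes>\<langle>vs M, vs N\<rangle> ac N (\<alpha> H (\<alpha> H x')) (\<alpha> N n))))"
        by simp
      also have "\<dots> = S ?H ?H ?HP R (\<lambda>x y. S ?H ?H ?HP (De x) (\<lambda>a b.
          \<alpha> H y \<otimes>\<langle>?H, ?P\<rangle> (ac M (\<alpha> H (\<alpha> H a)) (\<alpha> M m) \<otimes>\<langle>vs M, vs N\<rangle> ac N (\<alpha> H (\<alpha> H b)) (\<alpha> N n))))"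
        by (rule R_De_left[symmetric]) simp_all
      also have "\<dots> = rcoact (ten M N) (m \<otimes>\<langle>vs M, vs N\<rangle> n)"
        by (simp add: rcoact_eq[of "ten M N", unfolded vs_ten])
      finally show "coact (ten M N) (m \<otimes>\<langle>vs M, vs N\<rangle> n) = rcoact (ten M N) (m \<otimes>\<langle>vs M, vs N\<rangle> n)" .
    qed simp_all
  qed
  then show ?thesis
    unfolding robj_def by simp
qed

section \<open>The embedding of modules into Yetter-Drinfeld modules\<close>

abbreviation \<M> where "\<M> \<equiv> Mod K H R"
abbreviation F where "F \<equiv> as_yd K H R"
abbreviation G where "G \<equiv> as_yd_arrow K H R"

lemma F_simps [simp]: "vs (F M) = vs M" "\<alpha> (F M) = \<alpha> M" "act (F M) = act M" "\<alpha>inv (F M) = \<alpha>inv M" "ac (F M) = ac M"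
  by (simp_all add: as_yd_def \<alpha>inv_def ac_def[abs_def])

text \<open>The property depends on three record fields only; this passes between the two record
  types, for modules with and without a coaction.\<close>

lemma hmod_cong:
  fixes M :: "('k, 'a, 'z) hom_module_scheme" and N :: "('k, 'a, 'y) hom_module_scheme"
  assumes "vs M = vs N" "\<alpha> M = \<alpha> N" "act M = act N"
  shows "hmod M \<longleftrightarrow> hmod N"
  unfolding hmod_def left_module_def \<alpha>_bij_def assms ..

lemma robj_F [simp]:
  assumes "hmod M"
  shows "robj (F M)"
proof -
  have "hmod (F M)"
    using assms hmod_cong[of "F M" M] by simp
  then show ?thesis
    unfolding robj_def rcoact_def by (simp add: as_yd_def R_coact_def Let_def)
qed

definition mten :: "('k, 'a) hom_module \<Rightarrow> ('k, 'a) hom_module \<Rightarrow> ('k, 'a) hom_module" where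
  "mten M N = \<lparr>vs = vs M \<otimes>\<^sub>v vs N, \<alpha> = tensor_\<alpha> K M N, act = tensor_act K H M N\<rparr>"

lemma mten_fields: "vs (mten M N) = vs (ten (F M) (F N))" "\<alpha> (mten M N) = \<alpha> (ten (F M) (F N))"
  "act (mten M N) = act (ten (F M) (F N))"
  by (simp_all add: mten_def ten_def tensor_\<alpha>_def tensor_act_def)

lemma hmod_mten [simp]: "hmod M \<Longrightarrow> hmod N \<Longrightarrow> hmod (mten M N)"
  using robj_hmod[OF robj_ten[OF robj_F robj_F]] hmod_cong[OF mten_fields] by blast

text \<open>The subcategory has to have the same tensor product by equality of records. Only the
  coaction fields are in question, and both are the R-coaction by \<open>robj_ten\<close>.\<close>

lemma F_mten [simp]:
  assumes "hmod M" "hmod N"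
  shows "F (mten M N) = ten (F M) (F N)"
proof -
  have "coact (ten (F M) (F N)) = rcoact (ten (F M) (F N))"
    using robj_ten[OF robj_F robj_F] assms unfolding robj_def by blast
  moreover have "coact (F (mten M N)) = rcoact (F (mten M N))"
    using robj_F[OF hmod_mten] assms unfolding robj_def by blast
  moreover have "rcoact (F (mten M N)) = rcoact (ten (F M) (F N))"
    by (simp only: rcoact_def F_simps mten_fields)
  ultimately show ?thesis
    by (intro hom_yd.equality) (simp_all only: F_simps mten_fields, simp_all)
qed

text \<open>The \<alpha>^-1 on each factor untwists the action there, which gives R^2 n \<otimes>
  R^1 m with untwisted actions; this is also the ordinary braiding with the R-coaction
  inserted.\<close>

lemma R_braiding_eq:
  assumes [simp]: "hmod M" "hmod N"
  shows "R_braiding K H R M N = yd_braiding K H (F M) (F N)"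
proof -
  have "R_braiding K H R M N = (\<lambda>t \<in> carrier (vs M \<otimes>\<^sub>v vs N). R_braiding K H R M N t)"
    by (auto simp: R_braiding_def Let_def restrict_apply intro: restrict_ext)
  also have "\<dots> = (\<lambda>t \<in> carrier (vs M \<otimes>\<^sub>v vs N). yd_braiding K H (F M) (F N) t)"
  proof (rule restrict_ext)
    fix t assume "t \<in> carrier (vs M \<otimes>\<^sub>v vs N)"
    then have t: "t \<in>\<^sub>v vs M \<otimes>\<^sub>v vs N" by (simp add: el_def)
    then have "R_braiding K H R M N t = S (vs M) (vs N) (vs N \<otimes>\<^sub>v vs M) t (\<lambda>m n.
        S (vs H) (vs H) (vs N \<otimes>\<^sub>v vs M) R (\<lambda>x y. ac N y n \<otimes>\<langle>vs N, vs M\<rangle> ac M x m))"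
      by (simp add: R_braiding_def Let_def restrict_apply el_def[of t, symmetric]
          sweedler_eq_sw[of K "vs H" "vs H"] sweedler_eq_sw[of K "vs M" "vs N"] act_eq del: \<alpha>_ac)
    also have "\<dots> = yd_braiding K H (F M) (F N) t"
      using t by (simp add: braiding_eq[of "F M" "F N", unfolded F_simps] co_robj[of "F M", unfolded F_simps])
    finally show "R_braiding K H R M N t = yd_braiding K H (F M) (F N) t" .
  qed
  also have "\<dots> = yd_braiding K H (F M) (F N)"
    by (auto simp: yd_braiding_def Let_def restrict_apply intro: restrict_ext)
  finally show ?thesis .
qed

lemma associator_F [simp]: "associator K (F M) (F N) (F P) = associator K M N P"
  by (simp add: associator_def Let_def)

lemma G_simps [simp]: "G (M, f, N) = (F M, f, F N)"
  by (simp add: as_yd_arrow_def)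

lemma F_inj: "inj F"
proof (rule injI)
  fix M N assume "F M = F N"
  then have "vs (F M) = vs (F N)" "\<alpha> (F M) = \<alpha> (F N)" "act (F M) = act (F N)"
    by simp_all
  then show "M = N" by (intro hom_module.equality) simp_all
qed

text \<open>Arrows are described by \<open>mor\<close> of the images instead of
  \<open>module_morphisms\<close>, which is legitimate by \<open>mor_robj\<close>. The embedding
  then acts on hom-sets by relabelling source and target.\<close>

lemma Mod_simps [simp]:
  "Obj \<M> = {M. hmod M}"
  "Arr \<M> = {(M, f, N). hmod M \<and> hmod N \<and> f \<in> mor (F M) (F N)}"
  "Dom \<M> (M, f, N) = M"
  "Cod \<M> (M, f, N) = N"
  "Id \<M> M = (M, \<lambda>m \<in> elts M. m, M)"
  "Comp \<M> (N', g, P) (M, f, N) = (M, compose (elts M) g f, P)"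
  "TenO \<M> M N = mten M N"
  "TenA \<M> (M, f, N) (M', f', N') = (mten M M', tensor_map K (vs M) (vs M') (vs N) (vs N') f f', mten N N')"
  "Assoc \<M> M N P = (mten (mten M N) P, associator K M N P, mten M (mten N P))"
  "Braid \<M> M N = (mten M N, R_braiding K H R M N, mten N M)"
  by (auto simp: Mod_def linear_category_def hmod_def[symmetric] mten_def mor_robj module_morphisms_def)

lemma Hom_Mod [simp]: "f \<in> Hom \<M> A B \<longleftrightarrow> (\<exists>f'. f = (A, f', B) \<and> hmod A \<and> hmod B \<and> f' \<in> mor (F A) (F B))"
  by (cases f) (auto simp: Hom_def)

lemma full_embedding: "full_embedding \<M> \<Y> F G"
proof -
  interpret D: quasi_braided_pre_tensor_category \<Y> by (rule quasi_braided_YD)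
  show ?thesis
  proof
    fix f assume "f \<in> Arr \<M>"
    then show "Dom \<M> f \<in> Obj \<M>" "Cod \<M> f \<in> Obj \<M>" by auto
  next
    fix A assume "A \<in> Obj \<M>"
    then have [simp]: "hmod A" by simp
    show "F A \<in> Obj \<Y>" "Id \<M> A \<in> Hom \<M> A A" "G (Id \<M> A) = Id \<Y> (F A)"
      using mor_id[of "F A"] by simp_all
    fix B assume "B \<in> Obj \<M>"
    then have [simp]: "hmod B" by simp
    have "G (A, f, B) \<in> Hom \<Y> (F A) (F B) \<longleftrightarrow> (A, f, B) \<in> Hom \<M> A B" for f
      by simp
    \<comment> \<open>The inverse keeps the underlying map and restores the modules A and B as its
      ends.\<close>
    then show "bij_betw G (Hom \<M> A B) (Hom \<Y> (F A) (F B))"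
      by (intro bij_betwI[where g = "\<lambda>(_, f, _). (A, f, B)"]) auto
    show "A \<diamondop>\<^bsub>\<M>\<^esub> B \<in> Obj \<M>" "F (A \<diamondop>\<^bsub>\<M>\<^esub> B) = F A \<diamondop>\<^bsub>\<Y>\<^esub> F B"
      by simp_all
    show "Braid \<M> A B \<in> Hom \<M> (A \<diamondop>\<^bsub>\<M>\<^esub> B) (B \<diamondop>\<^bsub>\<M>\<^esub> A)" "G (Braid \<M> A B) = Braid \<Y> (F A) (F B)"
      by (simp_all add: R_braiding_eq braiding_mor)
    fix E assume "E \<in> Obj \<M>"
    then have [simp]: "hmod E" by simp
    show "Assoc \<M> A B E \<in> Hom \<M> ((A \<diamondop>\<^bsub>\<M>\<^esub> B) \<diamondop>\<^bsub>\<M>\<^esub> E) (A \<diamondop>\<^bsub>\<M>\<^esub> (B \<diamondop>\<^bsub>\<M>\<^esub> E))"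
      using associator_mor[of "F A" "F B" "F E"] by simp
    show "G (Assoc \<M> A B E) = Assoc \<Y> (F A) (F B) (F E)"
      by simp
  next
    fix f A B g E assume "f \<in> Hom \<M> A B" "g \<in> Hom \<M> B E"
    then show "g \<cdot>\<^bsub>\<M>\<^esub> f \<in> Hom \<M> A E" "G (g \<cdot>\<^bsub>\<M>\<^esub> f) = G g \<cdot>\<^bsub>\<Y>\<^esub> G f"
      using mor_comp[of "F A" "F B" "F E"] by auto
  next
    fix f A B g A' B' assume "f \<in> Hom \<M> A B" "g \<in> Hom \<M> A' B'"
    then show "f \<bowtie>\<^bsub>\<M>\<^esub> g \<in> Hom \<M> (A \<diamondop>\<^bsub>\<M>\<^esub> A') (B \<diamondop>\<^bsub>\<M>\<^esub> B')"
      using mor_tensor[of "F A" "F B" "F A'" "F B'"] by auto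
  next
    fix f g assume "f \<in> Arr \<M>" "g \<in> Arr \<M>"
    then show "G (f \<bowtie>\<^bsub>\<M>\<^esub> g) = G f \<bowtie>\<^bsub>\<Y>\<^esub> G g" by auto
  qed
qed

lemma subcategory: "quasi_braided_pre_tensor_subcategory \<M> \<Y> F G"
proof -
  interpret E: full_embedding \<M> \<Y> F G by (rule full_embedding)
  interpret C: quasi_braided_pre_tensor_category \<M> by (rule E.quasi_braided_C)
  show ?thesis
  proof
    show "inj_on F (Obj \<M>)"
      using F_inj by (rule inj_on_subset) simp
    show "inj_on G (Arr \<M>)"
      using F_inj by (auto simp: inj_on_def)
  qed (fact E.obj E.Fa_hom E.id_eq E.comp_eq E.tenO_eq E.tenA_eq E.assoc_eq E.braid_eq)+
qed

end

theorem theorem3p9: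
  fixes K :: "('k, 'r) ring_scheme"
    and H :: "('k, 'a) hom_bialg"
    and R :: "'a univ"
  assumes "field K"
    and "quasitriangular K H R"
    and "\<alpha>_bij H"
    and "tensor_map K (vs H) (vs H) (vs H) (vs H) (\<alpha> H) (\<alpha> H) R = R"
  shows "quasi_braided_pre_tensor_subcategory (Mod K H R) (YD K H) (as_yd K H R) (as_yd_arrow K H R)"
proof -
  have "hom_bialgebra K H"
    using assms(2) unfolding quasitriangular_def by blast
  then interpret quasitriangular_hom_bialgebra K H R
    using assms by unfold_locales
  show ?thesis by (rule subcategory)
qed

end
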